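(* Let $\mathfrak{g}$ be the $n$-dimensional Lie algebra of a Lie group, $\gamma=\frac{\partial}{\partial t}+\gamma^i\frac{\partial}{\partial w^i}$ a reduced vector field on $M=\mathbb{R}\times\mathfrak{g}$, and $A\to M$ the IP Lie algebroid with one-forms $\Gamma^0,\Psi^i,\Theta^i$ as in the context. Let $\Sigma^0=\mathrm{span}\{\omega^{ij}\mid 1\le i,j\le n\}$, with $\omega^{ij}=\frac12(\Psi^i\wedge\Theta^j+\Psi^j\wedge\Theta^i)$, and suppose that $\langle\Sigma^0\rangle_{\mathrm{alg}}$ is a differential ideal. Let $\mathcal{I}=\langle\sigma_{ij}\rangle$ be the differential ideal generated by the one-forms $$\sigma_{ij}=\delta s_{ij}-(s_{ki}\lambda_j^k+s_{kj}\lambda_i^k)\Gamma^0+P_{ijl}\Psi^l+\Big[\tfrac12\Big(s_{ki}C_{jl}^k+s_{kj}C_{il}^k-s_{kl}\frac{\partial^2\gamma^k}{\partial w^i\partial w^j}\Big)+Q_{ijl}\Big]\Theta^l$$ on the $p$-prolongation $\overline{A}\to\overline{M}$ of the IP Lie algebroid, where $p\colon\overline{M}\to M$ is the trivial bundle with coordinates $(t,w^i,s_{ij},P_{ijk},Q_{ijk})$ on $\overline{M}$. A solution $(k_{ij})$ to the reduced Helmholtz conditions exists if and only if there exists an integral manifold $i\colon M\to\overline{M}$, $$(t,w)\longmapsto\left(t,w,s_{ij}=\bar s_{ij}(t,w),P_{ijk}=\overline{P}_{ijk}(t,w),Q_{ijk}=\overline{Q}_{ijk}(t,w)\right)$$ of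 $\mathcal{I}$ with $\det(\bar s_{ij})\neq0$.
   Context: Summation convention. $\{E_i\}$ is a basis of $\mathfrak{g}$, $[E_i,E_j]=C_{ij}^kE_k$, $w^i$ the linear coordinates, $\gamma^i\in C^\infty(M)$. Set $$\lambda_i^j=\tfrac12\Big(w^kC_{ki}^j-\frac{\partial\gamma^j}{\partial w^i}\Big),\qquad\phi_i^j=-w^kC_{ki}^l\frac{\partial\gamma^j}{\partial w^l}-\gamma^kC_{ik}^j-\gamma(\lambda_i^j)-\lambda_i^k\lambda_k^j.$$ Reduced Helmholtz conditions for a matrix $(k_{ij})$ of smooth functions on $M$: $\det(k_{ij})\neq0$, $k_{ij}=k_{ji}$, $\gamma(k_{ij})-k_{kj}\lambda_i^k-k_{ik}\lambda_j^k=0$, $k_{ki}\phi_j^k=k_{kj}\phi_i^k$, $\frac{\partial k_{jk}}{\partial w^i}=\frac{\partial k_{ik}}{\partial w^j}$. IP Lie algebroid: the trivial vector bundle $A=M\times(\mathbb{R}\times\mathfrak{g}\times\mathfrak{g})\to M$ with basis of sections $T_0(t,w)=(t,w,1,0,0)$, $e_i(t,w)=(t,w,0,E_i,0)$, $W_i(t,w)=(t,w,0,0,E_i)$; anchor $\rho(T_0)=\frac{\partial}{\partial t}$, $\rho(e_i)=w^kC_{ki}^j\frac{\partial}{\partial w^j}$, $\rho(W_i)=\frac{\partial}{\partial w^i}$; bracket determined by $\llbracket T_0,e_i\rrbracket=\llbracket T_0,W_i\rrbracket=0$, $\llbracket e_i,e_j\rrbracket=C_{ij}^ke_k$, $\llbracket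 e_i,W_j\rrbracket=C_{ij}^kW_k$, $\llbracket W_i,W_j\rrbracket=0$ and the Leibniz rule. Put $\Gamma_0=T_0+w^je_j+\gamma^jW_j$, $H_i=e_i-\lambda_i^jW_j$; $\{\Gamma_0,W_i,H_i\}$ is a basis of sections, with dual basis $\{\Gamma^0,\Psi^i,\Theta^i\}\subset\Lambda^1(A)$. For any Lie algebroid, $\Lambda^q$ denotes $q$-forms (sections of the $q$-th exterior power of the dual bundle), and $\delta$ is the Lie algebroid exterior derivative, given by $\delta f(\sigma)=\rho(\sigma)f$ and the usual Koszul formula with the anchor and bracket. $\langle\cdot\rangle_{\mathrm{alg}}$ is the smallest graded (algebraic) ideal containing the given forms, $\langle\cdot\rangle$ the smallest differential ideal (algebraic ideal closed under $\delta$) containing them. "span" is over $C^\infty(M)$. The manifold $\overline{M}$ is the product of $M$ with the space of fiber coordinates $(s_{ij},P_{ijk},Q_{ijk})$, where $s_{ij}$ is symmetric in $ij$, and $P_{ijk},Q_{ijk}$ are totally symmetric in $ijk$; in particular $\bar s_{ij}=\bar s_{ji}$ and $\overline{P}_{ijk},\overline{Q}_{ijk}$ are totally symmetric for every section. The $p$-prolongation Lie algebroid is $\overline{A}=\{(a_m,\bar v_{\bar m})\in A\times\mathrm{T}\overline{M}\mid\rho(a_m)=\mathrm{T}p(\bar v_{\bar m})\}\to\overline{M}$, with anchor $\bar\rho(a_m,\bar v_{\bar m})=\bar v_{\bar m}$ and bracket $\llbracket(\sigma_1,X_1),(\sigma_2,X_2)\rrbracket=(\llbracket\sigma_1,\sigma_2\rrbracket^A,[X_1,X_2])$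 on sections with $\sigma_i\in\Gamma(A)$, extended by Leibniz. One-forms on $A$ are regarded as one-forms on $\overline{A}$ via the projection $P\colon\overline{A}\to A$, $(a_m,\bar v_{\bar m})\mapsto a_m$. Integral manifolds: for a section $i$ of $p$, put $I\colon A\to\overline{A}$, $I(a_m)=(a_m,\mathrm{T}i(\rho(a_m)))$. The pullback $I^*$ is $(I^*\bar f)(m)=\bar f(i(m))$, $(I^*\bar\theta)_m(a_m)=\bar\theta_{i(m)}(I(a_m))$ on functions and one-forms, extended linearly and compatibly with $\wedge$. The section $i$ is an integral manifold of a differential ideal $\mathcal{I}$ of forms on $\overline{A}$ if $I^*\theta=0$ for all $\theta\in\mathcal{I}$. *)

theory Defs
  imports "HOL-Analysis.Analysis" "HOL-Library.Multiset"
begin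

section \<open>Smooth maps\<close>

primrec Ck :: "nat \<Rightarrow> ('a::real_normed_vector \<Rightarrow> 'b::real_normed_vector) \<Rightarrow> bool" where
  "Ck 0 f \<longleftrightarrow> continuous_on UNIV f"
| "Ck (Suc k) f \<longleftrightarrow> (\<forall>x. f differentiable (at x)) \<and> (\<forall>v. Ck k (\<lambda>x. frechet_derivative f (at x) v))"

definition smooth :: "('a::real_normed_vector \<Rightarrow> 'b::real_normed_vector) \<Rightarrow> bool" where
  "smooth f \<longleftrightarrow> (\<forall>k. Ck k f)"

definition vf_bracket :: "('a::real_normed_vector \<Rightarrow> 'a) \<Rightarrow> ('a \<Rightarrow> 'a) \<Rightarrow> 'a \<Rightarrow> 'a" where
  "vf_bracket X Y x = frechet_derivative Y (at x) (X x) - frechet_derivative X (at x) (Y x)"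


section \<open>Lie algebroids and their exterior calculus\<close>

text \<open>The base manifold is a (Euclidean) vector space \<open>'m\<close>, and the vector bundle is a subbundle
  of the trivial bundle with fibre \<open>'f\<close>; \<open>fiber L x\<close> is its fibre over \<open>x\<close>. The tangent space of the
  base at any point is identified with \<open>'m\<close>.\<close>

record ('m, 'f) algebroid =
  fiber :: "'m \<Rightarrow> 'f set"
  anchor :: "'m \<Rightarrow> 'f \<Rightarrow> 'm"
  bracket :: "('m \<Rightarrow> 'f) \<Rightarrow> ('m \<Rightarrow> 'f) \<Rightarrow> 'm \<Rightarrow> 'f"

definition sections ::
  "('m::real_normed_vector, 'f::real_normed_vector) algebroid \<Rightarrow> ('m \<Rightarrow> 'f) set" where
  "sections L = {s. smooth s \<and> (\<forall>x. s x \<in> fiber L x)}"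

text \<open>A (possibly inhomogeneous) differential form assigns to each point \<open>x\<close> a function on finite
  lists of vectors; its part of degree \<open>q\<close> is the restriction to lists of length \<open>q\<close>. Lists not
  contained in the fibre over \<open>x\<close> get the dummy value 0. Parts of degree exceeding the rank vanish
  since they are alternating, so every form is a finite sum of homogeneous ones.\<close>

type_synonym ('m, 'f) form = "'m \<Rightarrow> 'f list \<Rightarrow> real"

definition forms ::
  "('m::real_normed_vector, 'f::real_normed_vector) algebroid \<Rightarrow> ('m, 'f) form set" where
  "forms L = {\<omega>.
     (\<forall>x vs. \<not> set vs \<subseteq> fiber L x \<longrightarrow> \<omega> x vs = 0) \<and>
     (\<forall>x us vs. \<forall>a\<in>fiber L x. \<forall>b\<in>fiber L x. \<forall>c. set us \<subseteq> fiber L x \<and> set vs \<subseteq> fiber L x \<longrightarrow>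
        \<omega> x (us @ (c *\<^sub>R a + b) # vs) = c * \<omega> x (us @ a # vs) + \<omega> x (us @ b # vs)) \<and>
     (\<forall>x vs. \<not> distinct vs \<longrightarrow> \<omega> x vs = 0) \<and>
     (\<forall>ss. set ss \<subseteq> sections L \<longrightarrow> smooth (\<lambda>x. \<omega> x (map (\<lambda>s. s x) ss)))}"

definition degree_part :: "nat \<Rightarrow> ('m, 'f) form \<Rightarrow> ('m, 'f) form" where
  "degree_part q \<omega> = (\<lambda>x vs. if length vs = q then \<omega> x vs else 0)"

definition func_form :: "('m \<Rightarrow> real) \<Rightarrow> ('m, 'f) form" where
  "func_form f = (\<lambda>x vs. if vs = [] then f x else 0)"

definition one_form :: "('m \<Rightarrow> 'f \<Rightarrow> real) \<Rightarrow> ('m, 'f) form" where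
  "one_form \<theta> = (\<lambda>x vs. case vs of [v] \<Rightarrow> \<theta> x v | _ \<Rightarrow> 0)"

text \<open>The sum runs over all shuffles: \<open>S\<close> is the set of positions whose vectors are inserted into
  the first factor, and the exponent is the number of inversions of the shuffle.\<close>

definition wedge :: "('m, 'f) form \<Rightarrow> ('m, 'f) form \<Rightarrow> ('m, 'f) form" where
  "wedge \<omega> \<eta> = (\<lambda>x vs. \<Sum>S\<in>Pow {..<length vs}.
     (-1) ^ card {(i, j). i < j \<and> j \<in> S \<and> i \<notin> S} * \<omega> x (nths vs S) * \<eta> x (nths vs (- S)))"

definition koszul ::
  "('m::real_normed_vector, 'f) algebroid \<Rightarrow> ('m, 'f) form \<Rightarrow> ('m \<Rightarrow> 'f) list \<Rightarrow> 'm \<Rightarrow> real" where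
  "koszul L \<omega> ss x =
     (\<Sum>i<length ss. (-1) ^ i *
        frechet_derivative (\<lambda>y. \<omega> y (map (\<lambda>s. s y) (nths ss (- {i})))) (at x)
          (anchor L x ((ss ! i) x)))
     + (\<Sum>j<length ss. \<Sum>i<j. (-1) ^ (i + j) *
        \<omega> x (bracket L (ss ! i) (ss ! j) x # map (\<lambda>s. s x) (nths ss (- {i, j}))))"

text \<open>The Koszul formula is multilinear over functions, so on a vector bundle it is the evaluation of
  a form, and this form is unique because every vector of a fibre extends to a section.\<close>

definition ext_deriv ::
  "('m::real_normed_vector, 'f::real_normed_vector) algebroid \<Rightarrow> ('m, 'f) form \<Rightarrow> ('m, 'f) form" where
  "ext_deriv L \<omega> = (THE \<eta>. \<eta> \<in> forms L \<and>
     (\<forall>ss x. set ss \<subseteq> sections L \<longrightarrow> \<eta> x (map (\<lambda>s. s x) ss) = koszul L \<omega> ss x))"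

definition algebraic_ideal ::
  "('m::real_normed_vector, 'f::real_normed_vector) algebroid \<Rightarrow> ('m, 'f) form set \<Rightarrow> bool" where
  "algebraic_ideal L J \<longleftrightarrow>
     J \<subseteq> forms L \<and> (\<lambda>x vs. 0) \<in> J \<and>
     (\<forall>\<omega>\<in>J. \<forall>\<eta>\<in>J. (\<lambda>x vs. \<omega> x vs + \<eta> x vs) \<in> J) \<and>
     (\<forall>\<omega>\<in>J. \<forall>\<eta>\<in>forms L. wedge \<eta> \<omega> \<in> J \<and> wedge \<omega> \<eta> \<in> J) \<and>
     (\<forall>\<omega>\<in>J. \<forall>q. degree_part q \<omega> \<in> J)"

definition differential_ideal ::
  "('m::real_normed_vector, 'f::real_normed_vector) algebroid \<Rightarrow> ('m, 'f) form set \<Rightarrow> bool" where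
  "differential_ideal L J \<longleftrightarrow> algebraic_ideal L J \<and> (\<forall>\<omega>\<in>J. ext_deriv L \<omega> \<in> J)"

definition algebraic_ideal_generated ::
  "('m::real_normed_vector, 'f::real_normed_vector) algebroid \<Rightarrow> ('m, 'f) form set \<Rightarrow> ('m, 'f) form set"
  where "algebraic_ideal_generated L S = \<Inter>{J. algebraic_ideal L J \<and> S \<subseteq> J}"

definition differential_ideal_generated ::
  "('m::real_normed_vector, 'f::real_normed_vector) algebroid \<Rightarrow> ('m, 'f) form set \<Rightarrow> ('m, 'f) form set"
  where "differential_ideal_generated L S = \<Inter>{J. differential_ideal L J \<and> S \<subseteq> J}"


section \<open>Prolongation over a trivial bundle, pullback and integral manifolds\<close>

text \<open>Here \<open>p = fst\<close>, so that also \<open>Tp = fst\<close>. The formula for the bracket is for an algebroid \<open>L\<close>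
  on a trivial bundle (all fibres \<open>UNIV\<close>); it comes from expanding the first component of a section
  in constant sections of \<open>L\<close> and applying the Leibniz rule. The first summand of the first
  component is the bracket of those constant sections, the others are the derivatives of the
  coefficients. The lemmas \<open>prolongation_bracket_basic\<close> and \<open>prolongation_bracket_leibniz\<close> below give
  the characterizing properties.\<close>

definition prolongation ::
  "('m::real_normed_vector, 'f::real_normed_vector) algebroid
    \<Rightarrow> ('m \<times> 'y::real_normed_vector, 'f \<times> ('m \<times> 'y)) algebroid" where
  "prolongation L =
     \<lparr>fiber = (\<lambda>x. {(a, v). a \<in> fiber L (fst x) \<and> anchor L (fst x) a = fst v}),
      anchor = (\<lambda>x (a, v). v),
      bracket = (\<lambda>\<xi> \<eta> x.
        (bracket L (\<lambda>_. fst (\<xi> x)) (\<lambda>_. fst (\<eta> x)) (fst x)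
           + frechet_derivative (\<lambda>y. fst (\<eta> y)) (at x) (snd (\<xi> x))
           - frechet_derivative (\<lambda>y. fst (\<xi> y)) (at x) (snd (\<eta> x)),
         vf_bracket (\<lambda>y. snd (\<xi> y)) (\<lambda>y. snd (\<eta> y)) x))\<rparr>"

definition lift_form ::
  "('m::real_normed_vector, 'f::real_normed_vector) algebroid \<Rightarrow> ('m, 'f) form
    \<Rightarrow> ('m \<times> 'y::real_normed_vector, 'f \<times> ('m \<times> 'y)) form" where
  "lift_form L \<omega> = (\<lambda>x vs.
     if set vs \<subseteq> fiber (prolongation L) x then \<omega> (fst x) (map fst vs) else 0)"

definition prolong_section ::
  "('m::real_normed_vector, 'f) algebroid \<Rightarrow> ('m \<Rightarrow> 'm \<times> 'y::real_normed_vector)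
    \<Rightarrow> 'm \<Rightarrow> 'f \<Rightarrow> 'f \<times> ('m \<times> 'y)" where
  "prolong_section L \<iota> m a = (a, frechet_derivative \<iota> (at m) (anchor L m a))"

definition pullback ::
  "('m::real_normed_vector, 'f) algebroid \<Rightarrow> ('m \<Rightarrow> 'm \<times> 'y::real_normed_vector)
    \<Rightarrow> ('m \<times> 'y, 'f \<times> ('m \<times> 'y)) form \<Rightarrow> ('m, 'f) form" where
  "pullback L \<iota> \<theta> = (\<lambda>m vs. if set vs \<subseteq> fiber L m
     then \<theta> (\<iota> m) (map (prolong_section L \<iota> m) vs) else 0)"

definition integral_manifold ::
  "('m::real_normed_vector, 'f) algebroid \<Rightarrow> ('m \<times> 'y::real_normed_vector, 'f \<times> ('m \<times> 'y)) form set
    \<Rightarrow> ('m \<Rightarrow> 'm \<times> 'y) \<Rightarrow> bool" where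
  "integral_manifold L J \<iota> \<longleftrightarrow>
     smooth \<iota> \<and> (\<forall>m. fst (\<iota> m) = m) \<and> (\<forall>\<theta>\<in>J. pullback L \<iota> \<theta> = (\<lambda>m vs. 0))"

lemma pullback_wedge:
  assumes "\<And>m. fiber L m = UNIV"
  shows "pullback L \<iota> (wedge \<omega> \<eta>) = wedge (pullback L \<iota> \<omega>) (pullback L \<iota> \<eta>)"
  by (simp add: pullback_def wedge_def assms nths_map fun_eq_iff)


section \<open>The Lie algebra and the reduced vector field\<close>

definition lie_algebra :: "('g::real_vector \<Rightarrow> 'g \<Rightarrow> 'g) \<Rightarrow> bool" where
  "lie_algebra br \<longleftrightarrow> bilinear br \<and> (\<forall>x. br x x = 0) \<and>
     (\<forall>x y z. br x (br y z) + br y (br z x) + br z (br x y) = 0)"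

definition is_basis :: "('n \<Rightarrow> 'g::real_vector) \<Rightarrow> bool" where
  "is_basis E \<longleftrightarrow> inj E \<and> independent (range E) \<and> span (range E) = UNIV"

definition coord :: "('n \<Rightarrow> 'g::real_vector) \<Rightarrow> 'n \<Rightarrow> 'g \<Rightarrow> real" where
  "coord E i x = representation (range E) x (E i)"

definition struct_const ::
  "('g::real_vector \<Rightarrow> 'g \<Rightarrow> 'g) \<Rightarrow> ('n \<Rightarrow> 'g) \<Rightarrow> 'n \<Rightarrow> 'n \<Rightarrow> 'n \<Rightarrow> real" where
  "struct_const br E i j k = coord E k (br (E i) (E j))"

text \<open>Points of \<open>M\<close> are pairs \<open>(t, w)\<close>.\<close>

definition dw :: "('n \<Rightarrow> 'g::real_normed_vector) \<Rightarrow> 'n \<Rightarrow> (real \<times> 'g \<Rightarrow> real) \<Rightarrow> real \<times> 'g \<Rightarrow> real" where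
  "dw E i f m = frechet_derivative f (at m) (0, E i)"

definition dgam :: "('n::finite \<Rightarrow> 'g::real_normed_vector) \<Rightarrow> ('n \<Rightarrow> real \<times> 'g \<Rightarrow> real)
    \<Rightarrow> (real \<times> 'g \<Rightarrow> real) \<Rightarrow> real \<times> 'g \<Rightarrow> real" where
  "dgam E \<gamma> f m = frechet_derivative f (at m) (1, \<Sum>i\<in>UNIV. \<gamma> i m *\<^sub>R E i)"

text \<open>In \<open>lam\<close>, \<open>phi\<close> the arguments are the lower index followed by the upper index.\<close>

definition lam :: "('g::real_normed_vector \<Rightarrow> 'g \<Rightarrow> 'g) \<Rightarrow> ('n::finite \<Rightarrow> 'g)
    \<Rightarrow> ('n \<Rightarrow> real \<times> 'g \<Rightarrow> real) \<Rightarrow> 'n \<Rightarrow> 'n \<Rightarrow> real \<times> 'g \<Rightarrow> real" where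
  "lam br E \<gamma> i j m =
     ((\<Sum>k\<in>UNIV. coord E k (snd m) * struct_const br E k i j) - dw E i (\<gamma> j) m) / 2"

definition phi :: "('g::real_normed_vector \<Rightarrow> 'g \<Rightarrow> 'g) \<Rightarrow> ('n::finite \<Rightarrow> 'g)
    \<Rightarrow> ('n \<Rightarrow> real \<times> 'g \<Rightarrow> real) \<Rightarrow> 'n \<Rightarrow> 'n \<Rightarrow> real \<times> 'g \<Rightarrow> real" where
  "phi br E \<gamma> i j m =
     - (\<Sum>k\<in>UNIV. \<Sum>l\<in>UNIV. coord E k (snd m) * struct_const br E k i l * dw E l (\<gamma> j) m)
     - (\<Sum>k\<in>UNIV. \<gamma> k m * struct_const br E i k j)
     - dgam E \<gamma> (lam br E \<gamma> i j) m
     - (\<Sum>k\<in>UNIV. lam br E \<gamma> i k m * lam br E \<gamma> k j m)"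

definition reduced_helmholtz :: "('g::real_normed_vector \<Rightarrow> 'g \<Rightarrow> 'g) \<Rightarrow> ('n::finite \<Rightarrow> 'g)
    \<Rightarrow> ('n \<Rightarrow> real \<times> 'g \<Rightarrow> real) \<Rightarrow> ('n \<Rightarrow> 'n \<Rightarrow> real \<times> 'g \<Rightarrow> real) \<Rightarrow> bool" where
  "reduced_helmholtz br E \<gamma> k \<longleftrightarrow>
     (\<forall>i j. smooth (k i j)) \<and>
     (\<forall>m. det (\<chi> i j. k i j m) \<noteq> 0) \<and>
     (\<forall>i j m. k i j m = k j i m) \<and>
     (\<forall>i j m. dgam E \<gamma> (k i j) m
        - (\<Sum>l\<in>UNIV. k l j m * lam br E \<gamma> i l m) - (\<Sum>l\<in>UNIV. k i l m * lam br E \<gamma> j l m) = 0) \<and>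
     (\<forall>i j m. (\<Sum>l\<in>UNIV. k l i m * phi br E \<gamma> j l m) = (\<Sum>l\<in>UNIV. k l j m * phi br E \<gamma> i l m)) \<and>
     (\<forall>i j l m. dw E i (k j l) m = dw E j (k i l) m)"


section \<open>The IP Lie algebroid\<close>

text \<open>The formula for the bracket extends the bracket of the constant sections
  \<open>T\<^sub>0 = (1, 0, 0)\<close>, \<open>e\<^sub>i = (0, E\<^sub>i, 0)\<close>, \<open>W\<^sub>i = (0, 0, E\<^sub>i)\<close> by the Leibniz rule; see the lemmas below.\<close>

definition ip_anchor :: "('g::real_normed_vector \<Rightarrow> 'g \<Rightarrow> 'g)
    \<Rightarrow> real \<times> 'g \<Rightarrow> real \<times> 'g \<times> 'g \<Rightarrow> real \<times> 'g" where
  "ip_anchor br = (\<lambda>(t, w) (c, u, v). (c, br w u + v))"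

definition ip_bracket :: "('g::real_normed_vector \<Rightarrow> 'g \<Rightarrow> 'g)
    \<Rightarrow> (real \<times> 'g \<Rightarrow> real \<times> 'g \<times> 'g) \<Rightarrow> (real \<times> 'g \<Rightarrow> real \<times> 'g \<times> 'g)
    \<Rightarrow> real \<times> 'g \<Rightarrow> real \<times> 'g \<times> 'g" where
  "ip_bracket br \<sigma> \<tau> m =
     (case (\<sigma> m, \<tau> m) of ((c, u, v), (c', u', v')) \<Rightarrow> (0, br u u', br u v' + br v u'))
     + frechet_derivative \<tau> (at m) (ip_anchor br m (\<sigma> m))
     - frechet_derivative \<sigma> (at m) (ip_anchor br m (\<tau> m))"

definition ip_algebroid ::
  "('g::real_normed_vector \<Rightarrow> 'g \<Rightarrow> 'g) \<Rightarrow> (real \<times> 'g, real \<times> 'g \<times> 'g) algebroid" where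
  "ip_algebroid br = \<lparr>fiber = (\<lambda>_. UNIV), anchor = ip_anchor br, bracket = ip_bracket br\<rparr>"

definition T0_sec :: "real \<times> 'g::real_vector \<Rightarrow> real \<times> 'g \<times> 'g" where
  "T0_sec m = (1, 0, 0)"

definition e_sec :: "('n \<Rightarrow> 'g::real_vector) \<Rightarrow> 'n \<Rightarrow> real \<times> 'g \<Rightarrow> real \<times> 'g \<times> 'g" where
  "e_sec E i m = (0, E i, 0)"

definition W_sec :: "('n \<Rightarrow> 'g::real_vector) \<Rightarrow> 'n \<Rightarrow> real \<times> 'g \<Rightarrow> real \<times> 'g \<times> 'g" where
  "W_sec E i m = (0, 0, E i)"

definition Gamma_sec :: "('n::finite \<Rightarrow> 'g::real_normed_vector) \<Rightarrow> ('n \<Rightarrow> real \<times> 'g \<Rightarrow> real)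
    \<Rightarrow> real \<times> 'g \<Rightarrow> real \<times> 'g \<times> 'g" where
  "Gamma_sec E \<gamma> m = T0_sec m + (\<Sum>j\<in>UNIV. coord E j (snd m) *\<^sub>R e_sec E j m)
     + (\<Sum>j\<in>UNIV. \<gamma> j m *\<^sub>R W_sec E j m)"

definition H_sec :: "('g::real_normed_vector \<Rightarrow> 'g \<Rightarrow> 'g) \<Rightarrow> ('n::finite \<Rightarrow> 'g)
    \<Rightarrow> ('n \<Rightarrow> real \<times> 'g \<Rightarrow> real) \<Rightarrow> 'n \<Rightarrow> real \<times> 'g \<Rightarrow> real \<times> 'g \<times> 'g" where
  "H_sec br E \<gamma> i m = e_sec E i m - (\<Sum>j\<in>UNIV. lam br E \<gamma> i j m *\<^sub>R W_sec E j m)"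

text \<open>The basis dual to \<open>Gamma_sec\<close>, \<open>W_sec\<close>, \<open>H_sec\<close>; the duality is lemma \<open>dual_basis\<close>.\<close>

definition Gamma_form :: "(real \<times> 'g, real \<times> 'g \<times> 'g) form" where
  "Gamma_form = one_form (\<lambda>m (c, u, v). c)"

definition Theta_form :: "('n \<Rightarrow> 'g::real_vector) \<Rightarrow> 'n \<Rightarrow> (real \<times> 'g, real \<times> 'g \<times> 'g) form" where
  "Theta_form E i = one_form (\<lambda>m (c, u, v). coord E i u - c * coord E i (snd m))"

definition Psi_form :: "('g::real_normed_vector \<Rightarrow> 'g \<Rightarrow> 'g) \<Rightarrow> ('n::finite \<Rightarrow> 'g)
    \<Rightarrow> ('n \<Rightarrow> real \<times> 'g \<Rightarrow> real) \<Rightarrow> 'n \<Rightarrow> (real \<times> 'g, real \<times> 'g \<times> 'g) form" where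
  "Psi_form br E \<gamma> i = one_form (\<lambda>m (c, u, v). coord E i v - c * \<gamma> i m
     + (\<Sum>k\<in>UNIV. lam br E \<gamma> k i m * (coord E k u - c * coord E k (snd m))))"

definition omega_form :: "('g::real_normed_vector \<Rightarrow> 'g \<Rightarrow> 'g) \<Rightarrow> ('n::finite \<Rightarrow> 'g)
    \<Rightarrow> ('n \<Rightarrow> real \<times> 'g \<Rightarrow> real) \<Rightarrow> 'n \<Rightarrow> 'n \<Rightarrow> (real \<times> 'g, real \<times> 'g \<times> 'g) form" where
  "omega_form br E \<gamma> i j = (\<lambda>m vs.
     (wedge (Psi_form br E \<gamma> i) (Theta_form E j) m vs
      + wedge (Psi_form br E \<gamma> j) (Theta_form E i) m vs) / 2)"

definition Sigma0 :: "('g::real_normed_vector \<Rightarrow> 'g \<Rightarrow> 'g) \<Rightarrow> ('n::finite \<Rightarrow> 'g)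
    \<Rightarrow> ('n \<Rightarrow> real \<times> 'g \<Rightarrow> real) \<Rightarrow> (real \<times> 'g, real \<times> 'g \<times> 'g) form set" where
  "Sigma0 br E \<gamma> = {(\<lambda>m vs. \<Sum>i\<in>UNIV. \<Sum>j\<in>UNIV. f i j m * omega_form br E \<gamma> i j m vs) | f.
     \<forall>i j. smooth (f i j)}"


section \<open>The prolongation of the IP Lie algebroid and the generating one-forms\<close>

text \<open>Symmetric index pairs and triples are multisets, so that symmetric matrices and totally
  symmetric three-index arrays are just vectors indexed by \<open>'n idx2\<close> and \<open>'n idx3\<close>.\<close>

typedef 'n idx2 = "{A :: 'n multiset. size A = 2}" morphisms mset_idx2 Abs_idx2
  by (rule exI[of _ "{#undefined, undefined#}"]) simp

typedef 'n idx3 = "{A :: 'n multiset. size A = 3}" morphisms mset_idx3 Abs_idx3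
  by (rule exI[of _ "{#undefined, undefined, undefined#}"]) simp

lemma finite_multisets_size: "finite {A :: 'n::finite multiset. size A = n}"
  using finite_multisets_of_size[of "UNIV :: 'n set" n] by (simp add: multisets_of_size_def)

instance idx2 :: (finite) finite
proof
  have "(UNIV :: 'a idx2 set) = Abs_idx2 ` {A. size A = 2}"
    by (metis type_definition.Abs_image type_definition_idx2)
  then show "finite (UNIV :: 'a idx2 set)"
    by (metis finite_imageI finite_multisets_size)
qed

instance idx3 :: (finite) finite
proof
  have "(UNIV :: 'a idx3 set) = Abs_idx3 ` {A. size A = 3}"
    by (metis type_definition.Abs_image type_definition_idx3)
  then show "finite (UNIV :: 'a idx3 set)"
    by (metis finite_imageI finite_multisets_size)
qed

type_synonym ('g, 'n) Mbar = "(real \<times> 'g) \<times> (real, 'n idx2) vec \<times> (real, 'n idx3) vec \<times> (real, 'n idx3) vec"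

definition s_co :: "'n::finite \<Rightarrow> 'n \<Rightarrow> ('g, 'n) Mbar \<Rightarrow> real" where
  "s_co i j = (\<lambda>(m, s, P, Q). s $ Abs_idx2 {#i, j#})"

definition P_co :: "'n::finite \<Rightarrow> 'n \<Rightarrow> 'n \<Rightarrow> ('g, 'n) Mbar \<Rightarrow> real" where
  "P_co i j k = (\<lambda>(m, s, P, Q). P $ Abs_idx3 {#i, j, k#})"

definition Q_co :: "'n::finite \<Rightarrow> 'n \<Rightarrow> 'n \<Rightarrow> ('g, 'n) Mbar \<Rightarrow> real" where
  "Q_co i j k = (\<lambda>(m, s, P, Q). Q $ Abs_idx3 {#i, j, k#})"

definition ip_prolongation :: "('g::real_normed_vector \<Rightarrow> 'g \<Rightarrow> 'g)
    \<Rightarrow> (('g, 'n::finite) Mbar, (real \<times> 'g \<times> 'g) \<times> ('g, 'n) Mbar) algebroid" where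
  "ip_prolongation br = prolongation (ip_algebroid br)"

definition sigma_form :: "('g::real_normed_vector \<Rightarrow> 'g \<Rightarrow> 'g) \<Rightarrow> ('n::finite \<Rightarrow> 'g)
    \<Rightarrow> ('n \<Rightarrow> real \<times> 'g \<Rightarrow> real) \<Rightarrow> 'n \<Rightarrow> 'n
    \<Rightarrow> (('g, 'n) Mbar, (real \<times> 'g \<times> 'g) \<times> ('g, 'n) Mbar) form" where
  "sigma_form br E \<gamma> i j = (\<lambda>x vs.
     ext_deriv (ip_prolongation br) (func_form (s_co i j)) x vs
     - (\<Sum>k\<in>UNIV. s_co k i x * lam br E \<gamma> j k (fst x) + s_co k j x * lam br E \<gamma> i k (fst x))
         * lift_form (ip_algebroid br) Gamma_form x vs
     + (\<Sum>l\<in>UNIV. P_co i j l x * lift_form (ip_algebroid br) (Psi_form br E \<gamma> l) x vs)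
     + (\<Sum>l\<in>UNIV.
          ((\<Sum>k\<in>UNIV. s_co k i x * struct_const br E j l k + s_co k j x * struct_const br E i l k
              - s_co k l x * dw E i (dw E j (\<gamma> k)) (fst x)) / 2
           + Q_co i j l x) * lift_form (ip_algebroid br) (Theta_form E l) x vs))"


section \<open>Consistency checks\<close>

lemma co_symmetric:
  "s_co i j = s_co j i" "P_co i j k = P_co j i k" "P_co i j k = P_co i k j"
  "Q_co i j k = Q_co j i k" "Q_co i j k = Q_co i k j"
  by (simp_all add: s_co_def P_co_def Q_co_def add_mset_commute)

lemma idx2_cases: obtains i j where "A = Abs_idx2 {#i, j#}"
proof (cases A)
  case (Abs_idx2 B)
  then have "size B = Suc (Suc 0)" by simp
  then obtain i B' where "B = add_mset i B'" "size B' = Suc 0"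
    by (metis size_add_mset size_eq_Suc_imp_eq_union Suc_inject)
  moreover from this obtain j where "B' = {#j#}" by (metis One_nat_def size_1_singleton_mset)
  ultimately show thesis using Abs_idx2 that by blast
qed

lemma idx3_cases: obtains i j k where "A = Abs_idx3 {#i, j, k#}"
proof (cases A)
  case (Abs_idx3 B)
  then have "size B = Suc 2" by simp
  then obtain k C where B: "B = add_mset k C" "size C = 2"
    by (metis size_add_mset size_eq_Suc_imp_eq_union Suc_inject)
  moreover obtain i j where "C = {#i, j#}"
    using idx2_cases[of "Abs_idx2 C"] B(2) by (auto simp: Abs_idx2_inject)
  ultimately show thesis using Abs_idx3 that by blast
qed

lemma Abs_idx_eq:
  "Abs_idx2 {#i, j#} = Abs_idx2 {#i', j'#} \<longleftrightarrow> {#i, j#} = {#i', j'#}"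
  "Abs_idx3 {#i, j, k#} = Abs_idx3 {#i', j', k'#} \<longleftrightarrow> {#i, j, k#} = {#i', j', k'#}"
  by (simp_all add: Abs_idx2_inject Abs_idx3_inject)

lemma idx2_array:
  fixes s :: "'n::finite \<Rightarrow> 'n \<Rightarrow> real"
  assumes "\<And>i j. s i j = s j i"
  shows "\<exists>x. \<forall>i j. x $ Abs_idx2 {#i, j#} = s i j"
proof (rule exI, intro allI)
  fix i j
  have "s i' j' = s i j" if "{#i', j'#} = {#i, j#}" for i' j'
    using that assms by (auto simp: add_eq_conv_ex)
  then have "(SOME r. \<exists>i' j'. Abs_idx2 {#i, j#} = Abs_idx2 {#i', j'#} \<and> r = s i' j') = s i j"
    unfolding Abs_idx_eq by (intro some_equality) (metis)+
  then show "(\<chi> A. SOME r. \<exists>i j. A = Abs_idx2 {#i, j#} \<and> r = s i j) $ Abs_idx2 {#i, j#} = s i j"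
    by simp
qed

lemma idx3_array:
  fixes P :: "'n::finite \<Rightarrow> 'n \<Rightarrow> 'n \<Rightarrow> real"
  assumes "\<And>i j k. P i j k = P j i k" "\<And>i j k. P i j k = P i k j"
  shows "\<exists>x. \<forall>i j k. x $ Abs_idx3 {#i, j, k#} = P i j k"
proof (rule exI, intro allI)
  fix i j k
  have "P i' j' k' = P i j k" if "{#i', j', k'#} = {#i, j, k#}" for i' j' k'
    using that assms by (auto simp: add_eq_conv_ex)
  then have "(SOME r. \<exists>i' j' k'. Abs_idx3 {#i, j, k#} = Abs_idx3 {#i', j', k'#} \<and> r = P i' j' k') = P i j k"
    unfolding Abs_idx_eq by (intro some_equality) (metis)+
  then show "(\<chi> A. SOME r. \<exists>i j k. A = Abs_idx3 {#i, j, k#} \<and> r = P i j k) $ Abs_idx3 {#i, j, k#}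
      = P i j k"
    by simp
qed

lemma co_surj:
  fixes s :: "'n::finite \<Rightarrow> 'n \<Rightarrow> real" and P Q :: "'n \<Rightarrow> 'n \<Rightarrow> 'n \<Rightarrow> real"
  assumes "\<And>i j. s i j = s j i"
    and "\<And>i j k. P i j k = P j i k" "\<And>i j k. P i j k = P i k j"
    and "\<And>i j k. Q i j k = Q j i k" "\<And>i j k. Q i j k = Q i k j"
  shows "\<exists>!x. fst x = m \<and> (\<forall>i j. s_co i j x = s i j) \<and>
    (\<forall>i j k. P_co i j k x = P i j k \<and> Q_co i j k x = Q i j k)"
proof -
  obtain s' P' Q' where *: "\<And>i j. s' $ Abs_idx2 {#i, j#} = s i j"
    "\<And>i j k. P' $ Abs_idx3 {#i, j, k#} = P i j k" "\<And>i j k. Q' $ Abs_idx3 {#i, j, k#} = Q i j k"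
    using idx2_array[of s] idx3_array[of P] idx3_array[of Q] assms by metis
  have eq2: "v = s'" if "\<And>i j. v $ Abs_idx2 {#i, j#} = s i j" for v
    unfolding vec_eq_iff by (metis idx2_cases that *(1))
  have eq3: "v = P'" if "\<And>i j k. v $ Abs_idx3 {#i, j, k#} = P i j k" for v
    unfolding vec_eq_iff by (metis idx3_cases that *(2))
  have eq3': "v = Q'" if "\<And>i j k. v $ Abs_idx3 {#i, j, k#} = Q i j k" for v
    unfolding vec_eq_iff by (metis idx3_cases that *(3))
  show ?thesis
    by (rule ex1I[of _ "(m, s', P', Q')"])
      (auto simp: s_co_def P_co_def Q_co_def * intro!: eq2 eq3 eq3')
qed

lemma coord_basis:
  assumes "is_basis E"
  shows "coord E i (E j) = (if i = j then 1 else 0)"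
  using assms representation_basis[of "range E" "E j"]
  by (auto simp: is_basis_def coord_def inj_def)

lemma coord_linear:
  assumes "is_basis E"
  shows "linear (coord E i)"
  using assms
  by (intro linearI) (auto simp: is_basis_def coord_def representation_add representation_scale)

lemma coord_expand:
  fixes E :: "'n::finite \<Rightarrow> 'g::real_vector"
  assumes "is_basis E"
  shows "(\<Sum>i\<in>UNIV. coord E i x *\<^sub>R E i) = x"
proof -
  have "(\<Sum>v\<in>range E. representation (range E) x v *\<^sub>R v) = x"
    using assms by (intro sum_representation_eq) (auto simp: is_basis_def)
  then show ?thesis
    using assms by (simp add: sum.reindex is_basis_def coord_def)
qed

lemma bilinear_zero: "bilinear br \<Longrightarrow> br x 0 = 0" "bilinear br \<Longrightarrow> br 0 x = 0"
  by (simp_all add: bilinear_rzero bilinear_lzero)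

lemma ip_anchor_basis:
  fixes E :: "'n::finite \<Rightarrow> 'g::real_normed_vector"
  assumes "lie_algebra br" "is_basis E"
  shows "ip_anchor br (t, w) (T0_sec (t, w)) = (1, 0)"
    and "ip_anchor br (t, w) (e_sec E i (t, w)) =
      (\<Sum>k\<in>UNIV. \<Sum>j\<in>UNIV. (coord E k w * struct_const br E k i j) *\<^sub>R (0, E j))"
    and "ip_anchor br (t, w) (W_sec E i (t, w)) = (0, E i)"
proof -
  have bl: "bilinear br" using assms(1) by (simp add: lie_algebra_def)
  show "ip_anchor br (t, w) (T0_sec (t, w)) = (1, 0)"
    and "ip_anchor br (t, w) (W_sec E i (t, w)) = (0, E i)"
    by (simp_all add: ip_anchor_def T0_sec_def W_sec_def bilinear_zero[OF bl])
  have lin: "linear (\<lambda>x. br x (E i))" using bl by (simp add: bilinear_def)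
  have "br w (E i) = br (\<Sum>k\<in>UNIV. coord E k w *\<^sub>R E k) (E i)"
    by (simp add: coord_expand[OF assms(2)])
  also have "\<dots> = (\<Sum>k\<in>UNIV. coord E k w *\<^sub>R br (E k) (E i))"
    by (simp add: linear_sum[OF lin] bilinear_lmul[OF bl])
  also have "\<dots> = (\<Sum>k\<in>UNIV. coord E k w *\<^sub>R (\<Sum>j\<in>UNIV. struct_const br E k i j *\<^sub>R E j))"
    by (simp add: struct_const_def coord_expand[OF assms(2)])
  finally have *: "br w (E i) = (\<Sum>k\<in>UNIV. \<Sum>j\<in>UNIV. (coord E k w * struct_const br E k i j) *\<^sub>R E j)"
    by (simp add: scaleR_sum_right)
  show "ip_anchor br (t, w) (e_sec E i (t, w)) =
      (\<Sum>k\<in>UNIV. \<Sum>j\<in>UNIV. (coord E k w * struct_const br E k i j) *\<^sub>R (0, E j))"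
    by (simp add: ip_anchor_def e_sec_def * prod_eq_iff fst_sum snd_sum)
qed

lemma ip_bracket_basis:
  fixes E :: "'n::finite \<Rightarrow> 'g::real_normed_vector"
  assumes "lie_algebra br" "is_basis E"
  shows "ip_bracket br T0_sec (e_sec E i) = (\<lambda>m. 0)"
    and "ip_bracket br T0_sec (W_sec E i) = (\<lambda>m. 0)"
    and "ip_bracket br (e_sec E i) (e_sec E j) =
      (\<lambda>m. \<Sum>k\<in>UNIV. struct_const br E i j k *\<^sub>R e_sec E k m)"
    and "ip_bracket br (e_sec E i) (W_sec E j) =
      (\<lambda>m. \<Sum>k\<in>UNIV. struct_const br E i j k *\<^sub>R W_sec E k m)"
    and "ip_bracket br (W_sec E i) (W_sec E j) = (\<lambda>m. 0)"
proof -
  have bl: "bilinear br" using assms(1) by (simp add: lie_algebra_def)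
  have const: "T0_sec = (\<lambda>m. (1, 0, 0))" "e_sec E i = (\<lambda>m. (0, E i, 0))"
      "W_sec E i = (\<lambda>m. (0, 0, E i))" for i
    by (simp_all add: T0_sec_def e_sec_def W_sec_def fun_eq_iff)
  have c: "br (E i) (E j) = (\<Sum>k\<in>UNIV. struct_const br E i j k *\<^sub>R E k)"
    by (simp add: struct_const_def coord_expand[OF assms(2)])
  show "ip_bracket br T0_sec (e_sec E i) = (\<lambda>m. 0)"
    "ip_bracket br T0_sec (W_sec E i) = (\<lambda>m. 0)"
    "ip_bracket br (W_sec E i) (W_sec E j) = (\<lambda>m. 0)"
    "ip_bracket br (e_sec E i) (e_sec E j) =
      (\<lambda>m. \<Sum>k\<in>UNIV. struct_const br E i j k *\<^sub>R e_sec E k m)"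
    "ip_bracket br (e_sec E i) (W_sec E j) =
      (\<lambda>m. \<Sum>k\<in>UNIV. struct_const br E i j k *\<^sub>R W_sec E k m)"
    by (simp_all add: ip_bracket_def const bilinear_zero[OF bl] c zero_prod_def prod_eq_iff fun_eq_iff
        fst_sum snd_sum)
qed

lemma lie_algebra_antisym:
  assumes "lie_algebra br"
  shows "br x y = - br y x"
proof -
  have bl: "bilinear br" and z: "\<And>x. br x x = 0" using assms by (simp_all add: lie_algebra_def)
  have "br (x + y) (x + y) = br x y + br y x"
    by (simp add: bilinear_ladd[OF bl] bilinear_radd[OF bl] z[of x] z[of y])
  then show ?thesis using z[of "x + y"] by (metis eq_neg_iff_add_eq_0)
qed

lemma ip_bracket_antisym:
  assumes "lie_algebra br"
  shows "ip_bracket br \<sigma> \<tau> m = - ip_bracket br \<tau> \<sigma> m"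
proof -
  obtain c u v c' u' v' where *: "\<sigma> m = (c, u, v)" "\<tau> m = (c', u', v')" by (metis prod_cases3)
  show ?thesis
    unfolding ip_bracket_def *
    using lie_algebra_antisym[OF assms, of u u'] lie_algebra_antisym[OF assms, of u v']
      lie_algebra_antisym[OF assms, of v u']
    by (simp add: prod_eq_iff)
qed

lemma frechet_derivative_scale:
  fixes f :: "'a::real_normed_vector \<Rightarrow> real" and \<tau> :: "'a \<Rightarrow> 'b::real_normed_vector"
  assumes "f differentiable (at m)" "\<tau> differentiable (at m)"
  shows "frechet_derivative (\<lambda>m. f m *\<^sub>R \<tau> m) (at m) v =
    f m *\<^sub>R frechet_derivative \<tau> (at m) v + frechet_derivative f (at m) v *\<^sub>R \<tau> m"
  using frechet_derivative_at[OF has_derivative_scaleR[OF assms[unfolded frechet_derivative_works]]]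
  by metis

lemma ip_anchor_scale:
  "bilinear br \<Longrightarrow> ip_anchor br m (c *\<^sub>R a) = c *\<^sub>R ip_anchor br m a"
  by (auto simp: ip_anchor_def scaleR_add_right bilinear_rmul split: prod.splits)

lemma ip_bracket_leibniz:
  fixes f :: "real \<times> 'g::real_normed_vector \<Rightarrow> real"
  assumes "lie_algebra br"
    and "f differentiable (at m)" "\<sigma> differentiable (at m)" "\<tau> differentiable (at m)"
  shows "ip_bracket br \<sigma> (\<lambda>m. f m *\<^sub>R \<tau> m) m =
    f m *\<^sub>R ip_bracket br \<sigma> \<tau> m + frechet_derivative f (at m) (ip_anchor br m (\<sigma> m)) *\<^sub>R \<tau> m"
proof -
  have bl: "bilinear br" using assms(1) by (simp add: lie_algebra_def)
  have lin: "linear (frechet_derivative \<sigma> (at m))"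
    using assms(3) by (rule linear_frechet_derivative)
  obtain c u v c' u' v' where *: "\<sigma> m = (c, u, v)" "\<tau> m = (c', u', v')" by (metis prod_cases3)
  have "(case (\<sigma> m, f m *\<^sub>R \<tau> m) of ((c, u, v), (c', u', v')) \<Rightarrow> (0, br u u', br u v' + br v u'))
    = f m *\<^sub>R (case (\<sigma> m, \<tau> m) of ((c, u, v), (c', u', v')) \<Rightarrow> (0::real, br u u', br u v' + br v u'))"
    by (simp add: * bilinear_rmul[OF bl] scaleR_add_right)
  then show ?thesis
    unfolding ip_bracket_def
    by (simp add: frechet_derivative_scale assms ip_anchor_scale[OF bl] linear_cmul[OF lin]
        scaleR_add_right scaleR_diff_right)
qed

lemma dual_basis:
  fixes E :: "'n::finite \<Rightarrow> 'g::real_normed_vector"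
  assumes "is_basis E"
  shows "Gamma_form m [Gamma_sec E \<gamma> m] = 1"
    and "Gamma_form m [W_sec E j m] = 0"
    and "Gamma_form m [H_sec br E \<gamma> j m] = 0"
    and "Psi_form br E \<gamma> i m [Gamma_sec E \<gamma> m] = 0"
    and "Psi_form br E \<gamma> i m [W_sec E j m] = (if i = j then 1 else 0)"
    and "Psi_form br E \<gamma> i m [H_sec br E \<gamma> j m] = 0"
    and "Theta_form E i m [Gamma_sec E \<gamma> m] = 0"
    and "Theta_form E i m [W_sec E j m] = 0"
    and "Theta_form E i m [H_sec br E \<gamma> j m] = (if i = j then 1 else 0)"
proof -
  have z: "coord E i 0 = 0" for i using coord_linear[OF assms] by (rule linear_0)
  have sm: "coord E i (\<Sum>j\<in>UNIV. c j *\<^sub>R E j) = c i" for i and c :: "'n \<Rightarrow> real"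
    by (simp add: linear_sum[OF coord_linear[OF assms]] linear_cmul[OF coord_linear[OF assms]]
        coord_basis[OF assms] if_distrib[of "\<lambda>x. _ * x"] cong: if_cong)
  have neg: "coord E i (- x) = - coord E i x" for i x
    using coord_linear[OF assms] by (rule linear_neg)
  have G: "Gamma_sec E \<gamma> m = (1, \<Sum>j\<in>UNIV. coord E j (snd m) *\<^sub>R E j, \<Sum>j\<in>UNIV. \<gamma> j m *\<^sub>R E j)"
    by (simp add: Gamma_sec_def T0_sec_def e_sec_def W_sec_def prod_eq_iff fst_sum snd_sum)
  have H: "H_sec br E \<gamma> j m = (0, E j, - (\<Sum>k\<in>UNIV. lam br E \<gamma> j k m *\<^sub>R E k))"
    by (simp add: H_sec_def e_sec_def W_sec_def prod_eq_iff fst_sum snd_sum)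
  show "Gamma_form m [Gamma_sec E \<gamma> m] = 1" "Gamma_form m [W_sec E j m] = 0"
    "Gamma_form m [H_sec br E \<gamma> j m] = 0"
    "Psi_form br E \<gamma> i m [Gamma_sec E \<gamma> m] = 0"
    "Psi_form br E \<gamma> i m [W_sec E j m] = (if i = j then 1 else 0)"
    "Psi_form br E \<gamma> i m [H_sec br E \<gamma> j m] = 0"
    "Theta_form E i m [Gamma_sec E \<gamma> m] = 0"
    "Theta_form E i m [W_sec E j m] = 0"
    "Theta_form E i m [H_sec br E \<gamma> j m] = (if i = j then 1 else 0)"
    by (simp_all add: Gamma_form_def Psi_form_def Theta_form_def one_form_def G H W_sec_def z sm neg
        coord_basis[OF assms] if_distrib[of "\<lambda>x. _ * x"] cong: if_cong)
qed

lemma prolongation_bracket_basic: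
  fixes X Y :: "((real \<times> 'g) \<times> 'y::real_normed_vector) \<Rightarrow> (real \<times> 'g::real_normed_vector) \<times> 'y"
  assumes "\<sigma> differentiable (at (fst x))" "\<tau> differentiable (at (fst x))"
    and "ip_anchor br (fst x) (\<sigma> (fst x)) = fst (X x)"
    and "ip_anchor br (fst x) (\<tau> (fst x)) = fst (Y x)"
  shows "bracket (prolongation (ip_algebroid br)) (\<lambda>y. (\<sigma> (fst y), X y)) (\<lambda>y. (\<tau> (fst y), Y y)) x
    = (ip_bracket br \<sigma> \<tau> (fst x), vf_bracket X Y x)"
proof -
  have comp: "frechet_derivative (\<lambda>y. \<rho> (fst y)) (at x) v = frechet_derivative \<rho> (at (fst x)) (fst v)"
    if "\<rho> differentiable (at (fst x))" for \<rho> :: "real \<times> 'g \<Rightarrow> real \<times> 'g \<times> 'g" and v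
  proof -
    have "((\<lambda>y. \<rho> (fst y)) has_derivative (\<lambda>v. frechet_derivative \<rho> (at (fst x)) (fst v))) (at x)"
      using has_derivative_compose[OF has_derivative_fst[OF has_derivative_ident]
          that[unfolded frechet_derivative_works]] .
    from frechet_derivative_at[OF this] show ?thesis by metis
  qed
  show ?thesis
    using assms(3,4) by (simp add: prolongation_def ip_algebroid_def ip_bracket_def comp assms(1,2))
qed

lemma prolongation_bracket_leibniz:
  fixes f :: "(real \<times> 'g::real_normed_vector) \<times> 'y::real_normed_vector \<Rightarrow> real"
    and \<xi> \<eta> :: "(real \<times> 'g) \<times> 'y \<Rightarrow> (real \<times> 'g \<times> 'g) \<times> ((real \<times> 'g) \<times> 'y)"
  assumes "lie_algebra br"
    and "f differentiable (at x)" "\<xi> differentiable (at x)" "\<eta> differentiable (at x)"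
  shows "bracket (prolongation (ip_algebroid br)) \<xi> (\<lambda>y. f y *\<^sub>R \<eta> y) x =
    f x *\<^sub>R bracket (prolongation (ip_algebroid br)) \<xi> \<eta> x
    + frechet_derivative f (at x) (anchor (prolongation (ip_algebroid br)) x (\<xi> x)) *\<^sub>R \<eta> x"
proof -
  have d: "(\<lambda>y. fst (\<xi> y)) differentiable (at x)" "(\<lambda>y. snd (\<xi> y)) differentiable (at x)"
      "(\<lambda>y. fst (\<eta> y)) differentiable (at x)" "(\<lambda>y. snd (\<eta> y)) differentiable (at x)"
    using assms(3,4) unfolding differentiable_def
    by (blast intro: has_derivative_fst has_derivative_snd)+
  have anch: "anchor (prolongation (ip_algebroid br)) x (\<xi> x) = snd (\<xi> x)"
    by (simp add: prolongation_def split: prod.splits)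
  have "ip_bracket br (\<lambda>_. fst (\<xi> x)) (\<lambda>_. f x *\<^sub>R fst (\<eta> x)) (fst x) =
      f x *\<^sub>R ip_bracket br (\<lambda>_. fst (\<xi> x)) (\<lambda>_. fst (\<eta> x)) (fst x)"
    using ip_bracket_leibniz[OF assms(1), of "\<lambda>_. f x" "fst x" "\<lambda>_. fst (\<xi> x)" "\<lambda>_. fst (\<eta> x)"]
    by simp
  then show ?thesis
    unfolding anch
    by (simp add: prolongation_def ip_algebroid_def vf_bracket_def frechet_derivative_scale assms(2) d
        linear_cmul[OF linear_frechet_derivative[OF d(1)]]
        linear_cmul[OF linear_frechet_derivative[OF d(2)]] prod_eq_iff scaleR_add_right scaleR_diff_right)
qed

end

theory Submission
  imports Defs
begin

text \<open>Along a section \<open>\<iota>\<close> with \<open>k = s \<circ> \<iota>\<close> the equations \<open>\<iota>\<^sup>*\<sigma>\<^sub>i\<^sub>j = 0\<close>, evaluated on \<open>\<Gamma>\<^sub>0\<close>, \<open>W\<^sub>l\<close> and \<open>H\<^sub>l\<close>, say that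
  \<open>\<gamma>(k\<^sub>i\<^sub>j) = k\<^sub>r\<^sub>j \<lambda>\<^sub>i\<^sup>r + k\<^sub>i\<^sub>r \<lambda>\<^sub>j\<^sup>r\<close>, that \<open>\<partial>k\<^sub>i\<^sub>j/\<partial>w\<^sup>l = - P\<^sub>i\<^sub>j\<^sub>l\<close> is totally symmetric, and that the horizontal
  derivatives of \<open>k\<close> differ from \<open>- Q\<^sub>i\<^sub>j\<^sub>l\<close> by the prescribed terms. The last condition is automatic: commuting
  \<open>\<gamma>\<close> with \<open>\<partial>/\<partial>w\<^sup>l\<close> in the first one expresses \<open>Q\<^sub>i\<^sub>j\<^sub>l\<close> through the first two. The remaining algebraic
  condition on \<open>\<phi>\<close> comes from the hypothesis on the \<open>\<omega>\<^sup>i\<^sup>j\<close>: \<open>\<delta>\<omega>\<^sup>i\<^sup>j(\<Gamma>\<^sub>0, H\<^sub>k, H\<^sub>l) = 0\<close> forces \<open>\<phi>\<close> to be a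
  multiple of the identity. That a section annihilating the \<open>\<sigma>\<^sub>i\<^sub>j\<close> annihilates the whole differential ideal
  holds because the kernel of \<open>\<iota>\<^sup>*\<close> is itself a differential ideal; this needs the Koszul formula on the
  prolongation to define a form.\<close>

section \<open>Calculus of smooth maps\<close>

text \<open>The exterior derivative is a definite description, so nothing can be said about \<delta>
  on either algebroid before the Koszul expression is known to come from exactly one form. This
  needs a global section through every fibre vector, and on the prolongation such sections are not
  constant, because the fibre is a moving subspace. The locale \<open>framed_algebroid\<close>
  therefore asks for a smooth family of projections onto the fibres and treats the IP algebroid and
  its prolongation at once. Generated ideals have no convenient explicit elements, so they are
  bounded from outside by ideals \<open>vanishing S V\<close> of forms that are zero on lists of
  vectors from \<open>V x\<close> for x in S. For the \<omega>^ij, V is the common kernel of the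
  \<Psi>^i over all of M; for the \<sigma>_ij, it is the image of I over the image of \<iota>.
  Closure under \<delta> is in the second case a question of involutivity: second derivatives of
  \<iota> cancel by symmetry, and the anchor respects brackets by the Jacobi identity. This replaces
  a proof that I^* commutes with \<delta>.\<close>

lemma Ck_differentiable: "Ck (Suc k) f \<Longrightarrow> f differentiable (at x)"
  by simp

lemma Ck_Suc_imp: "Ck (Suc k) f \<Longrightarrow> Ck k f"
proof (induction k arbitrary: f)
  case 0
  then show ?case
    by (auto intro!: continuous_at_imp_continuous_on differentiable_imp_continuous_within)
next
  case (Suc k)
  then show ?case by (metis Ck.simps(2))
qed

lemma frechet_derivative_eqI:
  "(f has_derivative f') (at x) \<Longrightarrow> frechet_derivative f (at x) = f'"
  using frechet_derivative_at by metis

lemma frechet_derivative_add: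
  assumes "f differentiable (at x)" "g differentiable (at x)"
  shows "frechet_derivative (\<lambda>x. f x + g x) (at x) =
    (\<lambda>v. frechet_derivative f (at x) v + frechet_derivative g (at x) v)"
  using assms unfolding frechet_derivative_works by (intro frechet_derivative_eqI has_derivative_add)

lemma Ck_const: "Ck k (\<lambda>x. c)"
proof (induction k arbitrary: c)
  case (Suc k)
  then show ?case by simp
qed simp

lemma Ck_add: "Ck k f \<Longrightarrow> Ck k g \<Longrightarrow> Ck k (\<lambda>x. f x + g x)"
proof (induction k arbitrary: f g)
  case (Suc k)
  then show ?case by (simp add: frechet_derivative_add)
qed (simp add: continuous_on_add)

text \<open>The Leibniz rule returns two terms of the same shape with one factor replaced by a
  directional derivative, so the induction runs over all pairs of factors; the undifferentiated
  factor is lowered from \<open>Ck (Suc k)\<close> to \<open>Ck k\<close>.\<close>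

lemma Ck_bilinear:
  assumes b: "bounded_bilinear p"
  shows "Ck k f \<Longrightarrow> Ck k g \<Longrightarrow> Ck k (\<lambda>x. p (f x) (g x))"
proof (induction k arbitrary: f g)
  case 0
  then show ?case using bounded_bilinear.continuous_on[OF b] by simp
next
  case (Suc k)
  have d: "((\<lambda>x. p (f x) (g x)) has_derivative
      (\<lambda>h. p (f x) (frechet_derivative g (at x) h) + p (frechet_derivative f (at x) h) (g x))) (at x)" for x
    using Suc.prems by (intro bounded_bilinear.FDERIV[OF b]) (simp_all add: frechet_derivative_works)
  have "Ck k f" "Ck k g" using Suc.prems Ck_Suc_imp by blast+
  then show ?case
    using Suc.prems d by (auto simp: frechet_derivative_eqI[OF d] differentiable_def
        intro!: Ck_add Suc.IH)
qed

lemma Ck_linear_left: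
  assumes h: "bounded_linear h"
  shows "Ck k f \<Longrightarrow> Ck k (\<lambda>x. h (f x))"
proof (induction k arbitrary: f)
  case 0
  then show ?case using bounded_linear.continuous_on[OF h] by simp
next
  case (Suc k)
  have d: "((\<lambda>x. h (f x)) has_derivative (\<lambda>v. h (frechet_derivative f (at x) v))) (at x)" for x
    using Suc.prems by (intro bounded_linear.has_derivative[OF h]) (simp add: frechet_derivative_works)
  show ?case
    using Suc d by (auto simp: frechet_derivative_eqI[OF d] differentiable_def)
qed

lemma Ck_linear_right:
  assumes h: "bounded_linear h"
  shows "Ck k f \<Longrightarrow> Ck k (\<lambda>x. f (h x))"
proof (induction k arbitrary: f)
  case 0
  then show ?case
    using continuous_on_compose[OF linear_continuous_on[OF h], of UNIV f]
    by (auto simp: o_def intro: continuous_on_subset)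
next
  case (Suc k)
  have d: "((\<lambda>x. f (h x)) has_derivative (\<lambda>v. frechet_derivative f (at (h x)) (h v))) (at x)" for x
    using Suc.prems
    by (intro has_derivative_compose[OF bounded_linear_imp_has_derivative[OF h]])
      (simp add: frechet_derivative_works)
  show ?case
    using Suc d by (auto simp: frechet_derivative_eqI[OF d] differentiable_def)
qed

lemma smooth_differentiable: "smooth f \<Longrightarrow> f differentiable (at x)"
  unfolding smooth_def using Ck_differentiable by blast

lemma smooth_has_derivative:
  "smooth f \<Longrightarrow> (f has_derivative frechet_derivative f (at x)) (at x)"
  using smooth_differentiable frechet_derivative_works by blast

lemma smooth_derivative: "smooth f \<Longrightarrow> smooth (\<lambda>x. frechet_derivative f (at x) v)"
  unfolding smooth_def by (metis Ck.simps(2))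

lemma smooth_const [simp]: "smooth (\<lambda>x. c)"
  by (simp add: smooth_def Ck_const)

lemma smooth_add: "smooth f \<Longrightarrow> smooth g \<Longrightarrow> smooth (\<lambda>x. f x + g x)"
  by (simp add: smooth_def Ck_add)

lemma smooth_bilinear:
  "bounded_bilinear p \<Longrightarrow> smooth f \<Longrightarrow> smooth g \<Longrightarrow> smooth (\<lambda>x. p (f x) (g x))"
  by (simp add: smooth_def Ck_bilinear)

lemmas smooth_scaleR = smooth_bilinear[OF bounded_bilinear_scaleR]
lemmas smooth_mult = smooth_bilinear[OF bounded_bilinear_mult]
lemmas smooth_inner = smooth_bilinear[OF bounded_bilinear_inner]

lemma smooth_linear_left: "bounded_linear h \<Longrightarrow> smooth f \<Longrightarrow> smooth (\<lambda>x. h (f x))"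
  by (simp add: smooth_def Ck_linear_left)

lemma smooth_linear_right: "bounded_linear h \<Longrightarrow> smooth f \<Longrightarrow> smooth (\<lambda>x. f (h x))"
  by (simp add: smooth_def Ck_linear_right)

lemma smooth_ident: "smooth (\<lambda>x. x)"
  unfolding smooth_def
proof
  show "Ck k (\<lambda>x::'a. x)" for k
    by (cases k) (simp_all add: Ck_const)
qed

lemma smooth_linear: "bounded_linear h \<Longrightarrow> smooth h"
  using smooth_linear_left[of h, OF _ smooth_ident] by simp

lemmas smooth_fst = smooth_linear_left[OF bounded_linear_fst]
lemmas smooth_snd = smooth_linear_left[OF bounded_linear_snd]

lemma smooth_minus: "smooth f \<Longrightarrow> smooth (\<lambda>x. - f x)"
  by (rule smooth_linear_left[OF bounded_linear_minus[OF bounded_linear_ident]])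

lemma smooth_diff: "smooth f \<Longrightarrow> smooth g \<Longrightarrow> smooth (\<lambda>x. f x - g x)"
  using smooth_add[OF _ smooth_minus, of f g] by simp

lemma smooth_sum: "(\<And>i. i \<in> I \<Longrightarrow> smooth (f i)) \<Longrightarrow> smooth (\<lambda>x. \<Sum>i\<in>I. f i x)"
  by (induction I rule: infinite_finite_induct) (simp_all add: smooth_add)

lemma smooth_divide: "smooth f \<Longrightarrow> smooth (\<lambda>x. f x / (c::real))"
  by (rule smooth_linear_left[OF bounded_linear_divide])

lemma smooth_Pair:
  assumes "smooth f" "smooth g"
  shows "smooth (\<lambda>x. (f x, g x))"
proof -
  have "bounded_linear (\<lambda>a. (a, 0))" "bounded_linear (\<lambda>b. (0, b))"
    by (intro bounded_linear_Pair bounded_linear_ident bounded_linear_zero)+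
  from smooth_add[OF smooth_linear_left[OF this(1) assms(1)] smooth_linear_left[OF this(2) assms(2)]]
  show ?thesis by simp
qed

lemmas smooth_intros = smooth_add smooth_scaleR smooth_mult smooth_inner smooth_fst smooth_snd
  smooth_minus smooth_diff smooth_sum smooth_divide smooth_Pair smooth_ident smooth_const

lemma smooth_vec_lambda:
  fixes f :: "'a::finite \<Rightarrow> 'b::real_normed_vector \<Rightarrow> real"
  assumes "\<And>i. smooth (f i)"
  shows "smooth (\<lambda>x. \<chi> i. f i x)"
proof -
  have "(\<lambda>x. \<chi> i. f i x) = (\<lambda>x. \<Sum>i\<in>UNIV. f i x *\<^sub>R axis i 1)"
    by (auto simp: fun_eq_iff vec_eq_iff axis_def if_distrib[of "\<lambda>y. _ * y"] cong: if_cong)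
  then show ?thesis using assms by (simp add: smooth_intros)
qed

lemma frechet_derivative_expand:
  fixes f :: "'a::euclidean_space \<Rightarrow> 'b::real_normed_vector"
  assumes "f differentiable (at x)"
  shows "frechet_derivative f (at x) v = (\<Sum>b\<in>Basis. (v \<bullet> b) *\<^sub>R frechet_derivative f (at x) b)"
proof -
  have l: "linear (frechet_derivative f (at x))" using assms by (rule linear_frechet_derivative)
  have "frechet_derivative f (at x) v = frechet_derivative f (at x) (\<Sum>b\<in>Basis. (v \<bullet> b) *\<^sub>R b)"
    by (simp add: euclidean_representation)
  then show ?thesis by (simp add: linear_sum[OF l] linear_cmul[OF l])
qed

text \<open>\<open>smooth\<close> controls derivatives only along fixed directions; expanding a
  moving direction in the finite \<open>Basis\<close> turns its derivative into a finite sum of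
  products of smooth functions.\<close>

lemma smooth_frechet_derivative:
  fixes f :: "'a::euclidean_space \<Rightarrow> 'b::real_normed_vector"
  assumes "smooth f" "smooth X"
  shows "smooth (\<lambda>x. frechet_derivative f (at x) (X x))"
  unfolding frechet_derivative_expand[OF smooth_differentiable[OF assms(1)], of _ "X _"]
  by (intro smooth_sum smooth_scaleR smooth_inner smooth_derivative assms smooth_const)

lemma smooth_imp_continuous: "smooth f \<Longrightarrow> continuous_on S f"
  by (metis Ck.simps(1) continuous_on_subset smooth_def subset_UNIV)

section \<open>Symmetry of second derivatives\<close>

lemma mixed_difference_mvt:
  fixes f :: "'a::real_normed_vector \<Rightarrow> real"
  assumes "smooth f" "h > 0"
  shows "\<exists>\<xi> \<eta>. 0 < \<xi> \<and> \<xi> < h \<and> 0 < \<eta> \<and> \<eta> < h \<and>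
    f (x + h *\<^sub>R u + h *\<^sub>R v) - f (x + h *\<^sub>R u) - f (x + h *\<^sub>R v) + f x =
      h * (h * frechet_derivative (\<lambda>y. frechet_derivative f (at y) u) (at (x + \<xi> *\<^sub>R u + \<eta> *\<^sub>R v)) v)"
proof -
  have D: "((\<lambda>s. g (y + s *\<^sub>R w)) has_real_derivative frechet_derivative g (at (y + s *\<^sub>R w)) w) (at s)"
    if "smooth g" for g :: "'a \<Rightarrow> real" and y w s
  proof -
    have lin: "linear (frechet_derivative g (at (y + s *\<^sub>R w)))"
      using that by (intro linear_frechet_derivative smooth_differentiable)
    have "((\<lambda>s. y + s *\<^sub>R w) has_derivative (\<lambda>r. r *\<^sub>R w)) (at s)"
      by (auto intro!: derivative_eq_intros)
    from has_derivative_compose[OF this smooth_has_derivative[OF that]]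
    show ?thesis
      by (simp add: has_field_derivative_def linear_cmul[OF lin] mult.commute[of _ "frechet_derivative _ _ _"])
  qed
  \<comment> \<open>The mixed difference over the parallelogram is an increment of \<open>g\<close>
    along u. The mean value theorem for \<open>g\<close>, and then for \<open>k\<close> along v,
    produces the two intermediate parameters.\<close>
  define g where "g s = f (x + h *\<^sub>R v + s *\<^sub>R u) - f (x + s *\<^sub>R u)" for s
  have "(g has_real_derivative (frechet_derivative f (at (x + h *\<^sub>R v + s *\<^sub>R u)) u
      - frechet_derivative f (at (x + s *\<^sub>R u)) u)) (at s)" for s
    unfolding g_def by (intro DERIV_diff D assms)
  from MVT2[OF assms(2) this] obtain \<xi> where \<xi>: "0 < \<xi>" "\<xi> < h" "g h - g 0 =
      h * (frechet_derivative f (at (x + h *\<^sub>R v + \<xi> *\<^sub>R u)) u - frechet_derivative f (at (x + \<xi> *\<^sub>R u)) u)"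
    by auto
  define k where "k s = frechet_derivative f (at (x + \<xi> *\<^sub>R u + s *\<^sub>R v)) u" for s
  have "(k has_real_derivative frechet_derivative (\<lambda>y. frechet_derivative f (at y) u)
      (at (x + \<xi> *\<^sub>R u + s *\<^sub>R v)) v) (at s)" for s
    unfolding k_def by (intro D[of "\<lambda>y. frechet_derivative f (at y) u"] smooth_derivative assms)
  from MVT2[OF assms(2) this] obtain \<eta> where \<eta>: "0 < \<eta>" "\<eta> < h" "k h - k 0 =
      h * frechet_derivative (\<lambda>y. frechet_derivative f (at y) u) (at (x + \<xi> *\<^sub>R u + \<eta> *\<^sub>R v)) v"
    by auto
  have "g h - g 0 = h * (k h - k 0)"
    using \<xi>(3) by (simp add: k_def add_ac)
  then show ?thesis
    using \<xi>(1,2) \<eta> by (intro exI[of _ \<xi>] exI[of _ \<eta>]) (simp add: g_def add_ac)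
qed

text \<open>The mixed difference does not change when u and v trade places, while its two mean value
  expressions approach the two iterated derivatives as the parallelogram shrinks; continuity then
  excludes a gap between them.\<close>

lemma frechet_derivative_symmetric_real:
  fixes f :: "'a::real_normed_vector \<Rightarrow> real"
  assumes "smooth f"
  shows "frechet_derivative (\<lambda>y. frechet_derivative f (at y) u) (at x) v =
    frechet_derivative (\<lambda>y. frechet_derivative f (at y) v) (at x) u"
proof (rule ccontr)
  define G where "G u v x = frechet_derivative (\<lambda>y. frechet_derivative f (at y) u) (at x) v" for u v x
  define e where "e = \<bar>G u v x - G v u x\<bar> / 2"
  assume "\<not> ?thesis"
  then have e: "e > 0" by (simp add: e_def G_def)
  have cont: "isCont (G u v) x" for u v
    unfolding G_def
    using smooth_imp_continuous[of _ UNIV, OF smooth_derivative[OF smooth_derivative[OF assms, of u], of v]]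
    by (simp add: continuous_on_eq_continuous_at)
  obtain d1 where d1: "d1 > 0" "\<And>y. dist y x < d1 \<Longrightarrow> dist (G u v y) (G u v x) < e"
    using cont[of u v] e unfolding continuous_at_eps_delta by blast
  obtain d2 where d2: "d2 > 0" "\<And>y. dist y x < d2 \<Longrightarrow> dist (G v u y) (G v u x) < e"
    using cont[of v u] e unfolding continuous_at_eps_delta by blast
  \<comment> \<open>The whole parallelogram with sides h u and h v has to stay within both radii;
    the summand 1 keeps the denominator positive when u and v are zero.\<close>
  define h where "h = min d1 d2 / (norm u + norm v + 1)"
  have pos: "norm u + norm v + 1 > 0" by (smt (verit) norm_ge_zero)
  have h: "h > 0" using d1(1) d2(1) pos by (simp add: h_def)
  have hm: "h * norm u + h * norm v < min d1 d2"
  proof -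
    have "h * (norm u + norm v + 1) = min d1 d2" using pos by (simp add: h_def)
    then show ?thesis using h by (simp only: distrib_left)
  qed
  have near: "dist (x + a *\<^sub>R u + b *\<^sub>R v) x < min d1 d2" if "0 < a" "a < h" "0 < b" "b < h" for a b
  proof -
    have "dist (x + a *\<^sub>R u + b *\<^sub>R v) x = norm (a *\<^sub>R u + b *\<^sub>R v)" by (simp add: dist_norm)
    also have "\<dots> \<le> a * norm u + b * norm v" using norm_triangle_ineq[of "a *\<^sub>R u" "b *\<^sub>R v"] that by simp
    also have "\<dots> \<le> h * norm u + h * norm v" using that by (intro add_mono mult_right_mono) auto
    finally show ?thesis using hm by linarith
  qed
  obtain a b where ab: "0 < a" "a < h" "0 < b" "b < h"
    "f (x + h *\<^sub>R u + h *\<^sub>R v) - f (x + h *\<^sub>R u) - f (x + h *\<^sub>R v) + f x = h * (h * G u v (x + a *\<^sub>R u + b *\<^sub>R v))"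
    using mixed_difference_mvt[OF assms h, of x u v] unfolding G_def by blast
  obtain a' b' where ab': "0 < a'" "a' < h" "0 < b'" "b' < h"
    "f (x + h *\<^sub>R v + h *\<^sub>R u) - f (x + h *\<^sub>R v) - f (x + h *\<^sub>R u) + f x = h * (h * G v u (x + a' *\<^sub>R v + b' *\<^sub>R u))"
    using mixed_difference_mvt[OF assms h, of x v u] unfolding G_def by blast
  have "G u v (x + a *\<^sub>R u + b *\<^sub>R v) = G v u (x + b' *\<^sub>R u + a' *\<^sub>R v)"
  proof -
    have "h * (h * G u v (x + a *\<^sub>R u + b *\<^sub>R v)) = h * (h * G v u (x + a' *\<^sub>R v + b' *\<^sub>R u))"
      unfolding ab(5)[symmetric] ab'(5)[symmetric] by (simp add: add_ac)
    then show ?thesis using h by (simp add: add_ac)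
  qed
  moreover have "dist (G u v (x + a *\<^sub>R u + b *\<^sub>R v)) (G u v x) < e"
    using near[OF ab(1-4)] by (intro d1(2)) simp
  moreover have "dist (G v u (x + b' *\<^sub>R u + a' *\<^sub>R v)) (G v u x) < e"
    using near[OF ab'(3,4,1,2)] by (intro d2(2)) simp
  ultimately show False
    unfolding dist_real_def e_def by (smt (verit) field_sum_of_halves)
qed

lemma frechet_derivative_linear_left:
  assumes "bounded_linear h" "f differentiable (at x)"
  shows "frechet_derivative (\<lambda>x. h (f x)) (at x) v = h (frechet_derivative f (at x) v)"
  using frechet_derivative_eqI[OF bounded_linear.has_derivative[OF assms(1)
        assms(2)[unfolded frechet_derivative_works]]] by simp

lemma frechet_derivative_symmetric:
  fixes f :: "'a::real_normed_vector \<Rightarrow> 'b::euclidean_space"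
  assumes "smooth f"
  shows "frechet_derivative (\<lambda>y. frechet_derivative f (at y) u) (at x) v =
    frechet_derivative (\<lambda>y. frechet_derivative f (at y) v) (at x) u"
proof (rule euclidean_eqI)
  fix b :: 'b
  have *: "frechet_derivative (\<lambda>y. frechet_derivative (\<lambda>z. f z \<bullet> b) (at y) u) (at x) v =
    frechet_derivative (\<lambda>y. frechet_derivative f (at y) u) (at x) v \<bullet> b" for u v
    by (simp add: frechet_derivative_linear_left[OF bounded_linear_inner_left] smooth_differentiable
        smooth_derivative assms)
  show "frechet_derivative (\<lambda>y. frechet_derivative f (at y) u) (at x) v \<bullet> b =
    frechet_derivative (\<lambda>y. frechet_derivative f (at y) v) (at x) u \<bullet> b"
    unfolding *[symmetric] by (intro frechet_derivative_symmetric_real smooth_intros assms)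
qed

lemma frechet_derivative_scale_add:
  fixes f :: "'a::real_normed_vector \<Rightarrow> real"
  assumes "f differentiable (at x)" "A differentiable (at x)" "B differentiable (at x)"
  shows "frechet_derivative (\<lambda>y. f y *\<^sub>R A y + B y) (at x) v =
    f x *\<^sub>R frechet_derivative A (at x) v + frechet_derivative f (at x) v *\<^sub>R A x + frechet_derivative B (at x) v"
proof -
  have "((\<lambda>y. f y *\<^sub>R A y + B y) has_derivative (\<lambda>v. f x *\<^sub>R frechet_derivative A (at x) v
      + frechet_derivative f (at x) v *\<^sub>R A x + frechet_derivative B (at x) v)) (at x)"
    using assms unfolding frechet_derivative_works by (intro has_derivative_add has_derivative_scaleR)
  then show ?thesis by (simp add: frechet_derivative_eqI)
qed

lemmas frechet_derivative_mult_add =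
  frechet_derivative_scale_add[where 'b = real, unfolded real_scaleR_def]

lemma frechet_derivative_fst_snd:
  assumes "f differentiable (at x)"
  shows "frechet_derivative (\<lambda>y. fst (f y)) (at x) v = fst (frechet_derivative f (at x) v)"
    and "frechet_derivative (\<lambda>y. snd (f y)) (at x) v = snd (frechet_derivative f (at x) v)"
  by (rule frechet_derivative_linear_left[OF bounded_linear_fst assms]
      frechet_derivative_linear_left[OF bounded_linear_snd assms])+

lemma frechet_derivative_chain:
  assumes "f differentiable (at x)" "g differentiable (at (f x))"
  shows "frechet_derivative (\<lambda>y. g (f y)) (at x) h =
    frechet_derivative g (at (f x)) (frechet_derivative f (at x) h)"
  using frechet_derivative_eqI[OF has_derivative_compose[OF assms[unfolded frechet_derivative_works]]] by simp

text \<open>The first summand keeps the direction frozen at \<open>v x\<close>, so it is a genuine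
  second derivative to which symmetry applies; the variation of the direction is isolated in the
  second. Expanding in \<open>Basis\<close> reduces this to the product rule.\<close>

lemma frechet_derivative_derivative:
  fixes f :: "'a::euclidean_space \<Rightarrow> 'b::real_normed_vector"
  assumes "smooth f" "v differentiable (at x)"
  shows "frechet_derivative (\<lambda>y. frechet_derivative f (at y) (v y)) (at x) h =
    frechet_derivative (\<lambda>y. frechet_derivative f (at y) (v x)) (at x) h
    + frechet_derivative f (at x) (frechet_derivative v (at x) h)"
proof -
  note e = frechet_derivative_expand[OF smooth_differentiable[OF assms(1)]]
  have d: "((\<lambda>y. frechet_derivative f (at y) b) has_derivative
      frechet_derivative (\<lambda>y. frechet_derivative f (at y) b) (at x)) (at x)" for b
    by (intro smooth_has_derivative smooth_derivative assms(1))
  have dv: "((\<lambda>y. v y \<bullet> b) has_derivative (\<lambda>h. frechet_derivative v (at x) h \<bullet> b)) (at x)" for b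
    by (intro has_derivative_inner_left assms(2)[unfolded frechet_derivative_works])
  have "((\<lambda>y. \<Sum>b\<in>Basis. (v y \<bullet> b) *\<^sub>R frechet_derivative f (at y) b) has_derivative
     (\<lambda>h. \<Sum>b\<in>Basis. (v x \<bullet> b) *\<^sub>R frechet_derivative (\<lambda>y. frechet_derivative f (at y) b) (at x) h
       + (frechet_derivative v (at x) h \<bullet> b) *\<^sub>R frechet_derivative f (at x) b)) (at x)"
    by (intro has_derivative_sum has_derivative_scaleR d dv)
  then have 1: "frechet_derivative (\<lambda>y. frechet_derivative f (at y) (v y)) (at x) h =
    (\<Sum>b\<in>Basis. (v x \<bullet> b) *\<^sub>R frechet_derivative (\<lambda>y. frechet_derivative f (at y) b) (at x) h)
    + frechet_derivative f (at x) (frechet_derivative v (at x) h)"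
    by (subst e) (simp add: frechet_derivative_eqI sum.distrib e[of x "frechet_derivative v (at x) h"])
  have "((\<lambda>y. \<Sum>b\<in>Basis. (v x \<bullet> b) *\<^sub>R frechet_derivative f (at y) b) has_derivative
     (\<lambda>h. \<Sum>b\<in>Basis. (v x \<bullet> b) *\<^sub>R frechet_derivative (\<lambda>y. frechet_derivative f (at y) b) (at x) h)) (at x)"
    by (intro has_derivative_sum has_derivative_scaleR_right d)
  then have 2: "frechet_derivative (\<lambda>y. frechet_derivative f (at y) (v x)) (at x) h =
    (\<Sum>b\<in>Basis. (v x \<bullet> b) *\<^sub>R frechet_derivative (\<lambda>y. frechet_derivative f (at y) b) (at x) h)"
    by (subst e) (simp add: frechet_derivative_eqI)
  show ?thesis using 1 2 by simp
qed

section \<open>Forms on an algebroid\<close>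

lemma nths_Cons_compl_0: "nths (s # ss) (- {0}) = ss"
  by (simp add: nths_Cons nths_all)

lemma nths_Cons_compl_Suc: "nths (s # ss) (- {Suc j}) = s # nths ss (- {j})"
proof -
  have "{k. Suc k \<in> - {Suc j}} = - {j}" by auto
  then show ?thesis by (simp add: nths_Cons)
qed

lemma nths_Cons_compl_Suc_Suc: "nths (s # ss) (- {Suc i, Suc j}) = s # nths ss (- {i, j})"
proof -
  have "{k. Suc k \<in> - {Suc i, Suc j}} = - {i, j}" by auto
  then show ?thesis by (simp add: nths_Cons)
qed

lemma nths_Cons_compl_0_Suc: "nths (s # ss) (- {0, Suc j}) = nths ss (- {j})"
proof -
  have "{k. Suc k \<in> - {0, Suc j}} = - {j}" by auto
  then show ?thesis by (simp add: nths_Cons)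
qed

text \<open>Interior product. Its argument is a section and not a single vector, so that the result
  is again a form and inductions over argument lists can move one argument after another into the
  form.\<close>

definition contract :: "('m \<Rightarrow> 'f) \<Rightarrow> ('m, 'f) form \<Rightarrow> ('m, 'f) form" where
  "contract X \<omega> = (\<lambda>x vs. \<omega> x (X x # vs))"

text \<open>Polarizing the condition on adjacent entries at a + b yields antisymmetry under
  neighbouring swaps, and such swaps carry two equal entries next to each other.\<close>

lemma nondistinct_zeroI:
  fixes f :: "'f::real_vector list \<Rightarrow> real"
  assumes sub: "subspace F"
    and lin: "\<And>us vs a b c. a \<in> F \<Longrightarrow> b \<in> F \<Longrightarrow> set us \<subseteq> F \<Longrightarrow> set vs \<subseteq> F \<Longrightarrow>
      f (us @ (c *\<^sub>R a + b) # vs) = c * f (us @ a # vs) + f (us @ b # vs)"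
    and adj: "\<And>us vs a. a \<in> F \<Longrightarrow> set us \<subseteq> F \<Longrightarrow> set vs \<subseteq> F \<Longrightarrow> f (us @ a # a # vs) = 0"
    and vs: "set vs \<subseteq> F" "\<not> distinct vs"
  shows "f vs = 0"
proof -
  have swap: "f (us @ a # b # vs) = - f (us @ b # a # vs)"
    if "a \<in> F" "b \<in> F" "set us \<subseteq> F" "set vs \<subseteq> F" for us vs a b
  proof -
    have ab: "a + b \<in> F" using that sub by (simp add: subspace_add)
    have "0 = f (us @ (a + b) # (a + b) # vs)" using adj[OF ab] that by simp
    also have "\<dots> = f (us @ a # (a + b) # vs) + f (us @ b # (a + b) # vs)"
      using lin[of a b us "(a + b) # vs" 1] that ab by simp
    also have "f (us @ a # (a + b) # vs) = f (us @ a # b # vs)"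
      using lin[of a b "us @ [a]" vs 1] adj[of a us vs] that by simp
    also have "f (us @ b # (a + b) # vs) = f (us @ b # a # vs)"
      using lin[of a b "us @ [b]" vs 1] adj[of b us vs] that by simp
    finally show ?thesis by simp
  qed
  have rep: "f (us @ a # zs @ a # ws) = 0" if "a \<in> F" "set us \<subseteq> F" "set zs \<subseteq> F" "set ws \<subseteq> F"
    for us zs ws a
    using that
  proof (induction zs arbitrary: us)
    case Nil
    then show ?case using adj by simp
  next
    case (Cons b zs)
    then have "f (us @ a # b # zs @ a # ws) = - f ((us @ [b]) @ a # zs @ a # ws)"
      using swap[of a b us "zs @ a # ws"] by simp
    also have "\<dots> = 0" using Cons.prems by (subst Cons.IH) auto
    finally show ?case by simp
  qed
  obtain us a zs ws where "vs = us @ [a] @ zs @ [a] @ ws"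
    using not_distinct_decomp[OF vs(2)] by blast
  then show ?thesis using rep[of a us zs ws] vs(1) by auto
qed

text \<open>\<open>T x\<close> is a projection onto the fibre over x, smooth in x, so
  \<open>\<lambda>y. T y v\<close> is a global section through any fibre vector v. The linearity and
  Leibniz conditions treat combinations f A + B, which joins additivity and scaling in one axiom; f
  = 1 recovers additivity.\<close>

locale framed_algebroid =
  fixes L :: "('m::euclidean_space, 'f::euclidean_space) algebroid"
    and T :: "'m \<Rightarrow> 'f \<Rightarrow> 'f"
  assumes fiber_subspace: "subspace (fiber L x)"
    and frame_linear: "linear (T x)"
    and frame_in: "T x v \<in> fiber L x"
    and frame_id: "v \<in> fiber L x \<Longrightarrow> T x v = v"
    and frame_smooth: "smooth (\<lambda>x. T x v)"
    and anchor_linear: "a \<in> fiber L x \<Longrightarrow> b \<in> fiber L x \<Longrightarrow>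
      anchor L x (c *\<^sub>R a + b) = c *\<^sub>R anchor L x a + anchor L x b"
    and anchor_smooth: "X \<in> sections L \<Longrightarrow> smooth (\<lambda>x. anchor L x (X x))"
    and bracket_section: "X \<in> sections L \<Longrightarrow> Y \<in> sections L \<Longrightarrow> bracket L X Y \<in> sections L"
    and bracket_antisym: "X \<in> sections L \<Longrightarrow> Y \<in> sections L \<Longrightarrow> bracket L X Y x = - bracket L Y X x"
    and bracket_leibniz: "X \<in> sections L \<Longrightarrow> A \<in> sections L \<Longrightarrow> B \<in> sections L \<Longrightarrow> smooth f \<Longrightarrow>
      bracket L X (\<lambda>y. f y *\<^sub>R A y + B y) x =
        f x *\<^sub>R bracket L X A x + frechet_derivative f (at x) (anchor L x (X x)) *\<^sub>R A x + bracket L X B x"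
begin

lemma fiber_zero: "0 \<in> fiber L x"
  and fiber_combo: "a \<in> fiber L x \<Longrightarrow> b \<in> fiber L x \<Longrightarrow> c *\<^sub>R a + b \<in> fiber L x"
  using fiber_subspace[of x] by (auto simp: subspace_def)

lemma sections_fiber: "X \<in> sections L \<Longrightarrow> X x \<in> fiber L x"
  by (simp add: sections_def)

lemma sections_image_fiber [simp]: "set ss \<subseteq> sections L \<Longrightarrow> (\<lambda>s. s x) ` set ss \<subseteq> fiber L x"
  by (auto simp: sections_def)

lemma frame_section [simp]: "(\<lambda>y. T y v) \<in> sections L"
  by (simp add: sections_def frame_smooth frame_in)

lemma sections_combo:
  "A \<in> sections L \<Longrightarrow> B \<in> sections L \<Longrightarrow> smooth f \<Longrightarrow> (\<lambda>y. f y *\<^sub>R A y + B y) \<in> sections L"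
  by (simp add: sections_def smooth_intros fiber_combo)

lemma zero_section [simp]: "(\<lambda>y. 0) \<in> sections L"
  by (simp add: sections_def fiber_zero)

lemma form_linear:
  "\<omega> \<in> forms L \<Longrightarrow> a \<in> fiber L x \<Longrightarrow> b \<in> fiber L x \<Longrightarrow> set us \<subseteq> fiber L x \<Longrightarrow> set vs \<subseteq> fiber L x \<Longrightarrow>
    \<omega> x (us @ (c *\<^sub>R a + b) # vs) = c * \<omega> x (us @ a # vs) + \<omega> x (us @ b # vs)"
  unfolding forms_def by blast

lemma form_linear_Cons:
  "\<omega> \<in> forms L \<Longrightarrow> a \<in> fiber L x \<Longrightarrow> b \<in> fiber L x \<Longrightarrow> set vs \<subseteq> fiber L x \<Longrightarrow>
    \<omega> x ((c *\<^sub>R a + b) # vs) = c * \<omega> x (a # vs) + \<omega> x (b # vs)"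
  using form_linear[of \<omega> a x b "[]" vs c] by simp

lemma form_nondistinct: "\<omega> \<in> forms L \<Longrightarrow> \<not> distinct vs \<Longrightarrow> \<omega> x vs = 0"
  unfolding forms_def by blast

lemma form_outside: "\<omega> \<in> forms L \<Longrightarrow> \<not> set vs \<subseteq> fiber L x \<Longrightarrow> \<omega> x vs = 0"
  unfolding forms_def by blast

lemma form_smooth: "\<omega> \<in> forms L \<Longrightarrow> set ss \<subseteq> sections L \<Longrightarrow> smooth (\<lambda>x. \<omega> x (map (\<lambda>s. s x) ss))"
  unfolding forms_def by blast

lemma form_swap_Cons:
  assumes "\<omega> \<in> forms L" "a \<in> fiber L x" "b \<in> fiber L x" "set vs \<subseteq> fiber L x"
  shows "\<omega> x (a # b # vs) = - \<omega> x (b # a # vs)"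
proof -
  have ab: "a + b \<in> fiber L x" using fiber_combo[of a x b 1] assms by simp
  have "0 = \<omega> x ((a + b) # (a + b) # vs)" using form_nondistinct[OF assms(1)] by simp
  also have "\<dots> = \<omega> x (a # (a + b) # vs) + \<omega> x (b # (a + b) # vs)"
    using form_linear_Cons[of \<omega> a x b "(a + b) # vs" 1] assms ab by simp
  also have "\<omega> x (a # (a + b) # vs) = \<omega> x (a # b # vs)"
    using form_linear[of \<omega> a x b "[a]" vs 1] form_nondistinct[OF assms(1), of "a # a # vs"] assms by simp
  also have "\<omega> x (b # (a + b) # vs) = \<omega> x (b # a # vs)"
    using form_linear[of \<omega> a x b "[b]" vs 1] form_nondistinct[OF assms(1), of "b # b # vs"] assms by simp
  finally show ?thesis by simp
qed

lemma formsI: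
  assumes "\<And>x vs. \<not> set vs \<subseteq> fiber L x \<Longrightarrow> \<omega> x vs = 0"
    and "\<And>x us vs a b c. a \<in> fiber L x \<Longrightarrow> b \<in> fiber L x \<Longrightarrow> set us \<subseteq> fiber L x \<Longrightarrow> set vs \<subseteq> fiber L x \<Longrightarrow>
      \<omega> x (us @ (c *\<^sub>R a + b) # vs) = c * \<omega> x (us @ a # vs) + \<omega> x (us @ b # vs)"
    and "\<And>x us vs a. a \<in> fiber L x \<Longrightarrow> set us \<subseteq> fiber L x \<Longrightarrow> set vs \<subseteq> fiber L x \<Longrightarrow>
      \<omega> x (us @ a # a # vs) = 0"
    and "\<And>ss. set ss \<subseteq> sections L \<Longrightarrow> smooth (\<lambda>x. \<omega> x (map (\<lambda>s. s x) ss))"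
  shows "\<omega> \<in> forms L"
proof -
  have "\<omega> x vs = 0" if "\<not> distinct vs" for x vs
  proof (cases "set vs \<subseteq> fiber L x")
    case True
    show ?thesis
      by (rule nondistinct_zeroI[OF fiber_subspace[of x] assms(2) assms(3) True that])
  qed (rule assms(1))
  then show ?thesis
    unfolding forms_def using assms(1,2,4) by simp
qed

lemma contract_form:
  assumes "\<omega> \<in> forms L" "X \<in> sections L"
  shows "contract X \<omega> \<in> forms L"
proof (rule formsI)
  show "contract X \<omega> x (us @ (c *\<^sub>R a + b) # vs) = c * contract X \<omega> x (us @ a # vs) + contract X \<omega> x (us @ b # vs)"
    if "a \<in> fiber L x" "b \<in> fiber L x" "set us \<subseteq> fiber L x" "set vs \<subseteq> fiber L x" for x us vs a b c
    using form_linear[OF assms(1), of a x b "X x # us" vs c] that sections_fiber[OF assms(2)] by (simp add: contract_def)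
  show "smooth (\<lambda>x. contract X \<omega> x (map (\<lambda>s. s x) ss))" if "set ss \<subseteq> sections L" for ss
    using form_smooth[OF assms(1), of "X # ss"] that assms(2) by (simp add: contract_def)
  show "contract X \<omega> x vs = 0" if "\<not> set vs \<subseteq> fiber L x" for x vs
    using form_outside[OF assms(1), of "X x # vs" x] that by (simp add: contract_def)
qed (use assms(1) in \<open>simp add: contract_def form_nondistinct\<close>)

lemma zero_form: "(\<lambda>x vs. 0) \<in> forms L"
  by (rule formsI) auto

lemma form_combo:
  assumes "\<omega> \<in> forms L" "\<eta> \<in> forms L" "smooth f"
  shows "(\<lambda>x vs. f x * \<omega> x vs + \<eta> x vs) \<in> forms L"
proof (rule formsI)
  show "smooth (\<lambda>x. f x * \<omega> x (map (\<lambda>s. s x) ss) + \<eta> x (map (\<lambda>s. s x) ss))"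
    if "set ss \<subseteq> sections L" for ss
    using form_smooth[OF assms(1) that] form_smooth[OF assms(2) that] assms(3) by (simp add: smooth_intros)
qed (use assms in \<open>simp_all add: form_outside form_linear form_nondistinct distrib_left mult.left_commute\<close>)

lemma form_add: "\<omega> \<in> forms L \<Longrightarrow> \<eta> \<in> forms L \<Longrightarrow> (\<lambda>x vs. \<omega> x vs + \<eta> x vs) \<in> forms L"
  using form_combo[of \<omega> \<eta> "\<lambda>_. 1"] by simp

lemma form_scale: "\<omega> \<in> forms L \<Longrightarrow> smooth f \<Longrightarrow> (\<lambda>x vs. f x * \<omega> x vs) \<in> forms L"
  using form_combo[OF _ zero_form, of \<omega> f] by simp

lemma form_sum: "(\<And>i. i \<in> I \<Longrightarrow> \<omega> i \<in> forms L) \<Longrightarrow> (\<lambda>x vs. \<Sum>i\<in>I. \<omega> i x vs) \<in> forms L"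
  by (induction I rule: infinite_finite_induct) (simp_all add: form_add zero_form)

lemma degree_part_form:
  assumes "\<omega> \<in> forms L"
  shows "degree_part q \<omega> \<in> forms L"
proof (rule formsI)
  show "smooth (\<lambda>x. degree_part q \<omega> x (map (\<lambda>s. s x) ss))" if "set ss \<subseteq> sections L" for ss
    using form_smooth[OF assms that] by (cases "length ss = q") (simp_all add: degree_part_def)
qed (use assms in \<open>auto simp: degree_part_def form_outside form_linear form_nondistinct\<close>)

section \<open>The exterior derivative\<close>

text \<open>The Lie derivative; the brackets are moved to the front of the argument list, which costs the sign.
  With it \<open>koszul_Cons\<close> is Cartan's formula \<open>i\<^sub>X \<delta> = \<L>\<^sub>X - \<delta> i\<^sub>X\<close>, and the properties of the Koszul formula
  follow by induction on the number of arguments.\<close>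

definition lie :: "('m \<Rightarrow> 'f) \<Rightarrow> ('m, 'f) form \<Rightarrow> ('m \<Rightarrow> 'f) list \<Rightarrow> 'm \<Rightarrow> real" where
  "lie X \<omega> ss x =
     frechet_derivative (\<lambda>y. \<omega> y (map (\<lambda>s. s y) ss)) (at x) (anchor L x (X x))
     - (\<Sum>j<length ss. (-1) ^ j * \<omega> x (bracket L X (ss ! j) x # map (\<lambda>s. s x) (nths ss (- {j}))))"

lemma nths_sections: "set ss \<subseteq> sections L \<Longrightarrow> set (nths ss I) \<subseteq> sections L"
  using set_nths_subset by fast

lemma lie_Nil: "lie X \<omega> [] x = frechet_derivative (\<lambda>y. \<omega> y []) (at x) (anchor L x (X x))"
  by (simp add: lie_def)

text \<open>Splitting off position 0 shifts the other positions by one, and the sign so gained is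
  used up by exchanging the bracket with \<open>s x\<close>. The outcome is the commutator rule
  [L_X, i_s] = i_[X,s].\<close>

lemma lie_Cons:
  assumes "\<omega> \<in> forms L" "X \<in> sections L" "s \<in> sections L" "set ss \<subseteq> sections L"
  shows "lie X \<omega> (s # ss) x =
    lie X (contract s \<omega>) ss x - \<omega> x (bracket L X s x # map (\<lambda>s. s x) ss)"
proof -
  have "\<omega> x (bracket L X (ss ! j) x # s x # map (\<lambda>s. s x) (nths ss (- {j}))) =
      - \<omega> x (s x # bracket L X (ss ! j) x # map (\<lambda>s. s x) (nths ss (- {j})))" if "j < length ss" for j
  proof -
    have "bracket L X (ss ! j) \<in> sections L"
      using assms that by (intro bracket_section) (auto simp: nth_mem subset_iff)
    then show ?thesis using assms nths_sections[OF assms(4), of "- {j}"]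
      by (intro form_swap_Cons) (simp_all add: sections_fiber[of "bracket L X (ss ! j)"] sections_fiber[of s])
  qed
  then show ?thesis
    by (simp add: lie_def lessThan_Suc_eq_insert_0 zero_notin_Suc_image sum.reindex o_def
        nths_Cons_compl_0 nths_Cons_compl_Suc contract_def sum_negf del: sum.lessThan_Suc)
qed

lemma koszul_Nil: "koszul L \<omega> [] x = 0"
  by (simp add: koszul_def)

lemma koszul_Cons:
  assumes "\<omega> \<in> forms L" "X \<in> sections L" "set ss \<subseteq> sections L"
  shows "koszul L \<omega> (X # ss) x = lie X \<omega> ss x - koszul L (contract X \<omega>) ss x"
proof -
  have "\<omega> x (bracket L (ss ! i) (ss ! j) x # X x # map (\<lambda>s. s x) (nths ss (- {i, j}))) =
      - \<omega> x (X x # bracket L (ss ! i) (ss ! j) x # map (\<lambda>s. s x) (nths ss (- {i, j})))"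
    if "i < j" "j < length ss" for i j
  proof -
    have "bracket L (ss ! i) (ss ! j) \<in> sections L"
      using assms that by (intro bracket_section) (auto simp: nth_mem subset_iff)
    then show ?thesis using assms nths_sections[OF assms(3), of "- {i, j}"]
      by (intro form_swap_Cons) (simp_all add: sections_fiber[of "bracket L (ss ! i) (ss ! j)"] sections_fiber[of X])
  qed
  then have *: "(\<Sum>j<length ss. \<Sum>i<j. (- 1) ^ (i + j) *
        \<omega> x (bracket L (ss ! i) (ss ! j) x # X x # map (\<lambda>s. s x) (nths ss (- {i, j})))) =
     - (\<Sum>j<length ss. \<Sum>i<j. (- 1) ^ (i + j) *
        \<omega> x (X x # bracket L (ss ! i) (ss ! j) x # map (\<lambda>s. s x) (nths ss (- {i, j}))))"
    by (simp add: sum_negf[symmetric])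
  show ?thesis
    using * by (simp add: koszul_def lie_def lessThan_Suc_eq_insert_0 zero_notin_Suc_image sum.reindex o_def
        nths_Cons_compl_0 nths_Cons_compl_Suc nths_Cons_compl_0_Suc nths_Cons_compl_Suc_Suc
        contract_def sum_negf sum.distrib sum_subtractf del: sum.lessThan_Suc)
qed

lemma evaluation_differentiable:
  "\<omega> \<in> forms L \<Longrightarrow> set ss \<subseteq> sections L \<Longrightarrow> (\<lambda>y. \<omega> y (map (\<lambda>s. s y) ss)) differentiable (at x)"
  by (intro smooth_differentiable form_smooth)

lemma contract_combo:
  assumes "\<omega> \<in> forms L" "A \<in> sections L" "B \<in> sections L" "smooth f"
  shows "contract (\<lambda>y. f y *\<^sub>R A y + B y) \<omega> =
    (\<lambda>x vs. f x * contract A \<omega> x vs + contract B \<omega> x vs)"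
proof (intro ext)
  fix x vs
  show "contract (\<lambda>y. f y *\<^sub>R A y + B y) \<omega> x vs = f x * contract A \<omega> x vs + contract B \<omega> x vs"
  proof (cases "set vs \<subseteq> fiber L x")
    case True
    then show ?thesis using form_linear_Cons[OF assms(1) sections_fiber[OF assms(2)] sections_fiber[OF assms(3)]]
      by (simp add: contract_def)
  next
    case False
    then show ?thesis
      using form_outside[OF contract_form[OF assms(1) sections_combo[OF assms(2-4)]]]
        form_outside[OF contract_form[OF assms(1,2)]] form_outside[OF contract_form[OF assms(1,3)]]
      by simp
  qed
qed

lemma lie_form_combo:
  assumes "\<omega> \<in> forms L" "\<eta> \<in> forms L" "smooth f" "set ss \<subseteq> sections L"
  shows "lie X (\<lambda>x vs. f x * \<omega> x vs + \<eta> x vs) ss x = f x * lie X \<omega> ss x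
    + frechet_derivative f (at x) (anchor L x (X x)) * \<omega> x (map (\<lambda>s. s x) ss) + lie X \<eta> ss x"
  unfolding lie_def
  by (simp add: frechet_derivative_mult_add evaluation_differentiable assms smooth_differentiable
      right_diff_distrib distrib_left sum.distrib sum_distrib_left mult.left_commute)

text \<open>The middle sum is df \<wedge> \<omega> written out on sections. It is left in this form
  because \<open>lie_combo_left\<close> produces the same sum, and the two cancel in
  \<open>koszul_combo\<close>.\<close>

lemma koszul_form_combo:
  assumes "\<omega> \<in> forms L" "\<eta> \<in> forms L" "smooth f" "set ss \<subseteq> sections L"
  shows "koszul L (\<lambda>x vs. f x * \<omega> x vs + \<eta> x vs) ss x = f x * koszul L \<omega> ss x
    + (\<Sum>j<length ss. (-1) ^ j * (frechet_derivative f (at x) (anchor L x ((ss ! j) x))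
        * \<omega> x (map (\<lambda>s. s x) (nths ss (- {j}))))) + koszul L \<eta> ss x"
  unfolding koszul_def
  by (simp add: frechet_derivative_mult_add evaluation_differentiable assms nths_sections smooth_differentiable
      distrib_left sum.distrib sum_distrib_left mult.left_commute)

lemma bracket_leibniz_left:
  assumes "A \<in> sections L" "B \<in> sections L" "s \<in> sections L" "smooth f"
  shows "bracket L (\<lambda>y. f y *\<^sub>R A y + B y) s x =
    f x *\<^sub>R bracket L A s x + ((- frechet_derivative f (at x) (anchor L x (s x))) *\<^sub>R A x + bracket L B s x)"
  unfolding bracket_antisym[OF sections_combo[OF assms(1,2,4)] assms(3)]
    bracket_leibniz[OF assms(3,1,2,4)] bracket_antisym[OF assms(3,1)] bracket_antisym[OF assms(3,2)]
  by (simp add: algebra_simps)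

text \<open>The anchor is linear over functions, so only the brackets differentiate f. Antisymmetry
  makes this term negative for the left argument, and the minus sign in front of the sum in
  \<open>lie\<close> reverses it.\<close>

lemma lie_combo_left:
  assumes "\<omega> \<in> forms L" "A \<in> sections L" "B \<in> sections L" "smooth f" "set ss \<subseteq> sections L"
  shows "lie (\<lambda>y. f y *\<^sub>R A y + B y) \<omega> ss x = f x * lie A \<omega> ss x
    + (\<Sum>j<length ss. (-1) ^ j * (frechet_derivative f (at x) (anchor L x ((ss ! j) x))
        * contract A \<omega> x (map (\<lambda>s. s x) (nths ss (- {j}))))) + lie B \<omega> ss x"
proof -
  have lin: "linear (frechet_derivative (\<lambda>y. \<omega> y (map (\<lambda>s. s y) ss)) (at x))"
    by (intro linear_frechet_derivative evaluation_differentiable assms)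
  have "\<omega> x (bracket L (\<lambda>y. f y *\<^sub>R A y + B y) (ss ! j) x # map (\<lambda>s. s x) (nths ss (- {j}))) =
      f x * \<omega> x (bracket L A (ss ! j) x # map (\<lambda>s. s x) (nths ss (- {j})))
      + (- frechet_derivative f (at x) (anchor L x ((ss ! j) x))
        * \<omega> x (A x # map (\<lambda>s. s x) (nths ss (- {j})))
      + \<omega> x (bracket L B (ss ! j) x # map (\<lambda>s. s x) (nths ss (- {j}))))"
    if "j < length ss" for j
  proof -
    have s: "ss ! j \<in> sections L" using assms(5) that nth_mem by blast
    have f: "bracket L A (ss ! j) x \<in> fiber L x" "bracket L B (ss ! j) x \<in> fiber L x" "A x \<in> fiber L x"
      using bracket_section s assms sections_fiber by blast+
    have n: "set (map (\<lambda>s. s x) (nths ss (- {j}))) \<subseteq> fiber L x"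
      using nths_sections[OF assms(5)] by simp
    show ?thesis
      unfolding bracket_leibniz_left[OF assms(2,3) s assms(4)]
      by (simp only: form_linear_Cons[OF assms(1) f(1) fiber_combo[OF f(3,2)] n]
          form_linear_Cons[OF assms(1) f(3,2) n])
  qed
  then show ?thesis
    unfolding lie_def
    by (simp add: anchor_linear sections_fiber[OF assms(2)] sections_fiber[OF assms(3)]
        linear_add[OF lin] linear_cmul[OF lin] contract_def
        right_diff_distrib distrib_left sum.distrib sum_distrib_left sum_negf sum_subtractf mult.left_commute)
qed

text \<open>Differentiating the evaluation along X and the Leibniz rule in [X, f A + B] both produce
  X(f) \<omega>(A, ...), with opposite signs. Entries in front of the modified one are contracted
  into the form, hence the general \<omega> in the induction.\<close>

lemma lie_combo:
  assumes "\<omega> \<in> forms L" "X \<in> sections L" "A \<in> sections L" "B \<in> sections L" "smooth f"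
    "set us \<subseteq> sections L" "set ws \<subseteq> sections L"
  shows "lie X \<omega> (us @ (\<lambda>y. f y *\<^sub>R A y + B y) # ws) x =
    f x * lie X \<omega> (us @ A # ws) x + lie X \<omega> (us @ B # ws) x"
  using assms(1,6)
proof (induction us arbitrary: \<omega>)
  case Nil
  note A = sections_combo[OF assms(3-5)]
  have f: "bracket L X A x \<in> fiber L x" "bracket L X B x \<in> fiber L x" "A x \<in> fiber L x"
    using bracket_section assms sections_fiber by blast+
  have n: "set (map (\<lambda>s. s x) ws) \<subseteq> fiber L x" using assms(7) by simp
  have "\<omega> x (bracket L X (\<lambda>y. f y *\<^sub>R A y + B y) x # map (\<lambda>s. s x) ws) =
      f x * \<omega> x (bracket L X A x # map (\<lambda>s. s x) ws)
      + (frechet_derivative f (at x) (anchor L x (X x)) * \<omega> x (A x # map (\<lambda>s. s x) ws)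
      + \<omega> x (bracket L X B x # map (\<lambda>s. s x) ws))"
    unfolding bracket_leibniz[OF assms(2-5)] add.assoc
    by (simp only: form_linear_Cons[OF Nil.prems(1) f(1) fiber_combo[OF f(3,2)] n]
          form_linear_Cons[OF Nil.prems(1) f(3,2) n])
  then show ?case
    using lie_form_combo[OF contract_form[OF Nil.prems(1) assms(3)] contract_form[OF Nil.prems(1) assms(4)]
        assms(5,7), of X x]
    by (simp add: lie_Cons[OF Nil.prems(1) assms(2) _ assms(7)] A assms(3,4)
        contract_combo[OF Nil.prems(1) assms(3-5)] right_diff_distrib)
      (simp add: contract_def)
next
  case (Cons Y us)
  then have Y: "Y \<in> sections L" "set us \<subseteq> sections L" by auto
  have sub: "set (us @ s # ws) \<subseteq> sections L" if "s \<in> sections L" for s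
    using that Y(2) assms(7) by simp
  have "\<omega> x ((bracket L X Y x # map (\<lambda>s. s x) us) @ (f x *\<^sub>R A x + B x) # map (\<lambda>s. s x) ws) =
      f x * \<omega> x ((bracket L X Y x # map (\<lambda>s. s x) us) @ A x # map (\<lambda>s. s x) ws)
      + \<omega> x ((bracket L X Y x # map (\<lambda>s. s x) us) @ B x # map (\<lambda>s. s x) ws)"
    using Y assms(7)
    by (intro form_linear[OF Cons.prems(1)])
      (simp_all add: sections_fiber[OF assms(3)] sections_fiber[OF assms(4)]
        sections_fiber[OF bracket_section[OF assms(2) Y(1)]])
  then show ?case
    using Cons.IH[OF contract_form[OF Cons.prems(1) Y(1)] Y(2)]
    by (simp add: lie_Cons[OF Cons.prems(1) assms(2) Y(1)] sub[unfolded set_append] sections_combo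
        assms(3-5,7) Y(2) right_diff_distrib)
qed

lemma lie_adjacent:
  assumes "\<omega> \<in> forms L" "X \<in> sections L" "A \<in> sections L" "set us \<subseteq> sections L" "set ws \<subseteq> sections L"
  shows "lie X \<omega> (us @ A # A # ws) x = 0"
  using assms(1,4)
proof (induction us arbitrary: \<omega>)
  case Nil
  have z: "contract A (contract A \<omega>) = (\<lambda>x vs. 0)"
    using form_nondistinct[OF Nil.prems(1)] by (simp add: contract_def fun_eq_iff)
  have "lie X (\<lambda>x vs. 0) ws x = 0"
    by (simp add: lie_def)
  \<comment> \<open>The equal entries give \<omega>(A, [X, A], ...) and \<omega>([X, A], A, ...),
    which cancel.\<close>
  moreover have "\<omega> x (A x # bracket L X A x # map (\<lambda>s. s x) ws) =
      - \<omega> x (bracket L X A x # A x # map (\<lambda>s. s x) ws)"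
    using assms(5) by (intro form_swap_Cons Nil.prems)
      (simp_all add: sections_fiber[OF assms(3)] sections_fiber[OF bracket_section[OF assms(2,3)]])
  ultimately show ?case
    by (simp add: lie_Cons Nil.prems assms(2,3,5) contract_form z) (simp add: contract_def)
next
  case (Cons Y us)
  then show ?case
    using form_nondistinct[OF Cons.prems(1)]
    by (simp add: lie_Cons assms(2,3,5) contract_form)
qed

text \<open>When the modified argument comes first, Cartan's formula applies and the df-terms of
  \<open>lie_combo_left\<close> and \<open>koszul_form_combo\<close> cancel; otherwise the first
  argument is contracted away, and the Lie derivative is function-linear by
  \<open>lie_combo\<close>.\<close>

lemma koszul_combo:
  assumes "\<omega> \<in> forms L" "A \<in> sections L" "B \<in> sections L" "smooth f"
    "set us \<subseteq> sections L" "set ws \<subseteq> sections L"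
  shows "koszul L \<omega> (us @ (\<lambda>y. f y *\<^sub>R A y + B y) # ws) x =
    f x * koszul L \<omega> (us @ A # ws) x + koszul L \<omega> (us @ B # ws) x"
  using assms(1,5)
proof (induction us arbitrary: \<omega>)
  case Nil
  show ?case
    using koszul_form_combo[OF contract_form[OF Nil.prems(1) assms(2)] contract_form[OF Nil.prems(1) assms(3)]
        assms(4,6)]
    by (simp add: koszul_Cons Nil.prems assms(2-4,6) sections_combo contract_combo lie_combo_left
        right_diff_distrib)
next
  case (Cons Y us)
  then have Y: "Y \<in> sections L" "set us \<subseteq> sections L" by auto
  show ?case
    using Cons.IH[OF contract_form[OF Cons.prems(1) Y(1)] Y(2)]
    by (simp add: koszul_Cons Cons.prems(1) Y sections_combo assms(2-4,6) lie_combo right_diff_distrib)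
qed

text \<open>After Cartan's formula is applied twice, the two copies of L_A i_A \<omega> cancel, and
  what remains contains [A, A] or i_A i_A \<omega>.\<close>

lemma koszul_adjacent:
  assumes "\<omega> \<in> forms L" "A \<in> sections L" "set us \<subseteq> sections L" "set ws \<subseteq> sections L"
  shows "koszul L \<omega> (us @ A # A # ws) x = 0"
  using assms(1,3)
proof (induction us arbitrary: \<omega>)
  case Nil
  have z: "contract A (contract A \<omega>) = (\<lambda>x vs. 0)"
    using form_nondistinct[OF Nil.prems(1)] by (simp add: contract_def fun_eq_iff)
  \<comment> \<open>Antisymmetry gives only [A, A] = - [A, A]; vanishing follows by
    doubling.\<close>
  have "bracket L A A x = - bracket L A A x" by (rule bracket_antisym[OF assms(2,2)])
  then have "bracket L A A x + bracket L A A x = 0" by (metis eq_neg_iff_add_eq_0)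
  then have "2 *\<^sub>R bracket L A A x = 0" by (simp add: scaleR_2)
  then have "bracket L A A x = 0" by simp
  moreover have "\<omega> x (0 # map (\<lambda>s. s x) ws) = 0"
    using form_linear_Cons[OF Nil.prems(1) fiber_zero fiber_zero, of "map (\<lambda>s. s x) ws" x 1] assms(4) by simp
  moreover have "koszul L (\<lambda>x vs. 0) ws x = 0"
    by (simp add: koszul_def)
  ultimately show ?case
    by (simp add: koszul_Cons lie_Cons Nil.prems assms(2,4) contract_form z)
next
  case (Cons Y us)
  then show ?case
    by (simp add: koszul_Cons lie_adjacent assms(2,4) contract_form)
qed

section \<open>Pointwise dependence of the Koszul expression on its arguments\<close>

lemma koszul_zero_entry:
  assumes "\<omega> \<in> forms L" "set us \<subseteq> sections L" "set ws \<subseteq> sections L"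
  shows "koszul L \<omega> (us @ (\<lambda>y. 0) # ws) x = 0"
  using koszul_combo[OF assms(1) zero_section zero_section smooth_const[of 1] assms(2,3), of x] by simp

lemma koszul_frame_sum:
  assumes "\<omega> \<in> forms L" "set us \<subseteq> sections L" "set ws \<subseteq> sections L" "\<And>b. smooth (f b)"
  shows "finite B \<Longrightarrow> (\<lambda>y. \<Sum>b\<in>B. f b y *\<^sub>R T y b) \<in> sections L \<and>
    koszul L \<omega> (us @ (\<lambda>y. \<Sum>b\<in>B. f b y *\<^sub>R T y b) # ws) x =
    (\<Sum>b\<in>B. f b x * koszul L \<omega> (us @ (\<lambda>y. T y b) # ws) x)"
proof (induction B rule: finite_induct)
  case empty
  then show ?case using koszul_zero_entry[OF assms(1-3)] by simp
next
  case (insert b B)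
  then show ?case
    using koszul_combo[OF assms(1) frame_section _ assms(4,2,3), of "\<lambda>y. \<Sum>b\<in>B. f b y *\<^sub>R T y b" b b x]
      sections_combo[OF frame_section _ assms(4), of "\<lambda>y. \<Sum>b\<in>B. f b y *\<^sub>R T y b" b b]
    by simp
qed

text \<open>Every section is a combination of frame sections whose coefficients are the coordinates
  of its values; function-linearity sees these coefficients only at x, where they may be
  frozen.\<close>

lemma koszul_frame:
  assumes "\<omega> \<in> forms L" "set us \<subseteq> sections L" "set ws \<subseteq> sections L" "s \<in> sections L"
  shows "koszul L \<omega> (us @ s # ws) x = koszul L \<omega> (us @ (\<lambda>y. T y (s x)) # ws) x"
proof -
  have T: "T y v = (\<Sum>b\<in>Basis. (v \<bullet> b) *\<^sub>R T y b)" for y v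
  proof -
    have "T y v = T y (\<Sum>b\<in>Basis. (v \<bullet> b) *\<^sub>R b)" by (simp add: euclidean_representation)
    then show ?thesis by (simp add: linear_sum[OF frame_linear] linear_cmul[OF frame_linear])
  qed
  have "s = (\<lambda>y. T y (s y))" using frame_id sections_fiber[OF assms(4)] by auto
  then have s: "s = (\<lambda>y. \<Sum>b\<in>Basis. (s y \<bullet> b) *\<^sub>R T y b)"
    using T[of _ "s _"] by metis
  have sm: "smooth s" using assms(4) by (simp add: sections_def)
  have "koszul L \<omega> (us @ s # ws) x = (\<Sum>b\<in>Basis. (s x \<bullet> b) * koszul L \<omega> (us @ (\<lambda>y. T y b) # ws) x)"
    by (subst s) (use koszul_frame_sum[OF assms(1-3), of "\<lambda>b y. s y \<bullet> b" Basis x] sm in \<open>simp add: smooth_intros\<close>)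
  also have "\<dots> = koszul L \<omega> (us @ (\<lambda>y. T y (s x)) # ws) x"
    unfolding T[of _ "s x"] using koszul_frame_sum[OF assms(1-3), of "\<lambda>b y. s x \<bullet> b" Basis x] by simp
  finally show ?thesis .
qed

text \<open>Entries are replaced from left to right; \<open>us\<close> collects those already
  replaced.\<close>

lemma koszul_frames:
  assumes "\<omega> \<in> forms L" "set us \<subseteq> sections L" "set ss \<subseteq> sections L"
  shows "koszul L \<omega> (us @ ss) x = koszul L \<omega> (us @ map (\<lambda>s y. T y (s x)) ss) x"
  using assms(2,3)
proof (induction ss arbitrary: us)
  case (Cons s ss)
  have "koszul L \<omega> (us @ s # ss) x = koszul L \<omega> ((us @ [\<lambda>y. T y (s x)]) @ ss) x"
    using koszul_frame[OF assms(1) Cons.prems(1), of ss s x] Cons.prems by simp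
  also have "\<dots> = koszul L \<omega> ((us @ [\<lambda>y. T y (s x)]) @ map (\<lambda>s y. T y (s x)) ss) x"
    using Cons.prems by (intro Cons.IH) auto
  finally show ?case by simp
qed simp

lemma koszul_smooth:
  assumes "\<omega> \<in> forms L" "set ss \<subseteq> sections L"
  shows "smooth (koszul L \<omega> ss)"
proof -
  have s: "ss ! i \<in> sections L" if "i < length ss" for i using assms(2) that nth_mem by blast
  have "smooth (\<lambda>x. \<omega> x (bracket L (ss ! i) (ss ! j) x # map (\<lambda>s. s x) (nths ss (- {i, j}))))"
    if "i < length ss" "j < length ss" for i j
    using form_smooth[OF assms(1), of "bracket L (ss ! i) (ss ! j) # nths ss (- {i, j})"]
      bracket_section[OF s s] nths_sections[OF assms(2)] that by simp
  then show ?thesis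
    unfolding koszul_def[abs_def]
    by (intro smooth_add smooth_sum smooth_mult smooth_const smooth_frechet_derivative)
      (auto intro: s anchor_smooth form_smooth[OF assms(1) nths_sections[OF assms(2)]])
qed

text \<open>The definite description is legitimate: frame sections reach every fibre vector and
  forms are zero off the fibre, which gives uniqueness; pointwise dependence of the Koszul
  expression gives existence.\<close>

theorem ext_deriv:
  assumes "\<omega> \<in> forms L"
  shows "ext_deriv L \<omega> \<in> forms L"
    and "set ss \<subseteq> sections L \<Longrightarrow> ext_deriv L \<omega> x (map (\<lambda>s. s x) ss) = koszul L \<omega> ss x"
proof -
  let ?P = "\<lambda>\<eta>. \<eta> \<in> forms L \<and>
     (\<forall>ss x. set ss \<subseteq> sections L \<longrightarrow> \<eta> x (map (\<lambda>s. s x) ss) = koszul L \<omega> ss x)"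
  \<comment> \<open>Each vector is extended along the frame; any other extension gives the same
    value by \<open>koszul_frames\<close>.\<close>
  define \<eta> where "\<eta> x vs = (if set vs \<subseteq> fiber L x then koszul L \<omega> (map (\<lambda>v y. T y v) vs) x else 0)" for x vs
  have frames: "set (map (\<lambda>v y. T y v) vs) \<subseteq> sections L" for vs by auto
  have eval: "\<eta> x (map (\<lambda>s. s x) ss) = koszul L \<omega> ss x" if "set ss \<subseteq> sections L" for ss x
    using koszul_frames[OF assms _ that, of "[]" x] that by (simp add: \<eta>_def o_def)
  have "\<eta> \<in> forms L"
  proof (rule formsI)
    show "\<eta> x vs = 0" if "\<not> set vs \<subseteq> fiber L x" for x vs using that by (simp add: \<eta>_def)
    show "\<eta> x (us @ (c *\<^sub>R a + b) # vs) = c * \<eta> x (us @ a # vs) + \<eta> x (us @ b # vs)"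
      if "a \<in> fiber L x" "b \<in> fiber L x" "set us \<subseteq> fiber L x" "set vs \<subseteq> fiber L x" for x us vs a b c
      using koszul_combo[OF assms frame_section frame_section smooth_const frames frames, of us c a b vs x] that
      by (simp add: \<eta>_def fiber_combo linear_add[OF frame_linear] linear_cmul[OF frame_linear])
    show "\<eta> x (us @ a # a # vs) = 0"
      if "a \<in> fiber L x" "set us \<subseteq> fiber L x" "set vs \<subseteq> fiber L x" for x us vs a
      using koszul_adjacent[OF assms frame_section frames frames, of us a vs x] by (simp add: \<eta>_def)
    show "smooth (\<lambda>x. \<eta> x (map (\<lambda>s. s x) ss))" if "set ss \<subseteq> sections L" for ss
      using koszul_smooth[OF assms that] by (simp add: eval that)
  qed
  then have P: "?P \<eta>" using eval by blast
  have "\<eta>' = \<eta>" if "?P \<eta>'" for \<eta>'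
  proof (intro ext)
    fix x vs
    show "\<eta>' x vs = \<eta> x vs"
    proof (cases "set vs \<subseteq> fiber L x")
      case True
      then have "map (\<lambda>s. s x) (map (\<lambda>v y. T y v) vs) = vs"
        by (auto simp: o_def frame_id intro!: map_idI)
      then show ?thesis using that P frames[of vs] by metis
    next
      case False
      then show ?thesis using form_outside that P by metis
    qed
  qed
  with P have "?P (ext_deriv L \<omega>)"
    unfolding ext_deriv_def by (rule theI)
  then show "ext_deriv L \<omega> \<in> forms L"
    and "set ss \<subseteq> sections L \<Longrightarrow> ext_deriv L \<omega> x (map (\<lambda>s. s x) ss) = koszul L \<omega> ss x" by blast+
qed

lemma ext_deriv_eval:
  assumes "\<omega> \<in> forms L" "set vs \<subseteq> fiber L x"
  shows "ext_deriv L \<omega> x vs = koszul L \<omega> (map (\<lambda>v y. T y v) vs) x"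
proof -
  have "map (\<lambda>s. s x) (map (\<lambda>v y. T y v) vs) = vs"
    using assms(2) by (auto simp: o_def frame_id intro!: map_idI)
  moreover have "set (map (\<lambda>v y. T y v) vs) \<subseteq> sections L" by auto
  ultimately show ?thesis using ext_deriv(2)[OF assms(1), of "map (\<lambda>v y. T y v) vs" x] by simp
qed

end

section \<open>Wedge products and ideals\<close>

text \<open>The grading involution; it carries the sign of the Leibniz rule for the interior product
  uniformly over inhomogeneous forms.\<close>

definition graded :: "('m, 'f) form \<Rightarrow> ('m, 'f) form" where
  "graded \<omega> = (\<lambda>x vs. (-1) ^ length vs * \<omega> x vs)"

lemma Pow_lessThan_Suc:
  "Pow {..<Suc n} = image Suc ` Pow {..<n} \<union> (\<lambda>S. insert 0 (Suc ` S)) ` Pow {..<n}"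
proof -
  have "Pow {..<Suc n} = Pow (insert 0 (Suc ` {..<n}))"
    by (simp only: lessThan_Suc_eq_insert_0)
  also have "\<dots> = Pow (Suc ` {..<n}) \<union> insert 0 ` Pow (Suc ` {..<n})"
    by (rule Pow_insert)
  also have "Pow (Suc ` {..<n}) = image Suc ` Pow {..<n}"
    by (simp only: image_Pow_surj[OF refl])
  finally show ?thesis by (simp only: image_image)
qed

lemma nths_Cons_Suc:
  "nths (v # vs) (Suc ` S) = nths vs S"
  "nths (v # vs) (- Suc ` S) = v # nths vs (- S)"
  "nths (v # vs) (insert 0 (Suc ` S)) = v # nths vs S"
  "nths (v # vs) (- insert 0 (Suc ` S)) = nths vs (- S)"
proof -
  have "{j. Suc j \<in> Suc ` S} = S" "{j. Suc j \<in> - Suc ` S} = - S"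
    "{j. Suc j \<in> insert 0 (Suc ` S)} = S" "{j. Suc j \<in> - insert 0 (Suc ` S)} = - S" by auto
  then show "nths (v # vs) (Suc ` S) = nths vs S"
    "nths (v # vs) (- Suc ` S) = v # nths vs (- S)"
    "nths (v # vs) (insert 0 (Suc ` S)) = v # nths vs S"
    "nths (v # vs) (- insert 0 (Suc ` S)) = nths vs (- S)"
    by (simp_all only: nths_Cons) auto
qed

definition inversions :: "nat set \<Rightarrow> (nat \<times> nat) set" where
  "inversions S = {(i, j). i < j \<and> j \<in> S \<and> i \<notin> S}"

lemma finite_inversions: "finite S \<Longrightarrow> finite (inversions S)"
proof -
  assume S: "finite S"
  have "inversions S \<subseteq> (\<Union>j\<in>S. {..<j} \<times> {j})" by (auto simp: inversions_def)
  then show ?thesis using S finite_subset by fastforce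
qed

lemma card_inversions_insert: "card (inversions (insert 0 (Suc ` S))) = card (inversions S)"
proof -
  have "inversions (insert 0 (Suc ` S)) = map_prod Suc Suc ` inversions S"
  proof (intro equalityI subsetI)
    fix p assume "p \<in> inversions (insert 0 (Suc ` S))"
    then show "p \<in> map_prod Suc Suc ` inversions S"
      by (cases p; cases "fst p"; cases "snd p") (auto simp: inversions_def)
  qed (auto simp: inversions_def)
  moreover have "inj (map_prod Suc Suc)" by (simp add: prod.inj_map)
  ultimately show ?thesis by (simp add: card_image inj_on_subset)
qed

text \<open>A position 0 left to the second factor precedes every position of the first, hence one
  further inversion for each element of S.\<close>

lemma card_inversions_Suc:
  assumes "finite S"
  shows "card (inversions (Suc ` S)) = card S + card (inversions S)"
proof -
  have "inversions (Suc ` S) = ({0} \<times> Suc ` S) \<union> map_prod Suc Suc ` inversions S"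
  proof (intro equalityI subsetI)
    fix p assume "p \<in> inversions (Suc ` S)"
    then show "p \<in> ({0} \<times> Suc ` S) \<union> map_prod Suc Suc ` inversions S"
      by (cases p; cases "fst p"; cases "snd p") (auto simp: inversions_def)
  qed (auto simp: inversions_def)
  moreover have "({0} \<times> Suc ` S) \<inter> map_prod Suc Suc ` inversions S = {}" by auto
  moreover have "inj (map_prod Suc Suc)" by (simp add: prod.inj_map)
  ultimately show ?thesis
    using assms by (simp add: card_Un_disjoint finite_inversions card_image inj_on_subset card_cartesian_product)
qed

text \<open>Shuffles split by the factor that receives the first vector. Sent to the second factor,
  it passes all arguments of the first, which is the sign recorded by \<open>graded\<close>. This is
  the Leibniz rule for the interior product.\<close>

lemma wedge_Cons:
  "wedge \<omega> \<eta> x (X x # vs) = wedge (contract X \<omega>) \<eta> x vs + wedge (graded \<omega>) (contract X \<eta>) x vs"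
proof -
  let ?n = "length vs"
  let ?t = "\<lambda>S. (-1) ^ card (inversions S) * \<omega> x (nths (X x # vs) S) * \<eta> x (nths (X x # vs) (- S))"
  have inj: "inj_on (image Suc) (Pow {..<?n})" "inj_on (\<lambda>S. insert 0 (Suc ` S)) (Pow {..<?n})"
    by (auto simp: inj_on_def inj_image_eq_iff)
  have disj: "image Suc ` Pow {..<?n} \<inter> (\<lambda>S. insert 0 (Suc ` S)) ` Pow {..<?n} = {}" by auto
  have "wedge \<omega> \<eta> x (X x # vs) = sum ?t (Pow {..<Suc ?n})"
    by (simp add: wedge_def inversions_def)
  also have "\<dots> = (\<Sum>S\<in>Pow {..<?n}. ?t (Suc ` S)) + (\<Sum>S\<in>Pow {..<?n}. ?t (insert 0 (Suc ` S)))"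
    unfolding Pow_lessThan_Suc using disj inj by (simp add: sum.union_disjoint sum.reindex)
  also have "(\<Sum>S\<in>Pow {..<?n}. ?t (insert 0 (Suc ` S))) = wedge (contract X \<omega>) \<eta> x vs"
    by (simp add: wedge_def nths_Cons_Suc card_inversions_insert contract_def inversions_def[symmetric])
  also have "(\<Sum>S\<in>Pow {..<?n}. ?t (Suc ` S)) = wedge (graded \<omega>) (contract X \<eta>) x vs"
    unfolding wedge_def
  proof (rule sum.cong[OF refl])
    \<comment> \<open>Positions in S are bounded by the length of \<open>vs\<close>, so
      \<open>nths vs S\<close> has exactly \<open>card S\<close> entries and the additional
      inversions match the sign in \<open>graded\<close>.\<close>
    fix S assume "S \<in> Pow {..<?n}"
    then have S: "finite S" "{i. i < ?n \<and> i \<in> S} = S" by (auto intro: finite_subset)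
    show "?t (Suc ` S) = (- 1) ^ card {(i, j). i < j \<and> j \<in> S \<and> i \<notin> S} *
        graded \<omega> x (nths vs S) * contract X \<eta> x (nths vs (- S))"
      by (simp add: nths_Cons_Suc card_inversions_Suc[OF S(1)] contract_def graded_def length_nths S(2)
          inversions_def[symmetric] power_add)
  qed
  finally show ?thesis by simp
qed

lemma wedge_combo_left:
  "wedge (\<lambda>x vs. f x * \<omega> x vs + \<omega>' x vs) \<eta> x vs = f x * wedge \<omega> \<eta> x vs + wedge \<omega>' \<eta> x vs"
  by (simp add: wedge_def sum_distrib_left sum.distrib[symmetric] algebra_simps)

lemma wedge_combo_right:
  "wedge \<omega> (\<lambda>x vs. f x * \<eta> x vs + \<eta>' x vs) x vs = f x * wedge \<omega> \<eta> x vs + wedge \<omega> \<eta>' x vs"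
  by (simp add: wedge_def sum_distrib_left sum.distrib[symmetric] algebra_simps)

context framed_algebroid
begin

lemma graded_form:
  assumes "\<omega> \<in> forms L"
  shows "graded \<omega> \<in> forms L"
proof (rule formsI)
  show "smooth (\<lambda>x. graded \<omega> x (map (\<lambda>s. s x) ss))" if "set ss \<subseteq> sections L" for ss
    using form_smooth[OF assms that] by (simp add: graded_def smooth_intros)
qed (use assms in \<open>simp_all add: graded_def form_outside form_linear form_nondistinct distrib_left mult.left_commute\<close>)

text \<open>By \<open>wedge_Cons\<close> a leading argument is contracted into one of the factors,
  so linearity in it is linearity of \<open>contract\<close>. Vectors are first extended to sections
  along the frame.\<close>

lemma wedge_linear:
  assumes "\<omega> \<in> forms L" "\<eta> \<in> forms L" "a \<in> fiber L x" "b \<in> fiber L x"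
    "set us \<subseteq> fiber L x" "set vs \<subseteq> fiber L x"
  shows "wedge \<omega> \<eta> x (us @ (c *\<^sub>R a + b) # vs) =
    c * wedge \<omega> \<eta> x (us @ a # vs) + wedge \<omega> \<eta> x (us @ b # vs)"
  using assms(1,2,5)
proof (induction us arbitrary: \<omega> \<eta>)
  case Nil
  define A where "A = (\<lambda>y. T y a)"
  define B where "B = (\<lambda>y. T y b)"
  have s: "A \<in> sections L" "B \<in> sections L" by (simp_all add: A_def B_def)
  have e: "A x = a" "B x = b" using assms by (simp_all add: A_def B_def frame_id)
  note W = contract_combo[OF _ s smooth_const, of _ c]
  show ?case
    using wedge_Cons[of \<omega> \<eta> x "\<lambda>y. c *\<^sub>R A y + B y" vs] wedge_Cons[of \<omega> \<eta> x A vs] wedge_Cons[of \<omega> \<eta> x B vs]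
    by (simp add: e W Nil.prems wedge_combo_left wedge_combo_right distrib_left)
next
  case (Cons v us)
  define X where "X = (\<lambda>y. T y v)"
  have s: "X \<in> sections L" by (simp add: X_def)
  have e: "v = X x" using Cons.prems by (simp add: X_def frame_id)
  have us: "set us \<subseteq> fiber L x" using Cons.prems by simp
  show ?case
    using Cons.IH[OF contract_form[OF Cons.prems(1) s] Cons.prems(2) us]
      Cons.IH[OF graded_form[OF Cons.prems(1)] contract_form[OF Cons.prems(2) s] us]
    unfolding e append_Cons wedge_Cons by (simp add: distrib_left)
qed

lemma wedge_adjacent:
  assumes "\<omega> \<in> forms L" "\<eta> \<in> forms L" "a \<in> fiber L x" "set us \<subseteq> fiber L x" "set vs \<subseteq> fiber L x"
  shows "wedge \<omega> \<eta> x (us @ a # a # vs) = 0"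
  using assms(1,2,4)
proof (induction us arbitrary: \<omega> \<eta>)
  case Nil
  define A where "A = (\<lambda>y. T y a)"
  have s: "A \<in> sections L" by (simp add: A_def)
  have e: "a = A x" using assms by (simp add: A_def frame_id)
  have z: "contract A (contract A \<omega>) = (\<lambda>x vs. 0)" if "\<omega> \<in> forms L" for \<omega>
    using form_nondistinct[OF that] by (simp add: contract_def fun_eq_iff)
  have zero: "wedge (\<lambda>x vs. 0) \<eta> x vs = 0" "wedge \<omega> (\<lambda>x vs. 0) x vs = 0" for \<omega> \<eta> :: "('m, 'f) form"
    by (simp_all add: wedge_def)
  \<comment> \<open>Removing one argument changes the parity, so contraction anticommutes with
    \<open>graded\<close>; the two mixed terms therefore cancel.\<close>
  have "wedge (contract A (graded \<omega>)) (contract A \<eta>) x vs =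
      - wedge (graded (contract A \<omega>)) (contract A \<eta>) x vs"
    by (simp add: wedge_def contract_def graded_def sum_negf)
  then show ?case
    unfolding e append_Nil wedge_Cons by (simp add: z Nil.prems zero)
next
  case (Cons v us)
  define X where "X = (\<lambda>y. T y v)"
  have s: "X \<in> sections L" by (simp add: X_def)
  have e: "v = X x" using Cons.prems by (simp add: X_def frame_id)
  have us: "set us \<subseteq> fiber L x" using Cons.prems by simp
  show ?case
    using Cons.IH[OF contract_form[OF Cons.prems(1) s] Cons.prems(2) us]
      Cons.IH[OF graded_form[OF Cons.prems(1)] contract_form[OF Cons.prems(2) s] us]
    unfolding e append_Cons wedge_Cons by simp
qed

lemma wedge_form:
  assumes "\<omega> \<in> forms L" "\<eta> \<in> forms L"
  shows "wedge \<omega> \<eta> \<in> forms L"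
proof (rule formsI)
  show "wedge \<omega> \<eta> x vs = 0" if out: "\<not> set vs \<subseteq> fiber L x" for x vs
    unfolding wedge_def
  proof (rule sum.neutral, rule ballI)
    fix S
    obtain v where v: "v \<in> set vs" "v \<notin> fiber L x" using out by blast
    have "v \<in> set (nths vs S) \<or> v \<in> set (nths vs (- S))"
      using v(1) by (auto simp: set_nths in_set_conv_nth)
    then have "\<omega> x (nths vs S) = 0 \<or> \<eta> x (nths vs (- S)) = 0"
      using v(2) form_outside assms by blast
    then show "(- 1) ^ card {(i, j). i < j \<and> j \<in> S \<and> i \<notin> S} * \<omega> x (nths vs S) * \<eta> x (nths vs (- S)) = 0"
      by auto
  qed
  show "smooth (\<lambda>x. wedge \<omega> \<eta> x (map (\<lambda>s. s x) ss))" if "set ss \<subseteq> sections L" for ss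
    unfolding wedge_def nths_map length_map
    by (intro smooth_sum smooth_mult smooth_const form_smooth[OF assms(1)] form_smooth[OF assms(2)] nths_sections that)
qed (use assms in \<open>simp_all add: wedge_linear wedge_adjacent\<close>)

section \<open>Ideals of forms vanishing on given vectors\<close>

definition vanishing :: "'m set \<Rightarrow> ('m \<Rightarrow> 'f set) \<Rightarrow> ('m, 'f) form set" where
  "vanishing S V = {\<omega> \<in> forms L. \<forall>x\<in>S. \<forall>vs. set vs \<subseteq> V x \<longrightarrow> \<omega> x vs = 0}"

text \<open>Any sublist of a list in \<open>V x\<close> lies in \<open>V x\<close> again, so each
  shuffle term of a wedge product contains a vanishing factor. The empty list is included, hence
  functions in the ideal vanish on S.\<close>

lemma vanishing_ideal: "algebraic_ideal L (vanishing S V)"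
proof -
  have sub: "set (nths vs I) \<subseteq> V x" if "set vs \<subseteq> V x" for vs I x
    using that set_nths_subset by fast
  have "wedge \<omega> \<eta> x vs = 0" "wedge \<eta> \<omega> x vs = 0"
    if "\<forall>vs. set vs \<subseteq> V x \<longrightarrow> \<omega> x vs = 0" "set vs \<subseteq> V x" for \<omega> \<eta> :: "('m, 'f) form" and x vs
    using that(1) sub[OF that(2)] by (simp_all add: wedge_def)
  then show ?thesis
    unfolding algebraic_ideal_def vanishing_def
    by (auto simp: zero_form form_add wedge_form degree_part_form) (simp_all add: degree_part_def)
qed

text \<open>A Frobenius-type criterion. The sections in \<open>\<X>\<close> pass through all of V
  along S, so the Koszul formula may be evaluated on them: its derivative terms differentiate
  functions vanishing on S in directions tangent to S, and its bracket terms vanish by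
  involutivity.\<close>

lemma vanishing_differential_ideal:
  assumes "\<X> \<subseteq> sections L"
    and "\<And>X x. X \<in> \<X> \<Longrightarrow> x \<in> S \<Longrightarrow> X x \<in> V x"
    and "\<And>x v. x \<in> S \<Longrightarrow> v \<in> V x \<Longrightarrow> \<exists>X\<in>\<X>. X x = v"
    and "\<And>X Y x. X \<in> \<X> \<Longrightarrow> Y \<in> \<X> \<Longrightarrow> x \<in> S \<Longrightarrow> bracket L X Y x \<in> V x"
    and tangent: "\<And>X f x. X \<in> \<X> \<Longrightarrow> x \<in> S \<Longrightarrow> smooth f \<Longrightarrow> (\<And>y. y \<in> S \<Longrightarrow> f y = (0::real)) \<Longrightarrow>
      frechet_derivative f (at x) (anchor L x (X x)) = 0"
  shows "differential_ideal L (vanishing S V)"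
proof -
  have "ext_deriv L \<omega> x vs = 0" if \<omega>: "\<omega> \<in> vanishing S V" and x: "x \<in> S" and vs: "set vs \<subseteq> V x" for \<omega> x vs
  proof -
    have form: "\<omega> \<in> forms L" and van: "\<And>y vs. y \<in> S \<Longrightarrow> set vs \<subseteq> V y \<Longrightarrow> \<omega> y vs = 0"
      using \<omega> by (auto simp: vanishing_def)
    obtain X where X: "\<And>v. v \<in> V x \<Longrightarrow> X v \<in> \<X> \<and> X v x = v"
      using assms(3)[OF x] by metis
    define ss where "ss = map X vs"
    have ss: "set ss \<subseteq> \<X>" using X vs by (auto simp: ss_def)
    then have sec: "set ss \<subseteq> sections L" using assms(1) by blast
    have "map (\<lambda>s. s x) ss = vs" using X vs by (auto simp: ss_def o_def intro!: map_idI)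
    then have "ext_deriv L \<omega> x vs = koszul L \<omega> ss x" using ext_deriv(2)[OF form sec] by metis
    also have "\<dots> = 0"
    proof -
      have mem: "ss ! i \<in> \<X>" if "i < length ss" for i using ss that nth_mem by blast
      have sub: "set (nths ss I) \<subseteq> \<X>" for I using ss set_nths_subset by fast
      have "frechet_derivative (\<lambda>y. \<omega> y (map (\<lambda>s. s y) (nths ss (- {i})))) (at x) (anchor L x ((ss ! i) x)) = 0"
        if "i < length ss" for i
      proof (rule tangent[OF mem[OF that] x])
        show "smooth (\<lambda>y. \<omega> y (map (\<lambda>s. s y) (nths ss (- {i}))))"
          by (intro form_smooth form nths_sections sec)
        show "\<omega> y (map (\<lambda>s. s y) (nths ss (- {i}))) = 0" if "y \<in> S" for y
          using sub[of "- {i}"] assms(2) that by (intro van) auto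
      qed
      moreover have "\<omega> x (bracket L (ss ! i) (ss ! j) x # map (\<lambda>s. s x) (nths ss (- {i, j}))) = 0"
        if "i < length ss" "j < length ss" for i j
        using sub[of "- {i, j}"] assms(2,4) mem that x by (intro van) auto
      ultimately show ?thesis by (simp add: koszul_def)
    qed
    finally show ?thesis .
  qed
  then show ?thesis
    unfolding differential_ideal_def using vanishing_ideal ext_deriv(1)
    by (simp add: vanishing_def)
qed

end

section \<open>The IP Lie algebroid and its prolongation\<close>

lemma ip_anchor_apply:
  "ip_anchor br m a = (fst a, br (snd m) (fst (snd a)) + snd (snd a))"
  by (simp add: ip_anchor_def split: prod.splits)

lemma ip_bracket_apply:
  "ip_bracket br \<sigma> \<tau> m =
    (0, br (fst (snd (\<sigma> m))) (fst (snd (\<tau> m))),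
      br (fst (snd (\<sigma> m))) (snd (snd (\<tau> m))) + br (snd (snd (\<sigma> m))) (fst (snd (\<tau> m))))
     + frechet_derivative \<tau> (at m) (ip_anchor br m (\<sigma> m))
     - frechet_derivative \<sigma> (at m) (ip_anchor br m (\<tau> m))"
  by (simp add: ip_bracket_def split: prod.splits)

lemma lie_algebra_bounded_bilinear:
  fixes br :: "'g::euclidean_space \<Rightarrow> 'g \<Rightarrow> 'g"
  shows "lie_algebra br \<Longrightarrow> bounded_bilinear br"
  by (simp add: lie_algebra_def bilinear_conv_bounded_bilinear)

lemma lie_algebra_jacobi:
  assumes "lie_algebra br"
  shows "br w (br p q) = br (br w p) q - br (br w q) p"
proof -
  have "br w (br p q) + br p (br q w) + br q (br w p) = 0"
    using assms by (simp add: lie_algebra_def)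
  moreover have "br p (br q w) = br (br w q) p" "br q (br w p) = - br (br w p) q"
    using lie_algebra_antisym[OF assms] bilinear_rneg[of br p "br w q"] assms
    by (metis lie_algebra_def minus_minus, metis)
  ultimately show ?thesis by (simp add: algebra_simps add_eq_0_iff)
qed

lemma smooth_ip_anchor:
  fixes br :: "'g::euclidean_space \<Rightarrow> 'g \<Rightarrow> 'g"
  assumes "lie_algebra br" "smooth p" "smooth a"
  shows "smooth (\<lambda>y. ip_anchor br (p y) (a y))"
  unfolding ip_anchor_apply
  by (intro smooth_Pair smooth_add smooth_fst smooth_snd
      smooth_bilinear[OF lie_algebra_bounded_bilinear[OF assms(1)]] assms)

lemma ip_anchor_linear:
  "bilinear br \<Longrightarrow> ip_anchor br m (c *\<^sub>R a + b) = c *\<^sub>R ip_anchor br m a + ip_anchor br m b"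
  by (simp add: ip_anchor_apply bilinear_radd bilinear_rmul algebra_simps)

lemma ip_sections: "sections (ip_algebroid br) = {s. smooth s}"
  by (simp add: sections_def ip_algebroid_def)

lemma ip_framed:
  fixes br :: "'g::euclidean_space \<Rightarrow> 'g \<Rightarrow> 'g"
  assumes lie: "lie_algebra br"
  shows "framed_algebroid (ip_algebroid br) (\<lambda>x v. v)"
proof (rule framed_algebroid.intro)
  have bl: "bilinear br" using lie by (simp add: lie_algebra_def)
  note bb = lie_algebra_bounded_bilinear[OF lie]
  show "anchor (ip_algebroid br) x (c *\<^sub>R a + b) =
      c *\<^sub>R anchor (ip_algebroid br) x a + anchor (ip_algebroid br) x b" for x c a b
    by (simp add: ip_algebroid_def ip_anchor_linear[OF bl])
  fix X assume X: "X \<in> sections (ip_algebroid br)"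
  show "smooth (\<lambda>x. anchor (ip_algebroid br) x (X x))"
    using X lie by (simp add: ip_sections) (simp add: ip_algebroid_def smooth_ip_anchor smooth_ident)
  fix Y assume Y: "Y \<in> sections (ip_algebroid br)"
  have s: "smooth X" "smooth Y" using X Y by (simp_all add: ip_sections)
  show "bracket (ip_algebroid br) X Y \<in> sections (ip_algebroid br)"
  proof -
    have "smooth (\<lambda>m. ip_bracket br X Y m)"
      unfolding ip_bracket_apply
      by (intro smooth_Pair smooth_add smooth_diff smooth_fst smooth_snd smooth_const smooth_bilinear[OF bb]
          smooth_frechet_derivative smooth_ip_anchor lie s smooth_ident)
    then show ?thesis by (simp add: ip_sections) (simp add: ip_algebroid_def)
  qed
  show "bracket (ip_algebroid br) X Y x = - bracket (ip_algebroid br) Y X x" for x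
    using ip_bracket_antisym[OF lie, of X Y x] by (simp add: ip_algebroid_def)
  fix B :: "real \<times> 'g \<Rightarrow> real \<times> 'g \<times> 'g" and f :: "real \<times> 'g \<Rightarrow> real" and x
  assume B: "B \<in> sections (ip_algebroid br)" and f: "smooth f"
  have d: "f differentiable (at x)" "Y differentiable (at x)" "B differentiable (at x)"
    using B s(2) f by (auto simp: ip_sections smooth_differentiable)
  have lin: "linear (frechet_derivative X (at x))"
    using s(1) by (intro linear_frechet_derivative smooth_differentiable)
  show "bracket (ip_algebroid br) X (\<lambda>y. f y *\<^sub>R Y y + B y) x =
        f x *\<^sub>R bracket (ip_algebroid br) X Y x +
        frechet_derivative f (at x) (anchor (ip_algebroid br) x (X x)) *\<^sub>R Y x + bracket (ip_algebroid br) X B x"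
    by (simp add: ip_algebroid_def ip_bracket_apply frechet_derivative_scale_add[OF d] ip_anchor_linear[OF bl]
        linear_add[OF lin] linear_cmul[OF lin] bilinear_radd[OF bl] bilinear_rmul[OF bl] scaleR_add_right
        scaleR_diff_right prod_eq_iff)
qed (simp_all add: ip_algebroid_def linear_ident[unfolded id_def])

section \<open>The prolongation of the IP algebroid\<close>

lemma ip_prolongation_fiber:
  "v \<in> fiber (prolongation (ip_algebroid br)) x \<longleftrightarrow> fst (snd v) = ip_anchor br (fst x) (fst v)"
  by (auto simp: prolongation_def ip_algebroid_def)

lemma prolongation_anchor: "anchor (prolongation L) x v = snd v"
  by (simp add: prolongation_def split: prod.splits)

lemma ip_prolongation_bracket:
  "bracket (prolongation (ip_algebroid br)) \<xi> \<eta> x =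
    ((0, br (fst (snd (fst (\<xi> x)))) (fst (snd (fst (\<eta> x)))),
       br (fst (snd (fst (\<xi> x)))) (snd (snd (fst (\<eta> x)))) + br (snd (snd (fst (\<xi> x)))) (fst (snd (fst (\<eta> x)))))
       + frechet_derivative (\<lambda>y. fst (\<eta> y)) (at x) (snd (\<xi> x))
       - frechet_derivative (\<lambda>y. fst (\<xi> y)) (at x) (snd (\<eta> x)),
     frechet_derivative (\<lambda>y. snd (\<eta> y)) (at x) (snd (\<xi> x))
       - frechet_derivative (\<lambda>y. snd (\<xi> y)) (at x) (snd (\<eta> x)))"
  by (simp add: prolongation_def ip_algebroid_def ip_bracket_apply vf_bracket_def)

text \<open>Beyond the linear term there is one from the base point, which enters through the
  bracket with w. The map p is later either the identity of M or the projection onto M.\<close>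

lemma frechet_derivative_ip_anchor:
  fixes br :: "'g::euclidean_space \<Rightarrow> 'g \<Rightarrow> 'g" and p :: "'a::real_normed_vector \<Rightarrow> real \<times> 'g"
  assumes "lie_algebra br" "bounded_linear p" "a differentiable (at x)"
  shows "frechet_derivative (\<lambda>y. ip_anchor br (p y) (a y)) (at x) h =
    ip_anchor br (p x) (frechet_derivative a (at x) h) + (0, br (snd (p h)) (fst (snd (a x))))"
proof -
  have "((\<lambda>y. ip_anchor br (p y) (a y)) has_derivative
     (\<lambda>h. (fst (frechet_derivative a (at x) h),
       (br (snd (p x)) (fst (snd (frechet_derivative a (at x) h))) + br (snd (p h)) (fst (snd (a x))))
         + snd (snd (frechet_derivative a (at x) h))))) (at x)"
    unfolding ip_anchor_apply
    by (intro has_derivative_Pair has_derivative_add has_derivative_fst has_derivative_snd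
        bounded_bilinear.FDERIV[OF lie_algebra_bounded_bilinear[OF assms(1)]]
        assms(3)[unfolded frechet_derivative_works] bounded_linear_imp_has_derivative assms(2))
  from frechet_derivative_eqI[OF this] show ?thesis by (simp add: ip_anchor_apply add_ac)
qed

text \<open>The right-hand side is the bracket of the vector fields
  \<open>w \<mapsto> br w u + v\<close> and \<open>w \<mapsto> br w u' + v'\<close>, so the anchor
  respects brackets of constant sections; this is the Jacobi identity together with
  antisymmetry.\<close>

lemma ip_anchor_bracket:
  fixes br :: "'g::real_normed_vector \<Rightarrow> 'g \<Rightarrow> 'g"
  assumes "lie_algebra br"
  shows "ip_anchor br m (0, br u u', br u v' + br v u') =
    (0, br (snd (ip_anchor br m (c, u, v))) u' - br (snd (ip_anchor br m (c', u', v'))) u)"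
proof -
  have bl: "bilinear br" using assms by (simp add: lie_algebra_def)
  show ?thesis
    using lie_algebra_antisym[OF assms, of v' u]
    by (simp add: ip_anchor_apply lie_algebra_jacobi[OF assms, of _ u u'] bilinear_ladd[OF bl])
qed

text \<open>A fibre vector has free algebroid and vertical parts, while its base part is prescribed
  by the anchor; overwriting this base part is the projection that \<open>framed_algebroid\<close>
  asks for.\<close>

definition ip_prolongation_frame :: "('g::euclidean_space \<Rightarrow> 'g \<Rightarrow> 'g)
    \<Rightarrow> (real \<times> 'g) \<times> 'y::euclidean_space \<Rightarrow> (real \<times> 'g \<times> 'g) \<times> ((real \<times> 'g) \<times> 'y)
    \<Rightarrow> (real \<times> 'g \<times> 'g) \<times> ((real \<times> 'g) \<times> 'y)" where
  "ip_prolongation_frame br x v = (fst v, (ip_anchor br (fst x) (fst v), snd (snd v)))"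

lemma ip_prolongation_framed:
  fixes br :: "'g::euclidean_space \<Rightarrow> 'g \<Rightarrow> 'g"
  assumes lie: "lie_algebra br"
  shows "framed_algebroid (prolongation (ip_algebroid br) :: ((real \<times> 'g) \<times> 'y::euclidean_space, _) algebroid)
    (ip_prolongation_frame br)"
proof (rule framed_algebroid.intro)
  let ?L = "prolongation (ip_algebroid br) :: ((real \<times> 'g) \<times> 'y::euclidean_space, _) algebroid"
  have bl: "bilinear br" using lie by (simp add: lie_algebra_def)
  note bb = lie_algebra_bounded_bilinear[OF lie]
  have al: "ip_anchor br m (a + b) = ip_anchor br m a + ip_anchor br m b"
    "ip_anchor br m (c *\<^sub>R a) = c *\<^sub>R ip_anchor br m a"
    "ip_anchor br m (a - b) = ip_anchor br m a - ip_anchor br m b" "ip_anchor br m 0 = 0" for m a b c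
    using ip_anchor_linear[OF bl, of m 1 a b] ip_anchor_scale[OF bl] ip_anchor_linear[OF bl, of m "-1" b a]
      ip_anchor_scale[OF bl, of m 0 0]
    by auto
  have sec: "smooth X" "fst (snd (X x)) = ip_anchor br (fst x) (fst (X x))" if "X \<in> sections ?L" for X x
    using that ip_prolongation_fiber[of "X x" br x] unfolding sections_def by blast+
  show "subspace (fiber ?L x)" for x
    by (auto simp: subspace_def ip_prolongation_fiber al)
  show "linear (ip_prolongation_frame br x)" for x :: "(real \<times> 'g) \<times> 'y"
    by (rule linearI) (simp_all add: ip_prolongation_frame_def al)
  show "ip_prolongation_frame br x v \<in> fiber ?L x" for x v
    by (simp add: ip_prolongation_fiber ip_prolongation_frame_def)
  show "v \<in> fiber ?L x \<Longrightarrow> ip_prolongation_frame br x v = v" for x v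
    by (simp add: ip_prolongation_fiber ip_prolongation_frame_def prod_eq_iff)
  show "smooth (\<lambda>x. ip_prolongation_frame br x v :: (real \<times> 'g \<times> 'g) \<times> (real \<times> 'g) \<times> 'y)" for v
    unfolding ip_prolongation_frame_def
    by (intro smooth_Pair smooth_const smooth_ip_anchor lie smooth_fst smooth_ident)
  show "anchor ?L x (c *\<^sub>R a + b) = c *\<^sub>R anchor ?L x a + anchor ?L x b" for x c a b
    by (simp add: prolongation_anchor)
  fix X assume X: "X \<in> sections ?L"
  show "smooth (\<lambda>x. anchor ?L x (X x))"
    using sec(1)[OF X] by (simp add: prolongation_anchor smooth_snd)
  fix Y assume Y: "Y \<in> sections ?L"
  note s = sec(1)[OF X] sec(1)[OF Y]
  show "bracket ?L X Y \<in> sections ?L"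
  proof -
    have "smooth (\<lambda>x. bracket ?L X Y x)"
      unfolding ip_prolongation_bracket
      by (intro smooth_Pair smooth_add smooth_diff smooth_fst smooth_snd smooth_const smooth_bilinear[OF bb]
          smooth_frechet_derivative s)
    moreover have "bracket ?L X Y x \<in> fiber ?L x" for x
    proof -
      \<comment> \<open>The relation that defines the fibre is differentiated; the last summand
        comes from the base point in the anchor.\<close>
      have D: "fst (frechet_derivative (\<lambda>y. snd (Z y)) (at x) h) =
         ip_anchor br (fst x) (frechet_derivative (\<lambda>y. fst (Z y)) (at x) h) + (0, br (snd (fst h)) (fst (snd (fst (Z x)))))"
        if Z: "Z \<in> sections ?L" for Z h
      proof -
        have d: "Z differentiable (at x)" "(\<lambda>y. snd (Z y)) differentiable (at x)"
            "(\<lambda>y. fst (Z y)) differentiable (at x)"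
          using sec(1)[OF Z] by (intro smooth_differentiable smooth_snd smooth_fst; simp)+
        have "fst (frechet_derivative (\<lambda>y. snd (Z y)) (at x) h) = frechet_derivative (\<lambda>y. fst (snd (Z y))) (at x) h"
          by (simp add: frechet_derivative_fst_snd d)
        also have "(\<lambda>y. fst (snd (Z y))) = (\<lambda>y. ip_anchor br (fst y) (fst (Z y)))"
          using sec(2)[OF Z] by simp
        finally show ?thesis
          using frechet_derivative_ip_anchor[OF lie bounded_linear_fst d(3)] by simp
      qed
      obtain c u v where a: "fst (X x) = (c, u, v)" by (metis prod_cases3)
      obtain c' u' v' where b: "fst (Y x) = (c', u', v')" by (metis prod_cases3)
      have X1: "fst (snd (X x)) = ip_anchor br (fst x) (c, u, v)" using sec(2)[OF X] a by metis
      have Y1: "fst (snd (Y x)) = ip_anchor br (fst x) (c', u', v')" using sec(2)[OF Y] b by metis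
      \<comment> \<open>Terms with derivatives of the sections match by linearity of the anchor; the
        base point terms are matched by \<open>ip_anchor_bracket\<close>.\<close>
      show ?thesis
        unfolding ip_prolongation_fiber ip_prolongation_bracket
        by (simp add: D[OF X] D[OF Y] al a b X1 Y1 ip_anchor_bracket[OF lie, of _ u u' v' v c c'])
    qed
    ultimately show ?thesis by (simp add: sections_def)
  qed
  show "bracket ?L X Y x = - bracket ?L Y X x" for x
    using lie_algebra_antisym[OF lie, of "fst (snd (fst (X x)))" "fst (snd (fst (Y x)))"]
      lie_algebra_antisym[OF lie, of "fst (snd (fst (X x)))" "snd (snd (fst (Y x)))"]
      lie_algebra_antisym[OF lie, of "snd (snd (fst (X x)))" "fst (snd (fst (Y x)))"]
    unfolding ip_prolongation_bracket by (simp add: prod_eq_iff)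
  fix B f x
  assume B: "B \<in> sections ?L" and f: "smooth (f :: (real \<times> 'g) \<times> 'y \<Rightarrow> real)"
  have d: "f differentiable (at x)" "Y differentiable (at x)" "B differentiable (at x)" "X differentiable (at x)"
    using sec(1)[OF B] s f by (auto simp: smooth_differentiable)
  have lin: "linear (frechet_derivative X (at x))"
    using d(4) by (rule linear_frechet_derivative)
  have d': "(\<lambda>y. f y *\<^sub>R Y y + B y) differentiable (at x)"
    using sec(1)[OF B] s f by (intro smooth_differentiable smooth_add smooth_scaleR)
  have fs: "frechet_derivative (\<lambda>y. f y *\<^sub>R fst (Y y) + fst (B y)) (at x) v =
      fst (frechet_derivative (\<lambda>y. f y *\<^sub>R Y y + B y) (at x) v)"
    "frechet_derivative (\<lambda>y. f y *\<^sub>R snd (Y y) + snd (B y)) (at x) v =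
      snd (frechet_derivative (\<lambda>y. f y *\<^sub>R Y y + B y) (at x) v)" for v
    using frechet_derivative_fst_snd[OF d', of v] by simp_all
  show "bracket ?L X (\<lambda>y. f y *\<^sub>R Y y + B y) x = f x *\<^sub>R bracket ?L X Y x +
        frechet_derivative f (at x) (anchor ?L x (X x)) *\<^sub>R Y x + bracket ?L X B x"
    unfolding ip_prolongation_bracket prolongation_anchor
    by (simp add: frechet_derivative_fst_snd d fs frechet_derivative_scale_add
        linear_add[OF lin] linear_cmul[OF lin] bilinear_radd[OF bl] bilinear_rmul[OF bl] scaleR_add_right
        scaleR_diff_right prod_eq_iff)
qed

section \<open>Coefficient functions and one-forms\<close>

lemma (in framed_algebroid) one_form_form:
  assumes "\<And>x c a b. a \<in> fiber L x \<Longrightarrow> b \<in> fiber L x \<Longrightarrow> \<theta> x (c *\<^sub>R a + b) = c * \<theta> x a + \<theta> x b"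
    and "\<And>s. s \<in> sections L \<Longrightarrow> smooth (\<lambda>x. \<theta> x (s x))"
  shows "(\<lambda>x vs. if set vs \<subseteq> fiber L x then one_form \<theta> x vs else 0) \<in> forms L"
proof (rule formsI)
  show "smooth (\<lambda>x. if set (map (\<lambda>s. s x) ss) \<subseteq> fiber L x then one_form \<theta> x (map (\<lambda>s. s x) ss) else 0)"
    if "set ss \<subseteq> sections L" for ss
  proof (cases "\<exists>s. ss = [s]")
    case True
    then show ?thesis using that assms(2) by (auto simp: one_form_def sections_fiber)
  next
    case False
    then have "one_form \<theta> x (map (\<lambda>s. s x) ss) = 0" for x
      by (cases ss; cases "tl ss") (auto simp: one_form_def)
    then show ?thesis by (simp cong: if_cong)
  qed
  show "(if set (us @ (c *\<^sub>R a + b) # vs) \<subseteq> fiber L x then one_form \<theta> x (us @ (c *\<^sub>R a + b) # vs) else 0) =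
     c * (if set (us @ a # vs) \<subseteq> fiber L x then one_form \<theta> x (us @ a # vs) else 0) +
     (if set (us @ b # vs) \<subseteq> fiber L x then one_form \<theta> x (us @ b # vs) else 0)"
    if "a \<in> fiber L x" "b \<in> fiber L x" "set us \<subseteq> fiber L x" "set vs \<subseteq> fiber L x" for x us vs a b c
    using that by (cases us; cases vs; cases "tl us") (auto simp: one_form_def assms(1) fiber_combo split: list.splits)
  show "(if set (us @ a # a # vs) \<subseteq> fiber L x then one_form \<theta> x (us @ a # a # vs) else 0) = 0" for x us vs a
    by (cases us; cases "tl us") (auto simp: one_form_def)
qed auto

lemma coord_bounded_linear:
  fixes E :: "'n::finite \<Rightarrow> 'g::euclidean_space"
  shows "is_basis E \<Longrightarrow> bounded_linear (coord E i)"
  by (simp add: linear_conv_bounded_linear[symmetric] coord_linear)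

lemma smooth_coord:
  fixes E :: "'n::finite \<Rightarrow> 'g::euclidean_space"
  shows "is_basis E \<Longrightarrow> smooth f \<Longrightarrow> smooth (\<lambda>x. coord E i (f x))"
  by (rule smooth_linear_left[OF coord_bounded_linear])

lemma smooth_dw: "smooth f \<Longrightarrow> smooth (dw E i f)"
  unfolding dw_def[abs_def] by (rule smooth_derivative)

lemma smooth_lam:
  fixes E :: "'n::finite \<Rightarrow> 'g::euclidean_space"
  assumes "is_basis E" "\<And>i. smooth (\<gamma> i)"
  shows "smooth (lam br E \<gamma> i j)"
  unfolding lam_def[abs_def]
  by (intro smooth_divide smooth_diff smooth_sum smooth_mult smooth_const smooth_coord assms smooth_snd
      smooth_ident smooth_dw)

text \<open>The one-form as a plain function of a base point and a vector, so that it serves on M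
  and, composed with projections, on the prolongation.\<close>

definition theta :: "('n \<Rightarrow> 'g::real_vector) \<Rightarrow> 'n \<Rightarrow> real \<times> 'g \<Rightarrow> real \<times> 'g \<times> 'g \<Rightarrow> real" where
  "theta E i m a = coord E i (fst (snd a)) - fst a * coord E i (snd m)"

definition psi :: "('g::real_normed_vector \<Rightarrow> 'g \<Rightarrow> 'g) \<Rightarrow> ('n::finite \<Rightarrow> 'g)
    \<Rightarrow> ('n \<Rightarrow> real \<times> 'g \<Rightarrow> real) \<Rightarrow> 'n \<Rightarrow> real \<times> 'g \<Rightarrow> real \<times> 'g \<times> 'g \<Rightarrow> real" where
  "psi br E \<gamma> i m a = coord E i (snd (snd a)) - fst a * \<gamma> i m + (\<Sum>k\<in>UNIV. lam br E \<gamma> k i m * theta E k m a)"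

lemma Gamma_form_alt: "Gamma_form = one_form (\<lambda>m a. fst a)"
  by (simp add: Gamma_form_def case_prod_beta')

lemma Theta_form_alt: "Theta_form E i = one_form (theta E i)"
  by (simp add: Theta_form_def theta_def[abs_def] case_prod_beta')

lemma Psi_form_alt: "Psi_form br E \<gamma> i = one_form (psi br E \<gamma> i)"
  by (simp add: Psi_form_def psi_def[abs_def] theta_def case_prod_beta')

lemma theta_linear:
  assumes "is_basis E"
  shows "theta E i m (c *\<^sub>R a + b) = c * theta E i m a + theta E i m b"
  using coord_linear[OF assms, of i] by (simp add: theta_def linear_add linear_cmul algebra_simps)

lemma psi_linear:
  assumes "is_basis E"
  shows "psi br E \<gamma> i m (c *\<^sub>R a + b) = c * psi br E \<gamma> i m a + psi br E \<gamma> i m b"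
  using coord_linear[OF assms, of i]
  by (simp add: psi_def theta_linear[OF assms] linear_add linear_cmul distrib_left distrib_right
      right_diff_distrib sum.distrib sum_distrib_left mult.left_commute mult.assoc)

lemma smooth_theta:
  fixes E :: "'n::finite \<Rightarrow> 'g::euclidean_space"
  assumes "is_basis E" "bounded_linear p" "smooth a"
  shows "smooth (\<lambda>y. theta E i (p y) (a y))"
  unfolding theta_def
  by (intro smooth_diff smooth_mult smooth_coord smooth_fst smooth_snd assms smooth_linear)

lemma smooth_psi:
  fixes E :: "'n::finite \<Rightarrow> 'g::euclidean_space"
  assumes "is_basis E" "\<And>i. smooth (\<gamma> i)" "bounded_linear p" "smooth a"
  shows "smooth (\<lambda>y. psi br E \<gamma> i (p y) (a y))"
  unfolding psi_def
  by (intro smooth_add smooth_diff smooth_sum smooth_mult smooth_coord smooth_fst smooth_snd smooth_theta assms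
      smooth_linear_right[OF assms(3) assms(2)] smooth_linear_right[OF assms(3) smooth_lam])

lemma lift_one_form:
  "lift_form L (one_form \<theta>) = (\<lambda>x vs. if set vs \<subseteq> fiber (prolongation L) x
     then one_form (\<lambda>x v. \<theta> (fst x) (fst v)) x vs else 0)"
  by (auto simp: lift_form_def one_form_def fun_eq_iff split: list.splits)

section \<open>Integral manifolds\<close>

lemma prolong_section_ip:
  "prolong_section (ip_algebroid br) \<iota> m a = (a, frechet_derivative \<iota> (at m) (ip_anchor br m a))"
  by (simp add: prolong_section_def ip_algebroid_def)

text \<open>The constant sections of the IP algebroid extend to sections of the prolongation that are tangent
  to the image of \<open>\<iota>\<close>, and on the image these extensions are \<open>\<iota>\<close>-related to the constant sections.\<close>

definition tangent_section :: "('g::euclidean_space \<Rightarrow> 'g \<Rightarrow> 'g) \<Rightarrow> (real \<times> 'g \<Rightarrow> (real \<times> 'g) \<times> 'y::euclidean_space)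
    \<Rightarrow> real \<times> 'g \<times> 'g \<Rightarrow> (real \<times> 'g) \<times> 'y \<Rightarrow> (real \<times> 'g \<times> 'g) \<times> ((real \<times> 'g) \<times> 'y)" where
  "tangent_section br \<iota> a x =
    (a, (ip_anchor br (fst x) a, snd (frechet_derivative \<iota> (at (fst x)) (ip_anchor br (fst x) a))))"

text \<open>A pullback vanishes exactly when the form vanishes on the image of I over the image of
  \<iota>. The criterion for \<open>vanishing\<close> ideals then applies with the sections
  \<open>tangent_section br \<iota> a\<close>.\<close>

lemma pullback_kernel_differential_ideal:
  fixes br :: "'g::euclidean_space \<Rightarrow> 'g \<Rightarrow> 'g" and \<iota> :: "real \<times> 'g \<Rightarrow> (real \<times> 'g) \<times> 'y::euclidean_space"
  assumes lie: "lie_algebra br" and \<iota>: "smooth \<iota>" "\<And>m. fst (\<iota> m) = m"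
  shows "differential_ideal (prolongation (ip_algebroid br))
    {\<theta> \<in> forms (prolongation (ip_algebroid br)). pullback (ip_algebroid br) \<iota> \<theta> = (\<lambda>m vs. 0)}"
proof -
  let ?L = "prolongation (ip_algebroid br) :: ((real \<times> 'g) \<times> 'y, _) algebroid"
  let ?I = "prolong_section (ip_algebroid br) \<iota>"
  let ?D = "\<lambda>m. frechet_derivative \<iota> (at m)"
  interpret framed_algebroid ?L "ip_prolongation_frame br" by (rule ip_prolongation_framed[OF lie])
  have bl: "bilinear br" using lie by (simp add: lie_algebra_def)
  have d\<iota>: "\<iota> differentiable (at m)" for m using \<iota>(1) by (rule smooth_differentiable)
  have fst_D: "fst (?D m h) = h" for m h
    using frechet_derivative_fst_snd(1)[OF d\<iota>, of m h] by (simp add: \<iota>(2))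
  have tan: "tangent_section br \<iota> a (\<iota> m) = ?I m a" for a m
    by (simp add: tangent_section_def prolong_section_ip \<iota>(2) prod_eq_iff fst_D)
  have sm: "smooth (\<lambda>m. ?D m (ip_anchor br m a))" for a
    by (intro smooth_frechet_derivative \<iota>(1) smooth_ip_anchor lie smooth_ident smooth_const)
  have sec: "tangent_section br \<iota> a \<in> sections ?L" for a
  proof -
    have "smooth (tangent_section br \<iota> a)"
      unfolding tangent_section_def[abs_def]
      by (intro smooth_Pair smooth_const smooth_ip_anchor[OF lie] smooth_fst smooth_ident smooth_snd
          smooth_linear_right[OF bounded_linear_fst sm])
    then show ?thesis
      by (simp add: sections_def ip_prolongation_fiber tangent_section_def)
  qed
  define V where "V x = range (?I (fst x))" for x :: "(real \<times> 'g) \<times> 'y"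
  have "differential_ideal ?L (vanishing (range \<iota>) V)"
  proof (rule vanishing_differential_ideal[where \<X> = "range (tangent_section br \<iota>)"])
    show "range (tangent_section br \<iota>) \<subseteq> sections ?L" using sec by auto
    show "X x \<in> V x" if "X \<in> range (tangent_section br \<iota>)" "x \<in> range \<iota>" for X x
      using that by (auto simp: tan V_def \<iota>(2))
    show "\<exists>X\<in>range (tangent_section br \<iota>). X x = v" if xv: "x \<in> range \<iota>" "v \<in> V x" for x v
    proof -
      obtain m where x: "x = \<iota> m" using xv by blast
      obtain a where "v = ?I m a" using xv by (auto simp add: V_def \<iota>(2) x simp del: split_paired_All split_paired_Ex)
      then have "tangent_section br \<iota> a x = v" by (simp add: tan x)
      then show ?thesis by blast
    qed
    show "bracket ?L X Y x \<in> V x"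
      if XY: "X \<in> range (tangent_section br \<iota>)" "Y \<in> range (tangent_section br \<iota>)" "x \<in> range \<iota>" for X Y x
    proof -
      obtain a b m where X: "X = tangent_section br \<iota> a" and Y: "Y = tangent_section br \<iota> b" and x: "x = \<iota> m"
        using XY by blast
      obtain c u v where a: "a = (c, u, v)" by (metis prod_cases3)
      obtain c' u' v' where b: "b = (c', u', v')" by (metis prod_cases3)
      \<comment> \<open>A derivative along D\<iota>(h) sees only the restriction to the image of
        \<iota>, where the section is I of a constant; its variation splits into a second derivative
        of \<iota> and the variation of the anchor.\<close>
      have D: "frechet_derivative (\<lambda>y. snd (tangent_section br \<iota> e y)) (at (\<iota> m)) (?D m h) =
          frechet_derivative (\<lambda>y. ?D y (ip_anchor br m e)) (at m) h + ?D m (0, br (snd h) (fst (snd e)))" for e h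
      proof -
        have "frechet_derivative (\<lambda>y. snd (tangent_section br \<iota> e y)) (at (\<iota> m)) (?D m h) =
            frechet_derivative (\<lambda>y. snd (tangent_section br \<iota> e (\<iota> y))) (at m) h"
          using sec[of e]
          by (intro frechet_derivative_chain[symmetric] d\<iota> smooth_differentiable smooth_snd) (simp add: sections_def)
        also have "\<dots> = frechet_derivative (\<lambda>y. ?D y (ip_anchor br y e)) (at m) h"
          by (simp add: tan prolong_section_ip)
        also have "\<dots> = frechet_derivative (\<lambda>y. ?D y (ip_anchor br m e)) (at m) h
            + ?D m (frechet_derivative (\<lambda>y. ip_anchor br y e) (at m) h)"
          by (intro frechet_derivative_derivative \<iota> smooth_differentiable smooth_ip_anchor lie smooth_ident smooth_const)
        also have "frechet_derivative (\<lambda>y. ip_anchor br y e) (at m) h = (0, br (snd h) (fst (snd e)))"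
          using frechet_derivative_ip_anchor[OF lie bounded_linear_ident, of "\<lambda>y. e" m h]
          by (simp add: ip_anchor_apply bilinear_zero[OF bl])
        finally show ?thesis .
      qed
      \<comment> \<open>The second derivatives of \<iota> drop out by symmetry, and
        \<open>ip_anchor_bracket\<close> identifies the rest with the anchor of the bracket.\<close>
      have "bracket ?L X Y x = ((0, br u u', br u v' + br v u'),
          ?D m (0, br (snd (ip_anchor br m a)) u') - ?D m (0, br (snd (ip_anchor br m b)) u))"
        unfolding ip_prolongation_bracket X Y x
        using frechet_derivative_symmetric[OF \<iota>(1), of "ip_anchor br m a" m "ip_anchor br m b"]
        by (simp add: tan prolong_section_ip D) (simp add: tangent_section_def a b)
      also have "\<dots> = ?I m (0, br u u', br u v' + br v u')"
        unfolding prolong_section_ip ip_anchor_bracket[OF lie, of m u u' v' v c c'] a b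
        by (simp add: linear_diff[OF linear_frechet_derivative[OF d\<iota>], symmetric])
      finally show ?thesis by (simp add: V_def x \<iota>(2))
    qed
    show "frechet_derivative f (at x) (anchor ?L x (X x)) = 0"
      if X: "X \<in> range (tangent_section br \<iota>)" "x \<in> range \<iota>" "smooth f" "\<And>y. y \<in> range \<iota> \<Longrightarrow> f y = (0::real)" for X f x
    proof -
      obtain a m where e: "X = tangent_section br \<iota> a" "x = \<iota> m" using X by blast
      \<comment> \<open>The anchor of a tangent section is a velocity of \<iota>, so this is a
        derivative of f \<circ> \<iota>, which is identically zero.\<close>
      have "frechet_derivative f (at x) (anchor ?L x (X x)) =
          frechet_derivative (\<lambda>y. f (\<iota> y)) (at m) (ip_anchor br m a)"
        unfolding e tan prolongation_anchor prolong_section_ip snd_conv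
        by (intro frechet_derivative_chain[symmetric] d\<iota> smooth_differentiable X(3))
      then show ?thesis using X(4) by simp
    qed
  qed
  moreover have "vanishing (range \<iota>) V = {\<theta> \<in> forms ?L. pullback (ip_algebroid br) \<iota> \<theta> = (\<lambda>m vs. 0)}"
  proof -
    have "(\<forall>x\<in>range \<iota>. \<forall>vs. set vs \<subseteq> V x \<longrightarrow> \<theta> x vs = 0) \<longleftrightarrow> (\<forall>m as. \<theta> (\<iota> m) (map (?I m) as) = 0)"
      for \<theta> :: "((real \<times> 'g) \<times> 'y, _) form"
    proof -
      have *: "set vs \<subseteq> V (\<iota> m) \<longleftrightarrow> (\<exists>as. vs = map (?I m) as)" for vs m
        unfolding ex_map_conv V_def \<iota>(2) by blast
      then show ?thesis unfolding ball_simps(9) * by blast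
    qed
    moreover have "pullback (ip_algebroid br) \<iota> \<theta> = (\<lambda>m vs. 0) \<longleftrightarrow> (\<forall>m as. \<theta> (\<iota> m) (map (?I m) as) = 0)"
      for \<theta> by (simp add: pullback_def ip_algebroid_def fun_eq_iff)
    ultimately show ?thesis unfolding vanishing_def by blast
  qed
  ultimately show ?thesis by simp
qed

section \<open>The generating one-forms\<close>

lemma (in framed_algebroid) func_form_form:
  assumes "smooth f"
  shows "func_form f \<in> forms L"
proof (rule formsI)
  show "smooth (\<lambda>x. func_form f x (map (\<lambda>s. s x) ss))" for ss
    using assms by (cases ss) (simp_all add: func_form_def)
qed (auto simp: func_form_def)

lemma (in framed_algebroid) ext_deriv_func_form:
  assumes "smooth f"
  shows "ext_deriv L (func_form f) =
    (\<lambda>x vs. if set vs \<subseteq> fiber L x then one_form (\<lambda>x v. frechet_derivative f (at x) (anchor L x v)) x vs else 0)"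
proof (intro ext)
  fix x vs
  note F = func_form_form[OF assms]
  show "ext_deriv L (func_form f) x vs =
     (if set vs \<subseteq> fiber L x then one_form (\<lambda>x v. frechet_derivative f (at x) (anchor L x v)) x vs else 0)"
  proof (cases "set vs \<subseteq> fiber L x")
    case True
    have z: "contract X (func_form f) = (\<lambda>x vs. 0)" for X
      by (simp add: contract_def func_form_def fun_eq_iff)
    have z': "koszul L (\<lambda>x vs. 0) ss x = 0" for ss
      by (simp add: koszul_def)
    show ?thesis
    proof (cases vs)
      case Nil
      then show ?thesis using ext_deriv_eval[OF F True] by (simp add: koszul_Nil one_form_def)
    next
      case (Cons v us)
      have "set (map (\<lambda>v y. T y v) us) \<subseteq> sections L" by auto
      then have "ext_deriv L (func_form f) x vs = lie (\<lambda>y. T y v) (func_form f) (map (\<lambda>v y. T y v) us) x"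
        using ext_deriv_eval[OF F True] Cons by (simp add: koszul_Cons F z z')
      then show ?thesis
        using True Cons by (cases us) (simp_all add: lie_def func_form_def one_form_def frame_id)
    qed
  next
    case False
    then show ?thesis using form_outside[OF ext_deriv(1)[OF F]] by simp
  qed
qed

lemma s_co_bounded_linear: "bounded_linear (s_co i j :: ('g::euclidean_space, 'n::finite) Mbar \<Rightarrow> real)"
  unfolding linear_conv_bounded_linear[symmetric]
  by (rule linearI) (auto simp: s_co_def split: prod.splits)

lemma P_co_bounded_linear: "bounded_linear (P_co i j k :: ('g::euclidean_space, 'n::finite) Mbar \<Rightarrow> real)"
  unfolding linear_conv_bounded_linear[symmetric]
  by (rule linearI) (auto simp: P_co_def split: prod.splits)

lemma Q_co_bounded_linear: "bounded_linear (Q_co i j k :: ('g::euclidean_space, 'n::finite) Mbar \<Rightarrow> real)"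
  unfolding linear_conv_bounded_linear[symmetric]
  by (rule linearI) (auto simp: Q_co_def split: prod.splits)

text \<open>The coefficient of \<Theta>^l in \<sigma>_ij without Q_ijl. The matrix s is a parameter
  because both the fibre coordinates and a multiplier are inserted for it.\<close>

definition horizontal_coeff :: "('g::euclidean_space \<Rightarrow> 'g \<Rightarrow> 'g) \<Rightarrow> ('n::finite \<Rightarrow> 'g)
    \<Rightarrow> ('n \<Rightarrow> real \<times> 'g \<Rightarrow> real) \<Rightarrow> ('n \<Rightarrow> 'n \<Rightarrow> real) \<Rightarrow> 'n \<Rightarrow> 'n \<Rightarrow> 'n \<Rightarrow> real \<times> 'g \<Rightarrow> real" where
  "horizontal_coeff br E \<gamma> s i j l m =
     (\<Sum>k\<in>UNIV. s k i * struct_const br E j l k + s k j * struct_const br E i l k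
              - s k l * dw E i (dw E j (\<gamma> k)) m) / 2"

text \<open>The argument d stands for the value of \<delta>s_ij: a coordinate of the tangent vector
  on the prolongation, a derivative of the s_ij-component of \<iota> after pullback.\<close>

definition sigma_value :: "('g::euclidean_space \<Rightarrow> 'g \<Rightarrow> 'g) \<Rightarrow> ('n::finite \<Rightarrow> 'g)
    \<Rightarrow> ('n \<Rightarrow> real \<times> 'g \<Rightarrow> real) \<Rightarrow> 'n \<Rightarrow> 'n \<Rightarrow> ('g, 'n) Mbar \<Rightarrow> real \<times> 'g \<times> 'g \<Rightarrow> real \<Rightarrow> real" where
  "sigma_value br E \<gamma> i j x a d = d
     - (\<Sum>k\<in>UNIV. s_co k i x * lam br E \<gamma> j k (fst x) + s_co k j x * lam br E \<gamma> i k (fst x)) * fst a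
     + (\<Sum>l\<in>UNIV. P_co i j l x * psi br E \<gamma> l (fst x) a)
     + (\<Sum>l\<in>UNIV. (horizontal_coeff br E \<gamma> (\<lambda>k l. s_co k l x) i j l (fst x) + Q_co i j l x) * theta E l (fst x) a)"

lemma sigma_form_eq:
  fixes br :: "'g::euclidean_space \<Rightarrow> 'g \<Rightarrow> 'g" and E :: "'n::finite \<Rightarrow> 'g"
  assumes "lie_algebra br"
  shows "sigma_form br E \<gamma> i j = (\<lambda>x vs. if set vs \<subseteq> fiber (ip_prolongation br) x
     then one_form (\<lambda>x v. sigma_value br E \<gamma> i j x (fst v) (s_co i j (snd v))) x vs else 0)"
proof (intro ext)
  fix x :: "('g, 'n) Mbar" and vs
  interpret framed_algebroid "ip_prolongation br :: (('g, 'n) Mbar, _) algebroid" "ip_prolongation_frame br"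
    unfolding ip_prolongation_def by (rule ip_prolongation_framed[OF assms])
  have D: "ext_deriv (ip_prolongation br) (func_form (s_co i j)) x vs =
     (if set vs \<subseteq> fiber (ip_prolongation br) x then one_form (\<lambda>x v. s_co i j (snd v)) x vs else 0)"
    by (simp add: ext_deriv_func_form[OF smooth_linear[OF s_co_bounded_linear]]
        frechet_derivative_eqI[OF bounded_linear_imp_has_derivative[OF s_co_bounded_linear]])
      (simp add: ip_prolongation_def prolongation_anchor)
  show "sigma_form br E \<gamma> i j x vs = (if set vs \<subseteq> fiber (ip_prolongation br) x
     then one_form (\<lambda>x v. sigma_value br E \<gamma> i j x (fst v) (s_co i j (snd v))) x vs else 0)"
    unfolding sigma_form_def D
    by (simp add: Gamma_form_alt Psi_form_alt Theta_form_alt lift_one_form ip_prolongation_def[symmetric])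
      (auto simp: one_form_def sigma_value_def horizontal_coeff_def split: list.splits)
qed

lemma sigma_form_form:
  fixes br :: "'g::euclidean_space \<Rightarrow> 'g \<Rightarrow> 'g" and E :: "'n::finite \<Rightarrow> 'g"
  assumes "lie_algebra br" "is_basis E" "\<And>i. smooth (\<gamma> i)"
  shows "sigma_form br E \<gamma> i j \<in> forms (ip_prolongation br)"
proof -
  interpret framed_algebroid "ip_prolongation br :: (('g, 'n) Mbar, _) algebroid" "ip_prolongation_frame br"
    unfolding ip_prolongation_def by (rule ip_prolongation_framed[OF assms(1)])
  have s: "s_co i j (c *\<^sub>R u + v) = c * s_co i j u + s_co i j v" for c and u v :: "('g, 'n) Mbar"
    by (auto simp: s_co_def split: prod.splits)
  show ?thesis
    unfolding sigma_form_eq[OF assms(1)]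
  proof (rule one_form_form)
    show "sigma_value br E \<gamma> i j x (fst (c *\<^sub>R a + b)) (s_co i j (snd (c *\<^sub>R a + b))) =
        c * sigma_value br E \<gamma> i j x (fst a) (s_co i j (snd a)) + sigma_value br E \<gamma> i j x (fst b) (s_co i j (snd b))"
      for x c and a b :: "(real \<times> 'g \<times> 'g) \<times> ('g, 'n) Mbar"
      unfolding sigma_value_def fst_add snd_add fst_scaleR snd_scaleR psi_linear[OF assms(2)]
        theta_linear[OF assms(2)] s
      by (simp only: distrib_left distrib_right sum.distrib right_diff_distrib sum_distrib_left
          mult.left_commute[of _ c] real_scaleR_def)
    show "smooth (\<lambda>x. sigma_value br E \<gamma> i j x (fst (X x)) (s_co i j (snd (X x))))"
      if "X \<in> sections (ip_prolongation br)" for X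
    proof -
      have X: "smooth X" using that by (simp add: sections_def)
      show ?thesis
        unfolding sigma_value_def horizontal_coeff_def
        by (intro smooth_add smooth_diff smooth_sum smooth_mult smooth_divide smooth_const
            smooth_linear_left[OF s_co_bounded_linear] smooth_fst[OF X] smooth_snd[OF X] smooth_fst[OF smooth_fst[OF X]]
            smooth_linear[OF s_co_bounded_linear] smooth_linear[OF P_co_bounded_linear]
            smooth_linear[OF Q_co_bounded_linear] smooth_psi smooth_theta bounded_linear_fst assms
            smooth_linear_right[OF bounded_linear_fst smooth_lam]
            smooth_linear_right[OF bounded_linear_fst smooth_dw[OF smooth_dw]])
    qed
  qed
qed

lemma pullback_sigma_form:
  fixes br :: "'g::euclidean_space \<Rightarrow> 'g \<Rightarrow> 'g" and E :: "'n::finite \<Rightarrow> 'g"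
  assumes "lie_algebra br" "smooth \<iota>" "\<And>m. fst (\<iota> m) = m"
  shows "pullback (ip_algebroid br) \<iota> (sigma_form br E \<gamma> i j) = (\<lambda>m vs. 0) \<longleftrightarrow>
    (\<forall>m a. sigma_value br E \<gamma> i j (\<iota> m) a
       (frechet_derivative (\<lambda>m. s_co i j (\<iota> m)) (at m) (ip_anchor br m a)) = 0)"
proof -
  let ?I = "prolong_section (ip_algebroid br) \<iota>"
  have d: "\<iota> differentiable (at m)" for m using assms(2) by (rule smooth_differentiable)
  \<comment> \<open>Since \<iota> is a section of p, the base component of D\<iota>(h) is h.\<close>
  have fib: "?I m a \<in> fiber (ip_prolongation br) (\<iota> m)" for m a
    using frechet_derivative_fst_snd(1)[OF d, of m "ip_anchor br m a"]
    by (simp add: ip_prolongation_def ip_prolongation_fiber prolong_section_ip assms(3))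
  have s: "s_co i j (snd (?I m a)) = frechet_derivative (\<lambda>m. s_co i j (\<iota> m)) (at m) (ip_anchor br m a)" for m a
    by (simp add: prolong_section_ip frechet_derivative_linear_left[OF s_co_bounded_linear d])
  have a: "fst (?I m a) = a" for m a by (simp add: prolong_section_ip)
  have sub: "set (map (?I m) vs) \<subseteq> fiber (ip_prolongation br) (\<iota> m)" for m vs
    unfolding set_map using fib by blast
  have "pullback (ip_algebroid br) \<iota> (sigma_form br E \<gamma> i j) =
     one_form (\<lambda>m a. sigma_value br E \<gamma> i j (\<iota> m) a
       (frechet_derivative (\<lambda>m. s_co i j (\<iota> m)) (at m) (ip_anchor br m a)))"
    unfolding sigma_form_eq[OF assms(1)] pullback_def using sub
    by (auto simp: fun_eq_iff one_form_def ip_algebroid_def[of br, THEN arg_cong, of fiber] s a split: list.splits)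
  moreover have "one_form \<theta> = (\<lambda>m vs. 0) \<longleftrightarrow> (\<forall>m a. \<theta> m a = 0)"
    for \<theta> :: "real \<times> 'g \<Rightarrow> real \<times> 'g \<times> 'g \<Rightarrow> real"
  proof
    assume "one_form \<theta> = (\<lambda>m vs. 0)"
    then have "one_form \<theta> m [a] = 0" for m a by simp
    then show "\<forall>m a. \<theta> m a = 0" by (simp add: one_form_def)
  qed (simp add: one_form_def fun_eq_iff split: list.splits)
  ultimately show ?thesis by simp
qed

section \<open>The curvature condition\<close>

lemma lam_double:
  "2 * lam br E \<gamma> i j m + dw E i (\<gamma> j) m = (\<Sum>k\<in>UNIV. coord E k (snd m) * struct_const br E k i j)"
proof -
  have "2 * ((a - b) / 2) + b = a" for a b :: real by (simp add: diff_divide_distrib)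
  then show ?thesis unfolding lam_def .
qed

text \<open>The definition of \<lambda> solved for w^k C_kl^j: the matrix of ad w becomes 2
  \<lambda> + \<partial>\<gamma>/\<partial>w. Trading brackets with w for these terms makes the
  later cancellations visible.\<close>

lemma br_coord:
  fixes E :: "'n::finite \<Rightarrow> 'g::euclidean_space"
  assumes "lie_algebra br" "is_basis E"
  shows "br w (E l) = (\<Sum>j\<in>UNIV. (2 * lam br E \<gamma> l j (t, w) + dw E l (\<gamma> j) (t, w)) *\<^sub>R E j)"
proof -
  have bl: "bilinear br" using assms(1) by (simp add: lie_algebra_def)
  have lin: "linear (\<lambda>x. br x (E l))" using bl by (simp add: bilinear_def)
  have "br w (E l) = br (\<Sum>k\<in>UNIV. coord E k w *\<^sub>R E k) (E l)"
    by (simp add: coord_expand[OF assms(2)])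
  also have "\<dots> = (\<Sum>k\<in>UNIV. coord E k w *\<^sub>R br (E k) (E l))"
    by (simp add: linear_sum[OF lin] bilinear_lmul[OF bl])
  also have "\<dots> = (\<Sum>k\<in>UNIV. coord E k w *\<^sub>R (\<Sum>j\<in>UNIV. struct_const br E k l j *\<^sub>R E j))"
    by (simp add: struct_const_def coord_expand[OF assms(2)])
  also have "\<dots> = (\<Sum>j\<in>UNIV. \<Sum>k\<in>UNIV. (coord E k w * struct_const br E k l j) *\<^sub>R E j)"
    by (subst sum.swap) (simp add: scaleR_sum_right)
  also have "\<dots> = (\<Sum>j\<in>UNIV. (\<Sum>k\<in>UNIV. coord E k w * struct_const br E k l j) *\<^sub>R E j)"
    by (simp add: scaleR_sum_left)
  finally show ?thesis using lam_double[of br E \<gamma> l _ "(t, w)"] by simp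
qed

lemma coord_sum:
  fixes E :: "'n::finite \<Rightarrow> 'g::real_normed_vector"
  assumes "is_basis E"
  shows "coord E i (\<Sum>j\<in>UNIV. c j *\<^sub>R E j) = c i"
  by (simp add: linear_sum[OF coord_linear[OF assms]] linear_cmul[OF coord_linear[OF assms]]
      coord_basis[OF assms] if_distrib[of "\<lambda>x. _ * x"] cong: if_cong)

lemma Gamma_sec_eq:
  "Gamma_sec E \<gamma> m = (1, \<Sum>j\<in>UNIV. coord E j (snd m) *\<^sub>R E j, \<Sum>j\<in>UNIV. \<gamma> j m *\<^sub>R E j)"
  by (simp add: Gamma_sec_def T0_sec_def e_sec_def W_sec_def prod_eq_iff fst_sum snd_sum)

lemma H_sec_eq: "H_sec br E \<gamma> j m = (0, E j, - (\<Sum>k\<in>UNIV. lam br E \<gamma> j k m *\<^sub>R E k))"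
  by (simp add: H_sec_def e_sec_def W_sec_def prod_eq_iff fst_sum snd_sum)

lemma frechet_derivative_sum_scaleR:
  fixes c :: "'n::finite \<Rightarrow> 'a::real_normed_vector \<Rightarrow> real"
  assumes "\<And>j. c j differentiable (at x)"
  shows "frechet_derivative (\<lambda>y. \<Sum>j\<in>UNIV. c j y *\<^sub>R E j) (at x) h =
    (\<Sum>j\<in>UNIV. frechet_derivative (c j) (at x) h *\<^sub>R E j)"
proof -
  have "((\<lambda>y. \<Sum>j\<in>UNIV. c j y *\<^sub>R E j) has_derivative
      (\<lambda>h. \<Sum>j\<in>UNIV. frechet_derivative (c j) (at x) h *\<^sub>R E j)) (at x)"
    using assms unfolding frechet_derivative_works
    by (intro has_derivative_sum has_derivative_scaleR_left)
  then show ?thesis by (simp add: frechet_derivative_eqI)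
qed

lemma anchor_Gamma:
  fixes E :: "'n::finite \<Rightarrow> 'g::real_normed_vector"
  assumes "lie_algebra br" "is_basis E"
  shows "ip_anchor br m (Gamma_sec E \<gamma> m) = (1, \<Sum>j\<in>UNIV. \<gamma> j m *\<^sub>R E j)"
  using assms by (simp add: Gamma_sec_eq ip_anchor_apply coord_expand lie_algebra_def)

lemma smooth_Gamma_sec:
  fixes E :: "'n::finite \<Rightarrow> 'g::euclidean_space"
  assumes "is_basis E" "\<And>i. smooth (\<gamma> i)"
  shows "smooth (Gamma_sec E \<gamma>)"
  unfolding Gamma_sec_eq[abs_def]
  by (intro smooth_Pair smooth_const smooth_sum smooth_scaleR smooth_coord smooth_snd smooth_ident assms)

lemma smooth_H_sec:
  fixes E :: "'n::finite \<Rightarrow> 'g::euclidean_space"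
  assumes "is_basis E" "\<And>i. smooth (\<gamma> i)"
  shows "smooth (H_sec br E \<gamma> j)"
  unfolding H_sec_eq[abs_def]
  by (intro smooth_Pair smooth_const smooth_minus smooth_sum smooth_scaleR smooth_lam assms)

text \<open>Links the coordinate expression \<phi> to a bracket of basis sections, which is how the
  Koszul formula for \<delta>\<omega>^ij comes to contain it.\<close>

lemma psi_bracket_Gamma_H:
  fixes E :: "'n::finite \<Rightarrow> 'g::euclidean_space"
  assumes lie: "lie_algebra br" and E: "is_basis E" and \<gamma>: "\<And>i. smooth (\<gamma> i)"
  shows "psi br E \<gamma> i m (ip_bracket br (Gamma_sec E \<gamma>) (H_sec br E \<gamma> k) m) = phi br E \<gamma> k i m"
proof -
  obtain t w where m: "m = (t, w)" by (cases m)
  have bl: "bilinear br" using lie by (simp add: lie_algebra_def)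
  note cl = coord_linear[OF E]
  let ?lm = "lam br E \<gamma>"
  let ?g = "\<Sum>j\<in>UNIV. \<gamma> j m *\<^sub>R E j"
  let ?\<Lambda> = "\<Sum>j\<in>UNIV. ?lm k j m *\<^sub>R E j"
  let ?h = "(0, br w (E k) - ?\<Lambda>)"
  have d\<gamma>: "\<gamma> j differentiable (at m)" "?lm k j differentiable (at m)" for j
    using \<gamma> smooth_lam[OF E \<gamma>] by (auto intro: smooth_differentiable)
  have DG: "frechet_derivative (Gamma_sec E \<gamma>) (at m) h =
      (0, snd h, \<Sum>j\<in>UNIV. frechet_derivative (\<gamma> j) (at m) h *\<^sub>R E j)" for h
  proof -
    have "((\<lambda>y. (1::real, snd y, \<Sum>j\<in>UNIV. \<gamma> j y *\<^sub>R E j)) has_derivative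
        (\<lambda>h. (0, snd h, frechet_derivative (\<lambda>y. \<Sum>j\<in>UNIV. \<gamma> j y *\<^sub>R E j) (at m) h))) (at m)"
      by (intro has_derivative_Pair has_derivative_const has_derivative_snd has_derivative_ident
          smooth_has_derivative smooth_sum smooth_scaleR smooth_const \<gamma>)
    then show ?thesis
      by (simp add: Gamma_sec_eq[abs_def] coord_expand[OF E] frechet_derivative_eqI
          frechet_derivative_sum_scaleR d\<gamma>)
  qed
  have DH: "frechet_derivative (H_sec br E \<gamma> k) (at m) h =
      (0, 0, - (\<Sum>j\<in>UNIV. frechet_derivative (?lm k j) (at m) h *\<^sub>R E j))" for h
  proof -
    have "((\<lambda>y. (0::real, E k, - (\<Sum>j\<in>UNIV. ?lm k j y *\<^sub>R E j))) has_derivative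
        (\<lambda>h. (0, 0, - frechet_derivative (\<lambda>y. \<Sum>j\<in>UNIV. ?lm k j y *\<^sub>R E j) (at m) h))) (at m)"
      by (intro has_derivative_Pair has_derivative_const has_derivative_minus
          smooth_has_derivative smooth_sum smooth_scaleR smooth_const smooth_lam[OF E \<gamma>])
    then show ?thesis
      by (simp add: H_sec_eq[abs_def] frechet_derivative_eqI frechet_derivative_sum_scaleR d\<gamma>)
  qed
  have aH: "ip_anchor br m (H_sec br E \<gamma> k m) = ?h"
    by (simp add: ip_anchor_apply H_sec_eq m)
  \<comment> \<open>In the middle component [w, E_k] appears in the constant and in the derivative
    part and cancels, leaving \<open>?\<Lambda>\<close>; the \<Theta>-components of the bracket are
    thus \<lambda>_k^l.\<close>
  have "ip_bracket br (Gamma_sec E \<gamma>) (H_sec br E \<gamma> k) m =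
      (0, ?\<Lambda>, br ?g (E k) - br w ?\<Lambda> - (\<Sum>j\<in>UNIV. dgam E \<gamma> (?lm k j) m *\<^sub>R E j)
        - (\<Sum>j\<in>UNIV. frechet_derivative (\<gamma> j) (at m) ?h *\<^sub>R E j))"
    unfolding ip_bracket_apply DG DH aH anchor_Gamma[OF lie E]
    by (simp add: Gamma_sec_eq H_sec_eq coord_expand[OF E] m bilinear_rneg[OF bl] dgam_def)
  then have 1: "psi br E \<gamma> i m (ip_bracket br (Gamma_sec E \<gamma>) (H_sec br E \<gamma> k) m) =
      coord E i (br ?g (E k)) - coord E i (br w ?\<Lambda>) - dgam E \<gamma> (?lm k i) m
      - frechet_derivative (\<gamma> i) (at m) ?h + (\<Sum>l\<in>UNIV. ?lm l i m * ?lm k l m)"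
    by (simp add: psi_def theta_def linear_diff[OF cl] coord_sum[OF E])
  have lin: "linear (frechet_derivative (\<gamma> i) (at m))" using d\<gamma> by (intro linear_frechet_derivative)
  have 2: "frechet_derivative (\<gamma> i) (at m) (0, \<Sum>l\<in>UNIV. c l *\<^sub>R E l) = (\<Sum>l\<in>UNIV. c l * dw E l (\<gamma> i) m)" for c
  proof -
    have "(0, \<Sum>l\<in>UNIV. c l *\<^sub>R E l) = (\<Sum>l\<in>UNIV. c l *\<^sub>R (0::real, E l))"
      by (simp add: prod_eq_iff fst_sum snd_sum)
    then show ?thesis by (simp only: linear_sum[OF lin] linear_cmul[OF lin] dw_def real_scaleR_def)
  qed
  have brw: "br w (E l) = (\<Sum>j\<in>UNIV. (\<Sum>a\<in>UNIV. coord E a w * struct_const br E a l j) *\<^sub>R E j)" for l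
    using br_coord[OF lie E, of w l \<gamma> t] lam_double[of br E \<gamma> l _ "(t, w)"] by simp
  have hor: "?h = (0, \<Sum>l\<in>UNIV. ((\<Sum>a\<in>UNIV. coord E a w * struct_const br E a k l) - ?lm k l m) *\<^sub>R E l)"
    by (simp add: brw scaleR_left_diff_distrib sum_subtractf)
  have 3: "coord E i (br ?g (E k)) = - (\<Sum>a\<in>UNIV. \<gamma> a m * struct_const br E k a i)"
  proof -
    have l1: "linear (\<lambda>x. br x (E k))" using bl by (simp add: bilinear_def)
    have "struct_const br E a k i = - struct_const br E k a i" for a
      using lie_algebra_antisym[OF lie, of "E a" "E k"] by (simp add: struct_const_def linear_neg[OF cl])
    then show ?thesis
      by (simp add: linear_sum[OF l1] bilinear_lmul[OF bl] linear_sum[OF cl] linear_cmul[OF cl]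
          struct_const_def[symmetric] sum_negf)
  qed
  have 4: "coord E i (br w ?\<Lambda>) = (\<Sum>b\<in>UNIV. ?lm k b m * (2 * ?lm b i m + dw E b (\<gamma> i) m))"
  proof -
    have l1: "linear (br w)" using bl by (simp add: bilinear_def)
    have "coord E i (br w (E b)) = 2 * ?lm b i m + dw E b (\<gamma> i) m" for b
      using br_coord[OF lie E, of w b \<gamma> t] by (simp add: coord_sum[OF E] m)
    then show ?thesis
      by (simp add: linear_sum[OF l1] linear_cmul[OF l1] linear_sum[OF cl] linear_cmul[OF cl])
  qed
  have 5: "frechet_derivative (\<gamma> i) (at m) ?h =
      (\<Sum>a\<in>UNIV. \<Sum>l\<in>UNIV. coord E a w * struct_const br E a k l * dw E l (\<gamma> i) m)
      - (\<Sum>l\<in>UNIV. ?lm k l m * dw E l (\<gamma> i) m)"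
    unfolding hor 2
    by (simp add: left_diff_distrib sum_subtractf sum_distrib_right)
      (rule sum.swap)
  \<comment> \<open>Fact \<open>4\<close> contributes - 2 \<lambda>\<lambda> and the correction in
    \<open>psi\<close> contributes + \<lambda>\<lambda>, leaving the single product in \<phi>; the
    terms \<lambda> \<partial>\<gamma> from \<open>4\<close> and \<open>5\<close> cancel.\<close>
  show ?thesis
    unfolding 1 3 4 5
    by (simp add: phi_def m distrib_left sum.distrib sum_distrib_left[symmetric] mult.left_commute mult.commute[of "?lm _ i _"])
qed

lemma one_form_ip_form:
  fixes br :: "'g::euclidean_space \<Rightarrow> 'g \<Rightarrow> 'g"
  assumes "lie_algebra br" "\<And>m c a b. \<theta> m (c *\<^sub>R a + b) = c * \<theta> m a + \<theta> m b"
    "\<And>s. smooth s \<Longrightarrow> smooth (\<lambda>m. \<theta> m (s m))"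
  shows "one_form \<theta> \<in> forms (ip_algebroid br)"
proof -
  interpret framed_algebroid "ip_algebroid br" "\<lambda>x v. v" by (rule ip_framed[OF assms(1)])
  have "(\<lambda>x vs. if set vs \<subseteq> fiber (ip_algebroid br) x then one_form \<theta> x vs else 0) \<in> forms (ip_algebroid br)"
    using assms(2,3) by (intro one_form_form) (simp_all add: ip_sections)
  then show ?thesis by (simp add: ip_algebroid_def)
qed

lemma wedge_one_forms: "wedge (one_form \<alpha>) (one_form \<beta>) x [a, b] = \<alpha> x a * \<beta> x b - \<alpha> x b * \<beta> x a"
  using wedge_Cons[of "one_form \<alpha>" "one_form \<beta>" x "\<lambda>_. a" "[b]"]
    wedge_Cons[of "contract (\<lambda>_. a) (one_form \<alpha>)" "one_form \<beta>" x "\<lambda>_. b" "[]"]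
    wedge_Cons[of "graded (one_form \<alpha>)" "contract (\<lambda>_. a) (one_form \<beta>)" x "\<lambda>_. b" "[]"]
  by (simp add: wedge_def contract_def graded_def one_form_def)

text \<open>The ideal generated by the \<open>\<omega>\<^sup>i\<^sup>j\<close> vanishes on the vectors annihilated by all \<open>\<Psi>\<^sup>i\<close>, in particular on
  \<open>\<Gamma>\<^sub>0, H\<^sub>k, H\<^sub>l\<close>; evaluating \<open>\<delta>\<omega>\<^sup>i\<^sup>j\<close> there isolates the symmetrized \<open>\<phi>\<close>.\<close>

lemma phi_condition_of_ideal:
  fixes E :: "'n::finite \<Rightarrow> 'g::euclidean_space"
  assumes lie: "lie_algebra br" and E: "is_basis E" and \<gamma>: "\<And>i. smooth (\<gamma> i)"
    and ideal: "differential_ideal (ip_algebroid br)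
      (algebraic_ideal_generated (ip_algebroid br) (Sigma0 br E \<gamma>))"
  shows "phi br E \<gamma> k i m * of_bool (j = l) + phi br E \<gamma> k j m * of_bool (i = l) =
    phi br E \<gamma> l i m * of_bool (j = k) + phi br E \<gamma> l j m * of_bool (i = k)"
proof -
  let ?L = "ip_algebroid br"
  let ?G = "Gamma_sec E \<gamma>" and ?H = "H_sec br E \<gamma>"
  let ?\<omega> = "omega_form br E \<gamma>"
  interpret framed_algebroid ?L "\<lambda>x v. v" by (rule ip_framed[OF lie])
  have Psi: "Psi_form br E \<gamma> i \<in> forms ?L" for i
    unfolding Psi_form_alt
    by (rule one_form_ip_form[OF lie psi_linear[OF E]]) (rule smooth_psi[OF E \<gamma> bounded_linear_ident])
  have Theta: "Theta_form E i \<in> forms ?L" for i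
    unfolding Theta_form_alt
    by (rule one_form_ip_form[OF lie theta_linear[OF E]]) (rule smooth_theta[OF E bounded_linear_ident])
  have \<omega>: "?\<omega> i j \<in> forms ?L" for i j
    using form_scale[OF form_add[OF wedge_form[OF Psi Theta] wedge_form[OF Psi Theta]] smooth_const, of "1/2" i j j i]
    by (simp add: omega_form_def)
  define V where "V m = {a. \<forall>i. psi br E \<gamma> i m a = 0}" for m
  have wV: "wedge (Psi_form br E \<gamma> i) \<eta> m vs = 0" if "set vs \<subseteq> V m" for i \<eta> m vs
  proof -
    have "Psi_form br E \<gamma> i m us = 0" if "set us \<subseteq> V m" for us
      using that by (auto simp: Psi_form_alt one_form_def V_def split: list.splits)
    moreover have "set (nths vs S) \<subseteq> V m" for S using that set_nths_subset by fast
    ultimately show ?thesis by (simp add: wedge_def)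
  qed
  have "Sigma0 br E \<gamma> \<subseteq> vanishing UNIV V"
  proof
    fix \<theta> assume "\<theta> \<in> Sigma0 br E \<gamma>"
    then obtain f where f: "\<And>i j. smooth (f i j)"
      and \<theta>: "\<theta> = (\<lambda>m vs. \<Sum>i\<in>UNIV. \<Sum>j\<in>UNIV. f i j m * ?\<omega> i j m vs)"
      by (auto simp: Sigma0_def)
    have "\<theta> \<in> forms ?L" unfolding \<theta> by (intro form_sum form_scale \<omega> f)
    moreover have "\<theta> m vs = 0" if "set vs \<subseteq> V m" for m vs
      unfolding \<theta> omega_form_def using wV[OF that] by simp
    ultimately show "\<theta> \<in> vanishing UNIV V" by (simp add: vanishing_def)
  qed
  then have gen: "algebraic_ideal_generated ?L (Sigma0 br E \<gamma>) \<subseteq> vanishing UNIV V"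
    unfolding algebraic_ideal_generated_def using vanishing_ideal by blast
  have "?\<omega> i j \<in> Sigma0 br E \<gamma>"
  proof -
    have "?\<omega> i j m vs = (\<Sum>p\<in>UNIV. \<Sum>q\<in>UNIV. (if p = i then if q = j then 1 else 0 else 0) * ?\<omega> p q m vs)" for m vs
    proof -
      have "(\<Sum>q\<in>UNIV. (if p = i then if q = j then 1 else 0 else 0) * ?\<omega> p q m vs) =
          (if p = i then ?\<omega> p j m vs else 0)" for p
        by (simp add: if_distrib[of "\<lambda>c. c * _"] cong: if_cong)
      then show ?thesis by simp
    qed
    then show ?thesis
      unfolding Sigma0_def
      by (intro CollectI exI[of _ "\<lambda>p q m. if p = i then if q = j then 1 else 0 else 0"])
        (simp add: fun_eq_iff)
  qed
  then have "?\<omega> i j \<in> algebraic_ideal_generated ?L (Sigma0 br E \<gamma>)"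
    unfolding algebraic_ideal_generated_def by blast
  then have "ext_deriv ?L (?\<omega> i j) \<in> vanishing UNIV V"
    using ideal gen unfolding differential_ideal_def by blast
  moreover have GV: "?G m \<in> V m" and HV: "?H k m \<in> V m" for k m
    using dual_basis(4,6)[OF E, of br \<gamma> _ m] by (simp_all add: V_def Psi_form_alt one_form_def)
  moreover have "\<theta> m vs = 0" if "\<theta> \<in> vanishing UNIV V" "set vs \<subseteq> V m" for \<theta> m vs
    using that unfolding vanishing_def by blast
  ultimately have "ext_deriv ?L (?\<omega> i j) m [?G m, ?H k m, ?H l m] = 0"
    by simp
  moreover have s: "?G \<in> sections ?L" "?H k \<in> sections ?L" for k
    using smooth_Gamma_sec[OF E \<gamma>] smooth_H_sec[OF E \<gamma>] by (simp_all add: ip_sections)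
  ultimately have 0: "koszul ?L (?\<omega> i j) [?G, ?H k, ?H l] m = 0"
    using ext_deriv(2)[OF \<omega>[of i j], of "[?G, ?H k, ?H l]" m] by simp
  have ev: "?\<omega> i j m [a, b] = (psi br E \<gamma> i m a * theta E j m b - psi br E \<gamma> i m b * theta E j m a
      + psi br E \<gamma> j m a * theta E i m b - psi br E \<gamma> j m b * theta E i m a) / 2" for m a b
    by (simp add: omega_form_def Psi_form_alt Theta_form_alt wedge_one_forms)
  have dual: "psi br E \<gamma> i m (?G m) = 0" "theta E i m (?G m) = 0"
    "psi br E \<gamma> i m (?H k m) = 0" "theta E i m (?H k m) = of_bool (i = k)" for i k m
  proof -
    show "psi br E \<gamma> i m (?G m) = 0" "psi br E \<gamma> i m (?H k m) = 0"
      using dual_basis(4,6)[OF E, of br \<gamma> _ m] by (simp_all add: Psi_form_alt one_form_def)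
    have "Theta_form E i m [?G m] = 0" "Theta_form E i m [?H k m] = (if i = k then 1 else 0)"
      by (rule dual_basis(7,9)[OF E])+
    then show "theta E i m (?G m) = 0" "theta E i m (?H k m) = of_bool (i = k)"
      by (simp_all add: Theta_form_alt one_form_def)
  qed
  \<comment> \<open>\<Gamma>_0 annihilates both factors of \<omega>^ij, so Cartan's formula reduces
    \<delta>\<omega>^ij to a Lie derivative along \<Gamma>_0.\<close>
  have cG: "contract ?G (?\<omega> i j) = (\<lambda>x vs. 0)"
  proof -
    have "contract ?G (Psi_form br E \<gamma> i) = (\<lambda>x vs. 0)" "contract ?G (Theta_form E i) = (\<lambda>x vs. 0)" for i
      by (auto simp: fun_eq_iff contract_def Psi_form_alt Theta_form_alt one_form_def dual split: list.splits)
    then show ?thesis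
      by (simp add: fun_eq_iff contract_def omega_form_def wedge_Cons[of _ _ _ ?G]) (simp add: wedge_def)
  qed
  have br: "bracket ?L ?G (?H k) m = ip_bracket br ?G (?H k) m" for k
    by (simp add: ip_algebroid_def)
  have "koszul ?L (?\<omega> i j) [?G, ?H k, ?H l] m = lie ?G (?\<omega> i j) [?H k, ?H l] m"
    by (simp add: koszul_Cons \<omega> s cG) (simp add: koszul_def)
  also have "\<dots> = - ?\<omega> i j m [?H k m, ip_bracket br ?G (?H l) m] - ?\<omega> i j m [ip_bracket br ?G (?H k) m, ?H l m]"
    by (simp add: lie_Cons lie_Nil contract_form \<omega> s br) (simp add: contract_def ev dual)
  finally have *: "0 = - ?\<omega> i j m [?H k m, ip_bracket br ?G (?H l) m] - ?\<omega> i j m [ip_bracket br ?G (?H k) m, ?H l m]"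
    unfolding 0 .
  \<comment> \<open>The \<Theta>-components of the brackets are multiplied by \<Psi>(H) = 0; the
    zeros mark these terms, and the four \<phi>-terms remain.\<close>
  have "c + d = a + b" if "0 = - ((0 - a + 0 - b) / 2) - (c - 0 + d - 0) / 2" for a b c d :: real
    using that by (simp add: field_simps)
  from this[OF *[unfolded ev dual psi_bracket_Gamma_H[OF lie E \<gamma>] mult_zero_left]] show ?thesis .
qed

text \<open>Taking i = j = l different from k kills the off-diagonal entries; taking k = i and l = j
  equates two diagonal entries.\<close>

lemma phi_scalar_of_ideal:
  fixes E :: "'n::finite \<Rightarrow> 'g::euclidean_space"
  assumes "lie_algebra br" "is_basis E" "\<And>i. smooth (\<gamma> i)"
    and "differential_ideal (ip_algebroid br)
      (algebraic_ideal_generated (ip_algebroid br) (Sigma0 br E \<gamma>))"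
  shows "\<exists>\<mu>. \<forall>k i. phi br E \<gamma> k i m = \<mu> * of_bool (i = k)"
proof -
  note C = phi_condition_of_ideal[OF assms, where m = m]
  have off: "phi br E \<gamma> k i m = 0" if "i \<noteq> k" for i k
    using C[of k i i i] that by simp
  have "phi br E \<gamma> i i m = phi br E \<gamma> j j m" for i j
    using C[of i i j j] by (cases "i = j") (simp_all add: off)
  \<comment> \<open>All diagonal entries agree, so any index, here \<open>undefined\<close>,
    supplies the factor.\<close>
  then show ?thesis using off by (intro exI[of _ "phi br E \<gamma> undefined undefined m"]) auto
qed

section \<open>Derivatives along the anchor\<close>

text \<open>Derivative along the anchor of H_l: that anchor is [w, E_l] - \<lambda>_l^r E_r, and
  [w, E_l] has coefficients 2 \<lambda> + \<partial>\<gamma>/\<partial>w by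
  \<open>br_coord\<close>.\<close>

definition dhor :: "('g::real_normed_vector \<Rightarrow> 'g \<Rightarrow> 'g) \<Rightarrow> ('n::finite \<Rightarrow> 'g)
    \<Rightarrow> ('n \<Rightarrow> real \<times> 'g \<Rightarrow> real) \<Rightarrow> 'n \<Rightarrow> (real \<times> 'g \<Rightarrow> real) \<Rightarrow> real \<times> 'g \<Rightarrow> real" where
  "dhor br E \<gamma> l f m = (\<Sum>r\<in>UNIV. (lam br E \<gamma> l r m + dw E l (\<gamma> r) m) * dw E r f m)"

text \<open>The expansion of a vector in \<Gamma>_0, W_l, H_l by its dual coordinates, seen through
  the anchor; it is what separates the coefficients of a differential along these three kinds of
  directions.\<close>

lemma ip_anchor_expand:
  fixes E :: "'n::finite \<Rightarrow> 'g::euclidean_space"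
  assumes lie: "lie_algebra br" and E: "is_basis E"
  shows "ip_anchor br m a = fst a *\<^sub>R (1, \<Sum>i\<in>UNIV. \<gamma> i m *\<^sub>R E i)
    + (\<Sum>l\<in>UNIV. psi br E \<gamma> l m a *\<^sub>R (0, E l))
    + (\<Sum>l\<in>UNIV. theta E l m a *\<^sub>R (\<Sum>r\<in>UNIV. (lam br E \<gamma> l r m + dw E l (\<gamma> r) m) *\<^sub>R (0, E r)))"
proof -
  obtain t w where m: "m = (t, w)" by (cases m)
  obtain c u v where a: "a = (c, u, v)" by (metis prod_cases3)
  have bl: "bilinear br" using lie by (simp add: lie_algebra_def)
  have lin: "linear (br w)" using bl by (simp add: bilinear_def)
  let ?th = "\<lambda>l. theta E l m a"
  let ?lm = "\<lambda>l r. lam br E \<gamma> l r m"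
  have th: "(\<Sum>l\<in>UNIV. ?th l *\<^sub>R E l) = u - c *\<^sub>R w"
    by (simp add: theta_def a m scaleR_left_diff_distrib sum_subtractf coord_expand[OF E]
        scaleR_scaleR[symmetric] scaleR_sum_right[symmetric] del: scaleR_scaleR)
  \<comment> \<open>Since [w, w] = 0, u may be replaced by u - c w, whose coordinates are the
    \<Theta>-components.\<close>
  have "br w w = 0" using lie by (simp add: lie_algebra_def)
  then have "br w u = br w (u - c *\<^sub>R w)"
    by (simp add: linear_diff[OF lin] linear_cmul[OF lin])
  also have "\<dots> = (\<Sum>l\<in>UNIV. ?th l *\<^sub>R br w (E l))"
    unfolding th[symmetric] by (simp add: linear_sum[OF lin] linear_cmul[OF lin])
  finally have 1: "br w u = (\<Sum>l\<in>UNIV. ?th l *\<^sub>R br w (E l))" .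
  have ps: "(\<Sum>l\<in>UNIV. psi br E \<gamma> l m a *\<^sub>R E l) = v - c *\<^sub>R (\<Sum>l\<in>UNIV. \<gamma> l m *\<^sub>R E l)
      + (\<Sum>l\<in>UNIV. ?th l *\<^sub>R (\<Sum>r\<in>UNIV. ?lm l r *\<^sub>R E r))"
  proof -
    have "(\<Sum>l\<in>UNIV. (\<Sum>k\<in>UNIV. ?lm k l * ?th k) *\<^sub>R E l) = (\<Sum>l\<in>UNIV. ?th l *\<^sub>R (\<Sum>r\<in>UNIV. ?lm l r *\<^sub>R E r))"
      by (simp add: scaleR_sum_left scaleR_sum_right mult.commute) (rule sum.swap)
    then show ?thesis
      by (simp add: psi_def a scaleR_left_distrib scaleR_left_diff_distrib sum.distrib sum_subtractf
          coord_expand[OF E] scaleR_scaleR[symmetric] scaleR_sum_right[symmetric] del: scaleR_scaleR)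
  qed
  have brw: "br w (E l) = (\<Sum>r\<in>UNIV. ?lm l r *\<^sub>R E r) + (\<Sum>r\<in>UNIV. (?lm l r + dw E l (\<gamma> r) m) *\<^sub>R E r)" for l
    unfolding br_coord[OF lie E, of w l \<gamma> t] m[symmetric] sum.distrib[symmetric] scaleR_left_distrib[symmetric]
    by (simp add: add.assoc[symmetric])
  have "br w u + v = c *\<^sub>R (\<Sum>i\<in>UNIV. \<gamma> i m *\<^sub>R E i) + (\<Sum>l\<in>UNIV. psi br E \<gamma> l m a *\<^sub>R E l)
      + (\<Sum>l\<in>UNIV. ?th l *\<^sub>R (\<Sum>r\<in>UNIV. (?lm l r + dw E l (\<gamma> r) m) *\<^sub>R E r))"
    unfolding 1 ps brw by (simp add: scaleR_right_distrib sum.distrib)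
  then show ?thesis
    by (simp add: ip_anchor_apply m a prod_eq_iff fst_sum snd_sum)
qed

lemma derivative_along_anchor:
  fixes E :: "'n::finite \<Rightarrow> 'g::euclidean_space"
  assumes "lie_algebra br" "is_basis E" "f differentiable (at m)"
  shows "frechet_derivative f (at m) (ip_anchor br m a) = fst a * dgam E \<gamma> f m
    + (\<Sum>l\<in>UNIV. psi br E \<gamma> l m a * dw E l f m) + (\<Sum>l\<in>UNIV. theta E l m a * dhor br E \<gamma> l f m)"
proof -
  have lin: "linear (frechet_derivative f (at m))" using assms(3) by (rule linear_frechet_derivative)
  show ?thesis
    unfolding ip_anchor_expand[OF assms(1,2), of m a \<gamma>] linear_add[OF lin] linear_sum[OF lin] linear_cmul[OF lin]
      dgam_def dw_def[of E _ f] dhor_def real_scaleR_def ..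
qed

lemma dw_symmetric:
  fixes E :: "'n \<Rightarrow> 'g::euclidean_space"
  shows "smooth f \<Longrightarrow> dw E i (dw E j f) m = dw E j (dw E i f) m"
  unfolding dw_def[abs_def] by (rule frechet_derivative_symmetric)

text \<open>Second derivatives of f are symmetric and the time component of the field is constant,
  so only the derivatives of the coefficients \<gamma>^r survive in the commutator.\<close>

lemma dw_dgam:
  fixes E :: "'n::finite \<Rightarrow> 'g::euclidean_space"
  assumes \<gamma>: "\<And>i. smooth (\<gamma> i)" and f: "smooth f"
  shows "dw E l (dgam E \<gamma> f) m = dgam E \<gamma> (dw E l f) m + (\<Sum>r\<in>UNIV. dw E l (\<gamma> r) m * dw E r f m)"
proof -
  let ?X = "\<lambda>m. (1::real, \<Sum>i\<in>UNIV. \<gamma> i m *\<^sub>R E i)"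
  have X: "smooth ?X" by (intro smooth_Pair smooth_const smooth_sum smooth_scaleR \<gamma>)
  have lin: "linear (frechet_derivative f (at m))"
    using f by (intro linear_frechet_derivative smooth_differentiable)
  have DX: "frechet_derivative ?X (at m) (0, E l) = (\<Sum>r\<in>UNIV. dw E l (\<gamma> r) m *\<^sub>R (0, E r))"
  proof -
    have "(?X has_derivative (\<lambda>h. (0, frechet_derivative (\<lambda>y. \<Sum>i\<in>UNIV. \<gamma> i y *\<^sub>R E i) (at m) h))) (at m)"
      by (intro has_derivative_Pair has_derivative_const smooth_has_derivative smooth_sum smooth_scaleR smooth_const \<gamma>)
    then show ?thesis
      by (simp add: frechet_derivative_eqI frechet_derivative_sum_scaleR smooth_differentiable \<gamma> dw_def
          prod_eq_iff fst_sum snd_sum)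
  qed
  have "dw E l (dgam E \<gamma> f) m = frechet_derivative (\<lambda>y. frechet_derivative f (at y) (?X m)) (at m) (0, E l)
     + frechet_derivative f (at m) (frechet_derivative ?X (at m) (0, E l))"
    unfolding dw_def dgam_def[abs_def] by (rule frechet_derivative_derivative[OF f smooth_differentiable[OF X]])
  also have "frechet_derivative (\<lambda>y. frechet_derivative f (at y) (?X m)) (at m) (0, E l) = dgam E \<gamma> (dw E l f) m"
    unfolding dw_def[abs_def] dgam_def by (rule frechet_derivative_symmetric[OF f])
  also have "frechet_derivative f (at m) (frechet_derivative ?X (at m) (0, E l)) =
      (\<Sum>r\<in>UNIV. dw E l (\<gamma> r) m * dw E r f m)"
    unfolding DX linear_sum[OF lin] linear_cmul[OF lin] dw_def[of E _ f] real_scaleR_def ..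
  finally show ?thesis .
qed

lemma dw_sum_mult:
  fixes f g :: "'i \<Rightarrow> real \<times> 'g::real_normed_vector \<Rightarrow> real"
  assumes "\<And>r. smooth (f r)" "\<And>r. smooth (g r)"
  shows "dw E l (\<lambda>m. \<Sum>r\<in>I. f r m * g r m) m = (\<Sum>r\<in>I. f r m * dw E l (g r) m + dw E l (f r) m * g r m)"
proof -
  have "((\<lambda>m. \<Sum>r\<in>I. f r m * g r m) has_derivative (\<lambda>h. \<Sum>r\<in>I. f r m * frechet_derivative (g r) (at m) h
      + frechet_derivative (f r) (at m) h * g r m)) (at m)"
    by (intro has_derivative_sum has_derivative_mult smooth_has_derivative assms)
  then show ?thesis by (simp add: dw_def frechet_derivative_eqI)
qed

lemma dw_add: "smooth f \<Longrightarrow> smooth g \<Longrightarrow> dw E l (\<lambda>m. f m + g m) m = dw E l f m + dw E l g m"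
  by (simp add: dw_def frechet_derivative_add smooth_differentiable)

text \<open>The coordinates w^k are linear, so differentiating w^k C_ki^r leaves the constant
  C_li^r; this term balances the structure constants in \<open>horizontal_coeff\<close>.\<close>

lemma dw_lam:
  fixes E :: "'n::finite \<Rightarrow> 'g::euclidean_space"
  assumes E: "is_basis E" and \<gamma>: "\<And>i. smooth (\<gamma> i)"
  shows "dw E l (lam br E \<gamma> i r) m = (struct_const br E l i r - dw E l (dw E i (\<gamma> r)) m) / 2"
proof -
  have "(lam br E \<gamma> i r has_derivative (\<lambda>h. ((\<Sum>k\<in>UNIV. coord E k (snd h) * struct_const br E k i r)
      - frechet_derivative (dw E i (\<gamma> r)) (at m) h) / 2)) (at m)"
    unfolding lam_def[abs_def]
    by (intro bounded_linear.has_derivative[OF bounded_linear_divide] has_derivative_diff has_derivative_sum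
        has_derivative_mult_left bounded_linear.has_derivative[OF coord_bounded_linear[OF E]] has_derivative_snd
        has_derivative_ident smooth_has_derivative smooth_dw \<gamma>)
  then have "dw E l (lam br E \<gamma> i r) m = ((\<Sum>k\<in>UNIV. coord E k (E l) * struct_const br E k i r)
      - dw E l (dw E i (\<gamma> r)) m) / 2"
    by (simp add: dw_def[of E l] frechet_derivative_eqI)
  then show ?thesis
    by (simp add: coord_basis[OF E] if_distrib[of "\<lambda>x. x * _"] cong: if_cong)
qed

text \<open>Trading \<partial>\<gamma> for a commutator puts \<gamma>(f) under the w-derivative,
  where the condition on \<gamma>(k_ij) can be substituted.\<close>

lemma dhor_eq:
  fixes E :: "'n::finite \<Rightarrow> 'g::euclidean_space"
  assumes "\<And>i. smooth (\<gamma> i)" "smooth f"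
  shows "dhor br E \<gamma> l f m = (\<Sum>r\<in>UNIV. lam br E \<gamma> l r m * dw E r f m)
    + dw E l (dgam E \<gamma> f) m - dgam E \<gamma> (dw E l f) m"
  by (simp add: dhor_def dw_dgam[OF assms] distrib_right sum.distrib)

section \<open>Symmetry of the horizontal derivatives of a multiplier\<close>

lemma reduced_helmholtzD:
  assumes "reduced_helmholtz br E \<gamma> k"
  shows "smooth (k i j)" and "k i j = k j i" and "dw E i (k j l) = dw E j (k i l)"
    and "dgam E \<gamma> (k i j) m =
      (\<Sum>l\<in>UNIV. k l j m * lam br E \<gamma> i l m) + (\<Sum>l\<in>UNIV. k i l m * lam br E \<gamma> j l m)"
proof -
  note k = assms[unfolded reduced_helmholtz_def]
  show "smooth (k i j)" using k by blast
  show "k i j = k j i" "dw E i (k j l) = dw E j (k i l)" by (rule ext; use k in blast)+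
  have "dgam E \<gamma> (k i j) m
      - (\<Sum>l\<in>UNIV. k l j m * lam br E \<gamma> i l m) - (\<Sum>l\<in>UNIV. k i l m * lam br E \<gamma> j l m) = 0"
    using k by blast
  then show "dgam E \<gamma> (k i j) m =
      (\<Sum>l\<in>UNIV. k l j m * lam br E \<gamma> i l m) + (\<Sum>l\<in>UNIV. k i l m * lam br E \<gamma> j l m)"
    by linarith
qed

text \<open>Commuting \<open>\<gamma>\<close> with \<open>\<partial>/\<partial>w\<^sup>l\<close> in \<open>\<gamma>(k\<^sub>i\<^sub>j) = k\<^sub>r\<^sub>j\<lambda>\<^sub>i\<^sup>r + k\<^sub>i\<^sub>r\<lambda>\<^sub>j\<^sup>r\<close> writes \<open>Q\<^sub>i\<^sub>j\<^sub>l\<close> as an expression whose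
  total symmetry follows from that of \<open>\<partial>k\<^sub>i\<^sub>j/\<partial>w\<^sup>l\<close>.\<close>

lemma horizontal_derivative_formula:
  fixes E :: "'n::finite \<Rightarrow> 'g::euclidean_space"
  assumes lie: "lie_algebra br" and E: "is_basis E" and \<gamma>: "\<And>i. smooth (\<gamma> i)"
    and k: "reduced_helmholtz br E \<gamma> k"
  shows "- dhor br E \<gamma> l (k i j) m - horizontal_coeff br E \<gamma> (\<lambda>a b. k a b m) i j l m =
    dgam E \<gamma> (dw E l (k i j)) m
    - (\<Sum>r\<in>UNIV. lam br E \<gamma> l r m * dw E r (k i j) m + lam br E \<gamma> i r m * dw E l (k r j) m
        + lam br E \<gamma> j r m * dw E l (k i r) m
        - (k r j m * dw E l (dw E i (\<gamma> r)) m + k r i m * dw E l (dw E j (\<gamma> r)) m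
           + k r l m * dw E i (dw E j (\<gamma> r)) m) / 2)"
proof -
  let ?lm = "lam br E \<gamma>"
  let ?C = "struct_const br E"
  note sk = reduced_helmholtzD(1)[OF k] and sym = reduced_helmholtzD(2)[OF k]
  have sl: "smooth (?lm i j)" for i j by (rule smooth_lam[OF E \<gamma>])
  have C: "?C a b r = - ?C b a r" for a b r
    using lie_algebra_antisym[OF lie, of "E a" "E b"]
    by (simp add: struct_const_def linear_neg[OF coord_linear[OF E]])
  have "dgam E \<gamma> (k i j) = (\<lambda>m. (\<Sum>r\<in>UNIV. k r j m * ?lm i r m) + (\<Sum>r\<in>UNIV. k i r m * ?lm j r m))"
    by (rule ext) (rule reduced_helmholtzD(4)[OF k])
  then have "dw E l (dgam E \<gamma> (k i j)) m =
    (\<Sum>r\<in>UNIV. k r j m * dw E l (?lm i r) m + dw E l (k r j) m * ?lm i r m)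
    + (\<Sum>r\<in>UNIV. k i r m * dw E l (?lm j r) m + dw E l (k i r) m * ?lm j r m)"
    by (simp add: dw_add dw_sum_mult smooth_sum smooth_mult sk sl)
  moreover have "horizontal_coeff br E \<gamma> (\<lambda>a b. k a b m) i j l m = (\<Sum>r\<in>UNIV. (- (k r i m * ?C l j r)
      - k r j m * ?C l i r - k r l m * dw E i (dw E j (\<gamma> r)) m) / 2)"
    unfolding horizontal_coeff_def C[of j l] C[of i l] by (simp add: sum_divide_distrib)
  \<comment> \<open>The structure constants from \<open>dw_lam\<close> and from
    \<open>horizontal_coeff\<close> cancel; halves of second derivatives of \<gamma> remain, one for
    each of the three indices paired with k.\<close>
  moreover have "(\<Sum>r\<in>UNIV. ?lm l r m * dw E r (k i j) m)
     + ((\<Sum>r\<in>UNIV. k r j m * dw E l (?lm i r) m + dw E l (k r j) m * ?lm i r m)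
     + (\<Sum>r\<in>UNIV. k i r m * dw E l (?lm j r) m + dw E l (k i r) m * ?lm j r m))
     + (\<Sum>r\<in>UNIV. (- (k r i m * ?C l j r) - k r j m * ?C l i r - k r l m * dw E i (dw E j (\<gamma> r)) m) / 2) =
    (\<Sum>r\<in>UNIV. ?lm l r m * dw E r (k i j) m + ?lm i r m * dw E l (k r j) m + ?lm j r m * dw E l (k i r) m
        - (k r j m * dw E l (dw E i (\<gamma> r)) m + k r i m * dw E l (dw E j (\<gamma> r)) m
           + k r l m * dw E i (dw E j (\<gamma> r)) m) / 2)"
    unfolding sum.distrib[symmetric] dw_lam[OF E \<gamma>] sym[of i]
    by (intro sum.cong refl) (simp add: field_simps)
  ultimately show ?thesis
    unfolding dhor_eq[OF \<gamma> sk] by linarith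
qed

text \<open>Two neighbouring transpositions generate all permutations of i, j, l. Each permutes the
  three \<lambda>-terms and the three second-derivative terms among themselves.\<close>

lemma horizontal_derivative_symmetric:
  fixes E :: "'n::finite \<Rightarrow> 'g::euclidean_space" and \<gamma> :: "'n \<Rightarrow> real \<times> 'g \<Rightarrow> real"
    and k :: "'n \<Rightarrow> 'n \<Rightarrow> real \<times> 'g \<Rightarrow> real"
  defines "Q \<equiv> \<lambda>br i j l m. - dhor br E \<gamma> l (k i j) m - horizontal_coeff br E \<gamma> (\<lambda>a b. k a b m) i j l m"
  assumes lie: "lie_algebra br" and E: "is_basis E" and \<gamma>: "\<And>i. smooth (\<gamma> i)"
    and k: "reduced_helmholtz br E \<gamma> k"
  shows "Q br i j l m = Q br j i l m" "Q br i j l m = Q br i l j m"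
proof -
  note sym = reduced_helmholtzD(2)[OF k] and K = reduced_helmholtzD(3)[OF k]
  have K': "dw E a (k b c) = dw E a (k c b)" for a b c by (simp add: sym[of b c])
  have G: "dw E a (dw E b (\<gamma> r)) m = dw E b (dw E a (\<gamma> r)) m" for a b r
    by (rule dw_symmetric[OF \<gamma>])
  show "Q br i j l m = Q br j i l m"
    unfolding Q_def horizontal_derivative_formula[OF lie E \<gamma> k] sym[of j i]
  proof (rule arg_cong2[of _ _ _ _ "(-)"], rule refl, rule sum.cong, rule refl)
    fix r
    show "lam br E \<gamma> l r m * dw E r (k i j) m + lam br E \<gamma> i r m * dw E l (k r j) m
        + lam br E \<gamma> j r m * dw E l (k i r) m
        - (k r j m * dw E l (dw E i (\<gamma> r)) m + k r i m * dw E l (dw E j (\<gamma> r)) m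
           + k r l m * dw E i (dw E j (\<gamma> r)) m) / 2 =
      lam br E \<gamma> l r m * dw E r (k i j) m + lam br E \<gamma> j r m * dw E l (k r i) m
        + lam br E \<gamma> i r m * dw E l (k j r) m
        - (k r i m * dw E l (dw E j (\<gamma> r)) m + k r j m * dw E l (dw E i (\<gamma> r)) m
           + k r l m * dw E j (dw E i (\<gamma> r)) m) / 2"
      unfolding sym[of r i] sym[of j r] G[of j i] by (simp add: add_ac)
  qed
  \<comment> \<open>The derivatives of k are rewritten so that exchanging j and l swaps the terms
    carrying \<lambda>_j and \<lambda>_l and preserves the one carrying \<lambda>_i.\<close>
  have e: "dw E l (k i j) = dw E j (k i l)" "dw E l (k r j) = dw E j (k r l)"
    "dw E l (k i r) = dw E r (k i l)" "dw E r (k i j) = dw E j (k i r)" for r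
    using K K' by metis+
  show "Q br i j l m = Q br i l j m"
    unfolding Q_def horizontal_derivative_formula[OF lie E \<gamma> k] e(1)
  proof (rule arg_cong2[of _ _ _ _ "(-)"], rule refl, rule sum.cong, rule refl)
    fix r
    show "lam br E \<gamma> l r m * dw E r (k i j) m + lam br E \<gamma> i r m * dw E l (k r j) m
        + lam br E \<gamma> j r m * dw E l (k i r) m
        - (k r j m * dw E l (dw E i (\<gamma> r)) m + k r i m * dw E l (dw E j (\<gamma> r)) m
           + k r l m * dw E i (dw E j (\<gamma> r)) m) / 2 =
      lam br E \<gamma> j r m * dw E r (k i l) m + lam br E \<gamma> i r m * dw E j (k r l) m
        + lam br E \<gamma> l r m * dw E j (k i r) m
        - (k r l m * dw E j (dw E i (\<gamma> r)) m + k r i m * dw E j (dw E l (\<gamma> r)) m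
           + k r j m * dw E i (dw E l (\<gamma> r)) m) / 2"
      unfolding e(2)[of r] e(3)[of r] e(4)[of r] G[of i l] G[of i j] G[of l j]
      by (simp add: add_ac)
  qed
qed

section \<open>Smooth sections from symmetric arrays\<close>

lemma Mbar_section:
  fixes s :: "'n::finite \<Rightarrow> 'n \<Rightarrow> real \<times> 'g::euclidean_space \<Rightarrow> real"
    and P Q :: "'n \<Rightarrow> 'n \<Rightarrow> 'n \<Rightarrow> real \<times> 'g \<Rightarrow> real"
  assumes "\<And>i j. smooth (s i j)" "\<And>i j k. smooth (P i j k)" "\<And>i j k. smooth (Q i j k)"
    and s: "\<And>i j. s i j = s j i"
    and P: "\<And>i j k. P i j k = P j i k" "\<And>i j k. P i j k = P i k j"
    and Q: "\<And>i j k. Q i j k = Q j i k" "\<And>i j k. Q i j k = Q i k j"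
  shows "\<exists>\<iota> :: real \<times> 'g \<Rightarrow> ('g, 'n) Mbar. smooth \<iota> \<and> (\<forall>m. fst (\<iota> m) = m \<and>
    (\<forall>i j. s_co i j (\<iota> m) = s i j m) \<and>
    (\<forall>i j k. P_co i j k (\<iota> m) = P i j k m \<and> Q_co i j k (\<iota> m) = Q i j k m))"
proof -
  \<comment> \<open>Pointwise existence of coordinates would not give smoothness, so one ordered
    representative is chosen for each multiset, independently of the base point.\<close>
  have "\<exists>p. A = Abs_idx2 {#fst p, snd p#}" for A :: "'n idx2"
    by (cases A rule: idx2_cases) auto
  then obtain a where a: "\<And>A :: 'n idx2. A = Abs_idx2 {#fst (a A), snd (a A)#}" by metis
  have "\<exists>p. A = Abs_idx3 {#fst p, fst (snd p), snd (snd p)#}" for A :: "'n idx3"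
    by (cases A rule: idx3_cases) auto
  then obtain b where b: "\<And>A :: 'n idx3. A = Abs_idx3 {#fst (b A), fst (snd (b A)), snd (snd (b A))#}" by metis
  define \<iota> :: "real \<times> 'g \<Rightarrow> ('g, 'n) Mbar" where "\<iota> m = (m, \<chi> A. s (fst (a A)) (snd (a A)) m,
    \<chi> A. P (fst (b A)) (fst (snd (b A))) (snd (snd (b A))) m,
    \<chi> A. Q (fst (b A)) (fst (snd (b A))) (snd (snd (b A))) m)" for m
  have 2: "s i' j' = s i j" if "{#i', j'#} = {#i, j#}" for i j i' j'
    using that s by (auto simp: add_eq_conv_ex)
  have 3: "R i' j' k' = R i j k" if "{#i', j', k'#} = {#i, j, k#}"
    "\<And>i j k. R i j k = R j i k" "\<And>i j k. R i j k = R i k j"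
    for R :: "'n \<Rightarrow> 'n \<Rightarrow> 'n \<Rightarrow> real \<times> 'g \<Rightarrow> real" and i j k i' j' k'
    using that(1) that(2,3) by (auto simp: add_eq_conv_ex)
  have "smooth \<iota>"
    unfolding \<iota>_def[abs_def] by (intro smooth_Pair smooth_ident smooth_vec_lambda assms)
  moreover have "s_co i j (\<iota> m) = s i j m" for i j m
    using 2[OF a[of "Abs_idx2 {#i, j#}", symmetric, unfolded Abs_idx_eq]] by (simp add: s_co_def \<iota>_def)
  moreover have "P_co i j k (\<iota> m) = P i j k m" for i j k m
    using 3[where R = P, OF b[of "Abs_idx3 {#i, j, k#}", symmetric, unfolded Abs_idx_eq] P]
    by (simp add: P_co_def \<iota>_def)
  moreover have "Q_co i j k (\<iota> m) = Q i j k m" for i j k m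
    using 3[where R = Q, OF b[of "Abs_idx3 {#i, j, k#}", symmetric, unfolded Abs_idx_eq] Q]
    by (simp add: Q_co_def \<iota>_def)
  moreover have "fst (\<iota> m) = m" for m by (simp add: \<iota>_def)
  ultimately show ?thesis by blast
qed

section \<open>Multipliers and integral manifolds\<close>

text \<open>P and Q are forced, since W_l and H_l each isolate one of them in \<sigma>_ij; their
  total symmetry makes them coordinates of a section of p.\<close>

lemma integral_manifold_of_multiplier:
  fixes br :: "'g::euclidean_space \<Rightarrow> 'g \<Rightarrow> 'g" and E :: "'n::finite \<Rightarrow> 'g"
  assumes lie: "lie_algebra br" and E: "is_basis E" and \<gamma>: "\<And>i. smooth (\<gamma> i)"
    and k: "reduced_helmholtz br E \<gamma> k"
  obtains \<iota> :: "real \<times> 'g \<Rightarrow> ('g, 'n) Mbar" where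
    "integral_manifold (ip_algebroid br)
       (differential_ideal_generated (ip_prolongation br) {sigma_form br E \<gamma> i j | i j. True}) \<iota>"
    "\<And>i j m. s_co i j (\<iota> m) = k i j m"
proof -
  note sk = reduced_helmholtzD(1)[OF k] and sym = reduced_helmholtzD(2)[OF k]
    and K = reduced_helmholtzD(3)[OF k] and nab = reduced_helmholtzD(4)[OF k]
  define P where "P i j l m = - dw E l (k i j) m" for i j l m
  define Q where "Q i j l m = - dhor br E \<gamma> l (k i j) m - horizontal_coeff br E \<gamma> (\<lambda>a b. k a b m) i j l m" for i j l m
  have sP: "smooth (P i j l)" for i j l
    unfolding P_def[abs_def] by (intro smooth_minus smooth_dw sk)
  have sQ: "smooth (Q i j l)" for i j l
    unfolding Q_def[abs_def] dhor_def horizontal_coeff_def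
    by (intro smooth_minus smooth_diff smooth_add smooth_sum smooth_mult smooth_divide smooth_const
        smooth_lam[OF E \<gamma>] smooth_dw \<gamma> sk)
  have P: "P i j l = P j i l" "P i j l = P i l j" for i j l
    unfolding P_def[abs_def] sym[of i j] using K[of l j i] K[of j i l] K[of j l i] sym[of l i] by simp_all
  have Q: "Q i j l = Q j i l" "Q i j l = Q i l j" for i j l
    using horizontal_derivative_symmetric[OF lie E \<gamma> k] by (auto simp: Q_def fun_eq_iff)
  obtain \<iota> :: "real \<times> 'g \<Rightarrow> ('g, 'n) Mbar" where \<iota>: "smooth \<iota>" "\<And>m. fst (\<iota> m) = m"
    "\<And>i j m. s_co i j (\<iota> m) = k i j m" "\<And>i j k m. P_co i j k (\<iota> m) = P i j k m"
    "\<And>i j k m. Q_co i j k (\<iota> m) = Q i j k m"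
    using Mbar_section[of k P Q, OF sk sP sQ sym P Q] by blast
  let ?J = "{\<theta> \<in> forms (ip_prolongation br). pullback (ip_algebroid br) \<iota> \<theta> = (\<lambda>m vs. 0)}"
  \<comment> \<open>The coefficients of \<open>fst a\<close>, \<open>psi\<close> and
    \<open>theta\<close> vanish separately: the first by the condition on \<gamma>(k_ij), the others
    by the choice of P and Q.\<close>
  have "sigma_value br E \<gamma> i j (\<iota> m) a
       (frechet_derivative (\<lambda>m. s_co i j (\<iota> m)) (at m) (ip_anchor br m a)) = 0" for i j m a
    unfolding sigma_value_def \<iota> derivative_along_anchor[OF lie E smooth_differentiable[OF sk], of _ _ _ a \<gamma>]
    by (simp add: nab P_def Q_def sum_negf distrib_right left_diff_distrib sum.distrib sum_subtractf
        sym[of _ i] mult.commute algebra_simps)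
  then have "pullback (ip_algebroid br) \<iota> (sigma_form br E \<gamma> i j) = (\<lambda>m vs. 0)" for i j
    unfolding pullback_sigma_form[OF lie \<iota>(1,2)] by blast
  then have "{sigma_form br E \<gamma> i j | i j. True} \<subseteq> ?J"
    using sigma_form_form[of br E \<gamma>, OF lie E \<gamma>] by blast
  moreover have "differential_ideal (ip_prolongation br) ?J"
    unfolding ip_prolongation_def by (rule pullback_kernel_differential_ideal[OF lie \<iota>(1,2)])
  ultimately have "differential_ideal_generated (ip_prolongation br) {sigma_form br E \<gamma> i j | i j. True} \<subseteq> ?J"
    unfolding differential_ideal_generated_def by blast
  then have "integral_manifold (ip_algebroid br)
       (differential_ideal_generated (ip_prolongation br) {sigma_form br E \<gamma> i j | i j. True}) \<iota>"
    using \<iota>(1,2) unfolding integral_manifold_def by blast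
  then show thesis using \<iota>(3) by (rule that)
qed

text \<open>As test vectors, \<Gamma>_0 yields the condition on \<gamma>(k_ij), and W_l equates
  derivatives of k with - P_ijl, whose total symmetry is built into the fibre coordinates.\<close>

lemma multiplier_of_integral_manifold:
  fixes br :: "'g::euclidean_space \<Rightarrow> 'g \<Rightarrow> 'g" and E :: "'n::finite \<Rightarrow> 'g"
    and \<iota> :: "real \<times> 'g \<Rightarrow> ('g, 'n) Mbar"
  assumes lie: "lie_algebra br" and E: "is_basis E" and \<gamma>: "\<And>i. smooth (\<gamma> i)"
    and ideal: "differential_ideal (ip_algebroid br)
      (algebraic_ideal_generated (ip_algebroid br) (Sigma0 br E \<gamma>))"
    and int: "integral_manifold (ip_algebroid br)
       (differential_ideal_generated (ip_prolongation br) {sigma_form br E \<gamma> i j | i j. True}) \<iota>"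
    and det: "\<And>m. det (\<chi> i j. s_co i j (\<iota> m)) \<noteq> 0"
  shows "reduced_helmholtz br E \<gamma> (\<lambda>i j m. s_co i j (\<iota> m))"
proof -
  have \<iota>: "smooth \<iota>" "\<And>m. fst (\<iota> m) = m" using int by (auto simp: integral_manifold_def)
  define k where "k i j m = s_co i j (\<iota> m)" for i j m
  have sk: "smooth (k i j)" for i j
    unfolding k_def[abs_def] by (rule smooth_linear_left[OF s_co_bounded_linear \<iota>(1)])
  have sym: "k i j m = k j i m" for i j m by (simp add: k_def co_symmetric(1)[of i j])
  have "sigma_form br E \<gamma> i j \<in> differential_ideal_generated (ip_prolongation br) {sigma_form br E \<gamma> i j | i j. True}" for i j
    unfolding differential_ideal_generated_def by blast
  then have "pullback (ip_algebroid br) \<iota> (sigma_form br E \<gamma> i j) = (\<lambda>m vs. 0)" for i j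
    using int unfolding integral_manifold_def by blast
  then have "sigma_value br E \<gamma> i j (\<iota> m) a (frechet_derivative (k i j) (at m) (ip_anchor br m a)) = 0" for i j m a
    unfolding pullback_sigma_form[OF lie \<iota>] k_def[abs_def] by blast
  note S = this[unfolded derivative_along_anchor[OF lie E smooth_differentiable[OF sk], of _ _ _ _ \<gamma>]
      sigma_value_def \<iota>(2)]
  have dual: "fst (Gamma_sec E \<gamma> m) = 1" "psi br E \<gamma> l m (Gamma_sec E \<gamma> m) = 0" "theta E l m (Gamma_sec E \<gamma> m) = 0"
    "fst (W_sec E j m) = 0" "psi br E \<gamma> l m (W_sec E j m) = (if l = j then 1 else 0)" "theta E l m (W_sec E j m) = 0"
    for l j m
  proof -
    show "psi br E \<gamma> l m (Gamma_sec E \<gamma> m) = 0" "psi br E \<gamma> l m (W_sec E j m) = (if l = j then 1 else 0)"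
      using dual_basis(4)[OF E, of br \<gamma> l m] dual_basis(5)[OF E, of br \<gamma> l m j]
      by (simp_all add: Psi_form_alt one_form_def)
    have "Theta_form E l m [Gamma_sec E \<gamma> m] = 0" "Theta_form E l m [W_sec E j m] = 0"
      by (rule dual_basis(7,8)[OF E])+
    then show "theta E l m (Gamma_sec E \<gamma> m) = 0" "theta E l m (W_sec E j m) = 0"
      by (simp_all add: Theta_form_alt one_form_def)
  qed (simp_all add: Gamma_sec_eq W_sec_def)
  have nab: "dgam E \<gamma> (k i j) m - (\<Sum>l\<in>UNIV. k l j m * lam br E \<gamma> i l m) - (\<Sum>l\<in>UNIV. k i l m * lam br E \<gamma> j l m) = 0" for i j m
    using S[where i = i and j = j and m = m and a = "Gamma_sec E \<gamma> m"] by (simp add: dual k_def[symmetric] sum.distrib sym[of _ i])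
  have "dw E l (k i j) m = - P_co i j l (\<iota> m)" for i j l m
    using S[where i = i and j = j and m = m and a = "W_sec E l m"]
    by (simp add: dual if_distrib[of "\<lambda>c. c * _"] if_distrib[of "\<lambda>c. _ * c"] cong: if_cong)
  then have K: "dw E i (k j l) m = dw E j (k i l) m" for i j l m
    using co_symmetric(2,3) by metis
  \<comment> \<open>With \<phi> equal to \<mu> times the identity, both sides are \<mu> times an
    entry of the symmetric matrix k.\<close>
  have "(\<Sum>l\<in>UNIV. k l i m * phi br E \<gamma> j l m) = (\<Sum>l\<in>UNIV. k l j m * phi br E \<gamma> i l m)" for i j m
  proof -
    obtain \<mu> where "\<And>k i. phi br E \<gamma> k i m = \<mu> * of_bool (i = k)"
      using phi_scalar_of_ideal[OF lie E \<gamma> ideal] by blast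
    then show ?thesis
      using sym[of i j m] by (simp add: of_bool_def if_distrib[of "\<lambda>c. _ * c"] cong: if_cong)
  qed
  then have "reduced_helmholtz br E \<gamma> k"
    unfolding reduced_helmholtz_def using sk sym nab K det by (simp add: k_def)
  then show ?thesis by (simp add: k_def[abs_def])
qed

theorem theorem3:
  fixes br :: "'g::euclidean_space \<Rightarrow> 'g \<Rightarrow> 'g"
    and E :: "'n::finite \<Rightarrow> 'g"
    and \<gamma> :: "'n \<Rightarrow> real \<times> 'g \<Rightarrow> real"
  assumes "lie_algebra br"
    and "is_basis E"
    and "\<And>i. smooth (\<gamma> i)"
    and "differential_ideal (ip_algebroid br)
           (algebraic_ideal_generated (ip_algebroid br) (Sigma0 br E \<gamma>))"
  shows "(\<exists>k :: 'n \<Rightarrow> 'n \<Rightarrow> real \<times> 'g \<Rightarrow> real. reduced_helmholtz br E \<gamma> k) \<longleftrightarrow>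
    (\<exists>\<iota> :: real \<times> 'g \<Rightarrow> ('g, 'n) Mbar.
       integral_manifold (ip_algebroid br)
         (differential_ideal_generated (ip_prolongation br) {sigma_form br E \<gamma> i j | i j. True}) \<iota>
       \<and> (\<forall>m. det (\<chi> i j. s_co i j (\<iota> m)) \<noteq> 0))"
proof
  assume "\<exists>k :: 'n \<Rightarrow> 'n \<Rightarrow> real \<times> 'g \<Rightarrow> real. reduced_helmholtz br E \<gamma> k"
  then obtain k :: "'n \<Rightarrow> 'n \<Rightarrow> real \<times> 'g \<Rightarrow> real" where k: "reduced_helmholtz br E \<gamma> k" by blast
  obtain \<iota> :: "real \<times> 'g \<Rightarrow> ('g, 'n) Mbar" where \<iota>: "integral_manifold (ip_algebroid br)
       (differential_ideal_generated (ip_prolongation br) {sigma_form br E \<gamma> i j | i j. True}) \<iota>"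
    "\<And>i j m. s_co i j (\<iota> m) = k i j m"
    using integral_manifold_of_multiplier[OF assms(1-3) k] by blast
  have "\<forall>m. det (\<chi> i j. s_co i j (\<iota> m)) \<noteq> 0" using k by (simp add: \<iota>(2) reduced_helmholtz_def)
  then show "\<exists>\<iota> :: real \<times> 'g \<Rightarrow> ('g, 'n) Mbar. integral_manifold (ip_algebroid br)
         (differential_ideal_generated (ip_prolongation br) {sigma_form br E \<gamma> i j | i j. True}) \<iota>
       \<and> (\<forall>m. det (\<chi> i j. s_co i j (\<iota> m)) \<noteq> 0)"
    using \<iota>(1) by blast
next
  assume "\<exists>\<iota> :: real \<times> 'g \<Rightarrow> ('g, 'n) Mbar. integral_manifold (ip_algebroid br)
         (differential_ideal_generated (ip_prolongation br) {sigma_form br E \<gamma> i j | i j. True}) \<iota>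
       \<and> (\<forall>m. det (\<chi> i j. s_co i j (\<iota> m)) \<noteq> 0)"
  then show "\<exists>k :: 'n \<Rightarrow> 'n \<Rightarrow> real \<times> 'g \<Rightarrow> real. reduced_helmholtz br E \<gamma> k"
    using multiplier_of_integral_manifold[OF assms] by blast
qed

end
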